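(* Let $K$ be a non-archimedean local field, $r\ge1$ an integer, and for each $n$ let $G_n=\langle g_{1_n},\dots,g_{r_n}\rangle$ be a discrete non-elementary subgroup of $\mathrm{SL}_2(K)$. Suppose $\{G_n\}$ converges algebraically to $G=\langle g_1,\dots,g_r\rangle\le\mathrm{SL}_2(K)$, in the sense that for every word $w$ in the free group $F_r$ on $r$ letters, $w(g_{1_n},\dots,g_{r_n})$ converges in $\mathrm{SL}_2(K)$, with $g_i=\lim_n g_{i_n}$ and $G$ the set of these limits. Then $G$ is discrete and non-elementary, and for all sufficiently large $n$ the assignment $g_i\mapsto g_{i_n}$ ($i=1,\dots,r$) extends to a surjective homomorphism $\psi_n:G\to G_n$.
   Context: A non-archimedean local field is a finite extension of $\mathbb{Q}_p$ or $\mathbb{F}_q((t))$. $\mathrm{SL}_2(K)$ has the subspace topology from $K^4$ and acts by isometries on its Bruhat–Tits tree $T_K$. A subgroup is elementary if it stabilises a vertex, an end, or a pair of ends of $T_K$, and non-elementary otherwise. *)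

theory Defs
  imports Complex_Main
begin

text \<open>A non-archimedean local field is represented by a field type together with an
absolute value a. It is non-archimedean (ultrametric), nontrivial and discrete
(values of nonzero elements lie in the cyclic group generated by some 0 < c < 1),
complete, and has finite residue field O/m. These are exactly the finite extensions
of Q_p and of F_q((t)).\<close>

definition k_converges :: "('k::field \<Rightarrow> real) \<Rightarrow> (nat \<Rightarrow> 'k) \<Rightarrow> 'k \<Rightarrow> bool" where
  "k_converges a f l \<longleftrightarrow> (\<forall>e>0. \<exists>N. \<forall>n\<ge>N. a (f n - l) < e)"

definition nonarch_local_field :: "('k::field \<Rightarrow> real) \<Rightarrow> bool" where
  "nonarch_local_field a \<longleftrightarrow>
     (\<forall>x. 0 \<le> a x) \<and> (\<forall>x. a x = 0 \<longleftrightarrow> x = 0) \<and>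
     (\<forall>x y. a (x * y) = a x * a y) \<and>
     (\<forall>x y. a (x + y) \<le> max (a x) (a y)) \<and>
     (\<exists>x. x \<noteq> 0 \<and> a x \<noteq> 1) \<and>
     (\<exists>c. 0 < c \<and> c < 1 \<and> (\<forall>x. x \<noteq> 0 \<longrightarrow> (\<exists>k::int. a x = c powi k))) \<and>
     (\<forall>f::nat \<Rightarrow> 'k. (\<forall>e>0. \<exists>N. \<forall>m\<ge>N. \<forall>n\<ge>N. a (f m - f n) < e)
          \<longrightarrow> (\<exists>l. k_converges a f l)) \<and>
     finite ({x. a x \<le> 1} // {(x, y). a x \<le> 1 \<and> a y \<le> 1 \<and> a (x - y) < 1})"

definition intO :: "('k::field \<Rightarrow> real) \<Rightarrow> 'k set" where
  "intO a = {x. a x \<le> 1}"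

definition uniformizer :: "('k::field \<Rightarrow> real) \<Rightarrow> 'k \<Rightarrow> bool" where
  "uniformizer a p \<longleftrightarrow> p \<noteq> 0 \<and> a p < 1 \<and> (\<forall>x. a x < 1 \<longrightarrow> a x \<le> a p)"

text \<open>A matrix (a,b,c,d) stands for [[a,b],[c,d]].\<close>
type_synonym 'k mat2 = "'k \<times> 'k \<times> 'k \<times> 'k"

fun mmul :: "'k::field mat2 \<Rightarrow> 'k mat2 \<Rightarrow> 'k mat2" where
  "mmul (a, b, c, d) (e, f, g, h) = (a*e + b*g, a*f + b*h, c*e + d*g, c*f + d*h)"

fun det2 :: "'k::field mat2 \<Rightarrow> 'k" where
  "det2 (a, b, c, d) = a*d - b*c"

text \<open>Inverse of a determinant-one matrix (the adjugate).\<close>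
fun inv2 :: "'k::field mat2 \<Rightarrow> 'k mat2" where
  "inv2 (a, b, c, d) = (d, -b, -c, a)"

definition id2 :: "'k::field mat2" where
  "id2 = (1, 0, 0, 1)"

fun mapply :: "'k::field mat2 \<Rightarrow> 'k \<times> 'k \<Rightarrow> 'k \<times> 'k" where
  "mapply (a, b, c, d) (x, y) = (a*x + b*y, c*x + d*y)"

definition SL2 :: "'k::field mat2 set" where
  "SL2 = {m. det2 m = 1}"

text \<open>Topology of SL_2(K) as a subspace of K^4: the max metric on entries.\<close>
fun mdist :: "('k::field \<Rightarrow> real) \<Rightarrow> 'k mat2 \<Rightarrow> 'k mat2 \<Rightarrow> real" where
  "mdist a (x1, x2, x3, x4) (y1, y2, y3, y4) =
     max (max (a (x1 - y1)) (a (x2 - y2))) (max (a (x3 - y3)) (a (x4 - y4)))"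

definition mconverges :: "('k::field \<Rightarrow> real) \<Rightarrow> (nat \<Rightarrow> 'k mat2) \<Rightarrow> 'k mat2 \<Rightarrow> bool" where
  "mconverges a f l \<longleftrightarrow> (\<forall>e>0. \<exists>N. \<forall>n\<ge>N. mdist a (f n) l < e)"

definition discrete_subgroup :: "('k::field \<Rightarrow> real) \<Rightarrow> 'k mat2 set \<Rightarrow> bool" where
  "discrete_subgroup a G \<longleftrightarrow> (\<forall>x\<in>G. \<exists>e>0. \<forall>y\<in>G. mdist a x y < e \<longrightarrow> y = x)"

text \<open>A word is a list of letters (i, True) = x_i and (i, False) = x_i^{-1}.\<close>
definition valid_word :: "nat \<Rightarrow> (nat \<times> bool) list \<Rightarrow> bool" where
  "valid_word r w \<longleftrightarrow> (\<forall>l\<in>set w. fst l < r)"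

fun eval_word :: "(nat \<Rightarrow> 'k::field mat2) \<Rightarrow> (nat \<times> bool) list \<Rightarrow> 'k mat2" where
  "eval_word g [] = id2"
| "eval_word g ((i, b) # w) = mmul (if b then g i else inv2 (g i)) (eval_word g w)"

definition gen_grp :: "(nat \<Rightarrow> 'k::field mat2) \<Rightarrow> nat \<Rightarrow> 'k mat2 set" where
  "gen_grp g r = {eval_word g w | w. valid_word r w}"

definition lattice :: "('k::field \<Rightarrow> real) \<Rightarrow> ('k \<times> 'k) set \<Rightarrow> bool" where
  "lattice a L \<longleftrightarrow> (\<exists>m. det2 m \<noteq> 0 \<and> L = {mapply m (s, t) | s t. s \<in> intO a \<and> t \<in> intO a})"

definition scale :: "'k::field \<Rightarrow> ('k \<times> 'k) set \<Rightarrow> ('k \<times> 'k) set" where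
  "scale c L = (\<lambda>(x, y). (c * x, c * y)) ` L"

definition lattice_class :: "('k::field \<times> 'k) set \<Rightarrow> ('k \<times> 'k) set set" where
  "lattice_class L = {scale c L | c. c \<noteq> 0}"

definition BT_vertices :: "('k::field \<Rightarrow> real) \<Rightarrow> ('k \<times> 'k) set set set" where
  "BT_vertices a = {lattice_class L | L. lattice a L}"

definition BT_adj :: "('k::field \<Rightarrow> real) \<Rightarrow> ('k \<times> 'k) set set \<Rightarrow> ('k \<times> 'k) set set \<Rightarrow> bool" where
  "BT_adj a x y \<longleftrightarrow> x \<in> BT_vertices a \<and> y \<in> BT_vertices a \<and>
     (\<exists>p L L'. uniformizer a p \<and> L \<in> x \<and> L' \<in> y \<and> L' \<subset> L \<and> scale p L \<subset> L')"

definition act_vertex :: "'k::field mat2 \<Rightarrow> ('k \<times> 'k) set set \<Rightarrow> ('k \<times> 'k) set set" where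
  "act_vertex g x = (\<lambda>L. mapply g ` L) ` x"

text \<open>Geodesic rays (non-backtracking infinite paths); ends are their classes under
eventual coincidence up to shift.\<close>
definition BT_ray :: "('k::field \<Rightarrow> real) \<Rightarrow> (nat \<Rightarrow> ('k \<times> 'k) set set) \<Rightarrow> bool" where
  "BT_ray a \<rho> \<longleftrightarrow> (\<forall>i. \<rho> i \<in> BT_vertices a) \<and> (\<forall>i. BT_adj a (\<rho> i) (\<rho> (Suc i))) \<and>
                  (\<forall>i. \<rho> (Suc (Suc i)) \<noteq> \<rho> i)"

definition same_end :: "(nat \<Rightarrow> 'v) \<Rightarrow> (nat \<Rightarrow> 'v) \<Rightarrow> bool" where
  "same_end \<rho> \<sigma> \<longleftrightarrow> (\<exists>m n. \<forall>i. \<rho> (m + i) = \<sigma> (n + i))"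

definition elementary :: "('k::field \<Rightarrow> real) \<Rightarrow> 'k mat2 set \<Rightarrow> bool" where
  "elementary a G \<longleftrightarrow>
     (\<exists>v\<in>BT_vertices a. \<forall>g\<in>G. act_vertex g v = v) \<or>
     (\<exists>\<rho>. BT_ray a \<rho> \<and> (\<forall>g\<in>G. same_end (act_vertex g \<circ> \<rho>) \<rho>)) \<or>
     (\<exists>\<rho> \<sigma>. BT_ray a \<rho> \<and> BT_ray a \<sigma> \<and> \<not> same_end \<rho> \<sigma> \<and>
        (\<forall>g\<in>G. (same_end (act_vertex g \<circ> \<rho>) \<rho> \<and> same_end (act_vertex g \<circ> \<sigma>) \<sigma>) \<or>
                (same_end (act_vertex g \<circ> \<rho>) \<sigma> \<and> same_end (act_vertex g \<circ> \<sigma>) \<rho>)))"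

end

theory Submission
  imports Defs "HOL-Computational_Algebra.Primes"
begin

text \<open>
  Write \<open>N\<close> for the maximum norm on matrices. By the Pluecker relation,
  \<open>E x y = N (x\<^sup>-\<^sup>1 y)\<close> satisfies the four-point inequality of a tree, which replaces all
  geometric arguments on the Bruhat--Tits tree.

  Elements of a discrete group that are close to 1 have finite order, hence are trivial in
  characteristic 0 and unipotent in characteristic p. If such an element \<open>x \<noteq> 1\<close> lies in a discrete
  group generated by bounded elements \<open>b\<close>, then \<open>x\<close>, \<open>b x b\<^sup>-\<^sup>1\<close> and their product are
  all unipotent, so every \<open>b\<close> fixes the line fixed by \<open>x\<close> and the group fixes an end. Therefore
  the groups \<open>G\<^sub>n\<close> are uniformly discrete. Discreteness of the limit \<open>G\<close> follows, and
  every relation of \<open>G\<close> holds in \<open>G\<^sub>n\<close> for large \<open>n\<close>. This is uniform in the relation: by the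
  four-point inequality each relation reduces to relations \<open>x \<cdot> y = xy\<close> inside the finite set of
  elements of \<open>G\<close> of norm at most that of the generators.

  If \<open>G\<close> were elementary, it would fix a vertex, and then so would \<open>G\<^sub>n\<close> since vertex stabilizers
  are open, or it would contain a hyperbolic \<open>x\<close> with \<open>y x y\<^sup>-\<^sup>1 = x\<^sup>\<plusminus>\<^sup>1\<close> for all
  \<open>y\<close>; these finitely many relations pass to \<open>G\<^sub>n\<close>, which then preserves the pair of ends of the
  element corresponding to \<open>x\<close>.
\<close>

text \<open>Convergence controls one word at a time, while G may have infinitely many relations. The
  obstacle is therefore to replace each condition on a whole group by finitely many conditions on
  words, since only these hold for a common large \<open>n\<close>.

  The gap around \<open>id2\<close> can be chosen from a bound on the generators alone because the
  argument uses only one conjugation by one generator, which enlarges the distance to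
  \<open>id2\<close> by at most the square of that bound.

  Discreteness of G has to come before the other conclusions. It makes norm-bounded parts of G
  finite, and the hyperbolic alternative for elementary groups rests on it: a discrete group that
  fixes an end and contains a hyperbolic element also preserves the other end of its axis.

  Lattice bases are arbitrary invertible matrices, for which \<open>inv2\<close> is only the
  adjugate. Determinants are carried along in the formulas instead of dividing by them, so that
  \<open>E\<close> stays a maximum of minors.\<close>

fun mtr :: "'k::field mat2 \<Rightarrow> 'k" where
  "mtr (x, y, z, w) = x + w"

fun mnorm :: "('k::field \<Rightarrow> real) \<Rightarrow> 'k mat2 \<Rightarrow> real" where
  "mnorm a (x, y, z, w) = max (max (a x) (a y)) (max (a z) (a w))"

fun msub :: "'k::field mat2 \<Rightarrow> 'k mat2 \<Rightarrow> 'k mat2" where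
  "msub (x, y, z, w) (x', y', z', w') = (x - x', y - y', z - z', w - w')"

fun smul :: "'k::field \<Rightarrow> 'k mat2 \<Rightarrow> 'k mat2" where
  "smul c (x, y, z, w) = (c * x, c * y, c * z, c * w)"

primrec mpow :: "'k::field mat2 \<Rightarrow> nat \<Rightarrow> 'k mat2" where
  "mpow m 0 = id2"
| "mpow m (Suc k) = mmul m (mpow m k)"

section \<open>Algebra of two-by-two matrices\<close>

lemma mdist_eq_mnorm: "mdist a x y = mnorm a (msub x y)"
  by (cases x; cases y) simp

lemma mmul_assoc: "mmul (mmul x y) z = mmul x (mmul y z)"
  by (cases x; cases y; cases z) (simp add: algebra_simps)

lemma mmul_id2 [simp]: "mmul id2 x = x" "mmul x id2 = x"
  by (cases x; simp add: id2_def)+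

lemma det2_mmul [simp]: "det2 (mmul x y) = det2 x * det2 y"
  by (cases x; cases y) (simp add: algebra_simps)

lemma det2_inv2 [simp]: "det2 (inv2 x) = det2 x"
  by (cases x) (simp add: algebra_simps)

lemma det2_id2 [simp]: "det2 id2 = 1"
  by (simp add: id2_def)

lemma det2_smul [simp]: "det2 (smul c x) = c\<^sup>2 * det2 x"
  by (cases x) (simp add: algebra_simps power2_eq_square)

lemma inv2_inv2 [simp]: "inv2 (inv2 x) = x"
  by (cases x) simp

lemma inv2_id2 [simp]: "inv2 id2 = id2"
  by (simp add: id2_def)

lemma inv2_mmul: "inv2 (mmul x y) = mmul (inv2 y) (inv2 x)"
  by (cases x; cases y) (simp add: algebra_simps)

lemma mmul_inv2_smul: "mmul x (inv2 x) = smul (det2 x) id2" "mmul (inv2 x) x = smul (det2 x) id2"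
  by (cases x; simp add: algebra_simps id2_def)+

lemma smul_one [simp]: "smul 1 x = x"
  by (cases x) simp

lemma smul_smul [simp]: "smul c (smul d x) = smul (c * d) x"
  by (cases x) (simp add: algebra_simps)

lemma mmul_smul [simp]: "mmul (smul c x) y = smul c (mmul x y)" "mmul x (smul c y) = smul c (mmul x y)"
  by (cases x; cases y; simp add: algebra_simps)+

lemma inv2_smul: "inv2 (smul c x) = smul c (inv2 x)"
  by (cases x) simp

lemma mmul_inv2 [simp]:
  assumes "det2 x = 1"
  shows "mmul x (inv2 x) = id2" "mmul (inv2 x) x = id2"
  using assms by (simp_all add: mmul_inv2_smul)

lemma mmul_inv2_cancel [simp]:
  assumes "det2 x = 1"
  shows "mmul x (mmul (inv2 x) y) = y" "mmul (inv2 x) (mmul x y) = y"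
  using assms by (simp_all flip: mmul_assoc)

lemma mmul_left_cancel: "det2 x = 1 \<Longrightarrow> mmul x y = mmul x z \<longleftrightarrow> y = z"
  by (metis mmul_inv2_cancel(2))

lemma mmul_right_cancel: "det2 x = 1 \<Longrightarrow> mmul y x = mmul z x \<longleftrightarrow> y = z"
  by (metis mmul_assoc mmul_id2(2) mmul_inv2(1))

lemma mtr_mmul_commute: "mtr (mmul x y) = mtr (mmul y x)"
  by (cases x; cases y) (simp add: algebra_simps)

lemma mtr_conj: "det2 x = 1 \<Longrightarrow> mtr (mmul x (mmul y (inv2 x))) = mtr y"
  by (subst mtr_mmul_commute) (simp add: mmul_assoc)

lemma mtr_inv2 [simp]: "mtr (inv2 x) = mtr x"
  by (cases x) simp

lemma msub_mmul: "mmul x (msub y z) = msub (mmul x y) (mmul x z)" "mmul (msub y z) x = msub (mmul y x) (mmul z x)"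
  by (cases x; cases y; cases z; simp add: algebra_simps)+

lemma mpow_add: "mpow m (k + l) = mmul (mpow m k) (mpow m l)"
  by (induction k) (simp_all add: mmul_assoc)

lemma mpow_Suc2: "mpow m (Suc k) = mmul (mpow m k) m"
  using mpow_add[of m k 1] by simp

lemma mpow_mult: "mpow m (k * l) = mpow (mpow m k) l"
  by (induction l) (simp_all add: mpow_add)

lemma det2_mpow [simp]: "det2 (mpow m k) = det2 m ^ k"
  by (induction k) simp_all

text \<open>The matrix of \<open>x\<close> in the basis formed by the columns of \<open>m\<close>.
  Dividing by \<open>det2 m\<close> turns the adjugate into the inverse.\<close>

definition conj2 :: "'k::field mat2 \<Rightarrow> 'k mat2 \<Rightarrow> 'k mat2" where
  "conj2 m x = smul (1 / det2 m) (mmul (inv2 m) (mmul x m))"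

lemma mmul_conj2: "det2 m \<noteq> 0 \<Longrightarrow> mmul m (conj2 m x) = mmul x m"
  unfolding conj2_def by (simp flip: mmul_assoc add: mmul_inv2_smul)

lemma conj2_mmul: "det2 m \<noteq> 0 \<Longrightarrow> conj2 m (mmul x y) = mmul (conj2 m x) (conj2 m y)"
proof -
  assume m: "det2 m \<noteq> 0"
  have "mmul (conj2 m x) (conj2 m y) = smul (1 / det2 m) (mmul (inv2 m) (mmul x (mmul m (conj2 m y))))"
    by (simp add: conj2_def[of m x] mmul_assoc)
  thus ?thesis unfolding mmul_conj2[OF m, of y] by (simp add: conj2_def mmul_assoc)
qed

lemma det2_conj2 [simp]: "det2 m \<noteq> 0 \<Longrightarrow> det2 (conj2 m x) = det2 x"
  by (simp add: conj2_def power2_eq_square)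

lemma mtr_conj2 [simp]: "det2 m \<noteq> 0 \<Longrightarrow> mtr (conj2 m x) = mtr x"
proof -
  assume m: "det2 m \<noteq> 0"
  have s: "mtr (smul c y) = c * mtr y" for c and y :: "'a mat2"
    by (cases y) (simp add: algebra_simps)
  show ?thesis
    unfolding conj2_def s
    by (subst mtr_mmul_commute) (simp add: mmul_assoc mmul_inv2_smul s m)
qed

lemma conj2_inv2: "det2 m \<noteq> 0 \<Longrightarrow> conj2 m (inv2 x) = inv2 (conj2 m x)"
  by (simp add: conj2_def inv2_smul inv2_mmul mmul_assoc)

lemma conj2_eqI: "det2 m \<noteq> 0 \<Longrightarrow> mmul x m = mmul m y \<Longrightarrow> conj2 m x = y"
  unfolding conj2_def by (simp flip: mmul_assoc add: mmul_inv2_smul)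

lemma conj2_inject: "det2 m \<noteq> 0 \<Longrightarrow> conj2 m x = conj2 m y \<longleftrightarrow> x = y"
proof
  assume m: "det2 m \<noteq> 0" and "conj2 m x = conj2 m y"
  hence "mmul (mmul x m) (inv2 m) = mmul (mmul y m) (inv2 m)"
    by (metis mmul_conj2)
  hence "smul (1 / det2 m) (smul (det2 m) x) = smul (1 / det2 m) (smul (det2 m) y)"
    by (simp add: mmul_assoc mmul_inv2_smul)
  thus "x = y" using m by simp
qed simp

lemma conj2_id2 [simp]: "det2 m \<noteq> 0 \<Longrightarrow> conj2 m id2 = id2"
  by (simp add: conj2_eqI)

lemma conj2_mpow: "det2 m \<noteq> 0 \<Longrightarrow> conj2 m (mpow x k) = mpow (conj2 m x) k"
  by (induction k) (simp_all add: conj2_mmul)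

section \<open>Words and the groups they generate\<close>

definition inv_word :: "(nat \<times> bool) list \<Rightarrow> (nat \<times> bool) list" where
  "inv_word w = rev (map (\<lambda>(i, b). (i, \<not> b)) w)"

lemma eval_word_append: "eval_word g (u @ v) = mmul (eval_word g u) (eval_word g v)"
  by (induction g u rule: eval_word.induct) (simp_all add: mmul_assoc)

lemma eval_word_inv_word: "eval_word g (inv_word w) = inv2 (eval_word g w)"
  by (induction g w rule: eval_word.induct)
     (auto simp: inv_word_def eval_word_append inv2_mmul)

lemma valid_word_simps [simp]:
  "valid_word r []" "valid_word r (l # w) \<longleftrightarrow> fst l < r \<and> valid_word r w"
  "valid_word r (u @ v) \<longleftrightarrow> valid_word r u \<and> valid_word r v"
  "valid_word r (inv_word w) \<longleftrightarrow> valid_word r w"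
  by (auto simp: valid_word_def inv_word_def)

lemma det2_eval_word: "\<forall>i<r. g i \<in> SL2 \<Longrightarrow> valid_word r w \<Longrightarrow> det2 (eval_word g w) = 1"
  by (induction g w rule: eval_word.induct) (auto simp: SL2_def)

definition is_grp :: "'k::field mat2 set \<Rightarrow> bool" where
  "is_grp G \<longleftrightarrow> id2 \<in> G \<and> (\<forall>x\<in>G. det2 x = 1 \<and> inv2 x \<in> G \<and> (\<forall>y\<in>G. mmul x y \<in> G))"

lemma is_grpD:
  assumes "is_grp G"
  shows "id2 \<in> G" "x \<in> G \<Longrightarrow> det2 x = 1" "x \<in> G \<Longrightarrow> inv2 x \<in> G"
    "x \<in> G \<Longrightarrow> y \<in> G \<Longrightarrow> mmul x y \<in> G" "x \<in> G \<Longrightarrow> mpow x k \<in> G"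
proof -
  show "x \<in> G \<Longrightarrow> mpow x k \<in> G"
    by (induction k) (use assms in \<open>auto simp: is_grp_def\<close>)
qed (use assms in \<open>auto simp: is_grp_def\<close>)

lemma gen_grpI: "valid_word r w \<Longrightarrow> eval_word g w \<in> gen_grp g r"
  by (auto simp: gen_grp_def)

lemma gen_in_gen_grp: "i < r \<Longrightarrow> g i \<in> gen_grp g r"
  using gen_grpI[of r "[(i, True)]" g] by simp

lemma is_grp_gen_grp:
  assumes "\<forall>i<r. g i \<in> SL2"
  shows "is_grp (gen_grp g r)"
proof -
  have "id2 \<in> gen_grp g r"
    using gen_grpI[of r "[]" g] by simp
  moreover have "inv2 (eval_word g w) \<in> gen_grp g r" if "valid_word r w" for w
    using gen_grpI[of r "inv_word w" g] that by (simp add: eval_word_inv_word)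
  moreover have "mmul (eval_word g w) (eval_word g v) \<in> gen_grp g r"
    if "valid_word r w" "valid_word r v" for w v
    using gen_grpI[of r "w @ v" g] that by (simp add: eval_word_append)
  moreover have "\<exists>w. valid_word r w \<and> x = eval_word g w" if "x \<in> gen_grp g r" for x
    using that by (auto simp: gen_grp_def)
  ultimately show ?thesis
    unfolding is_grp_def using det2_eval_word[OF assms] by metis
qed

lemma gen_grp_induct [consumes 1, case_names id gen]:
  assumes "x \<in> gen_grp g r" and "P id2"
    and "\<And>x i. P x \<Longrightarrow> i < r \<Longrightarrow> P (mmul (g i) x) \<and> P (mmul (inv2 (g i)) x)"
  shows "P x"
proof -
  have "valid_word r w \<Longrightarrow> P (eval_word g w)" for w
  proof (induction w)
    case Nil
    then show ?case using assms(2) by simp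
  next
    case (Cons l w)
    then show ?case using assms(3) by (cases l) auto
  qed
  thus ?thesis using assms(1) by (auto simp: gen_grp_def)
qed

section \<open>Action on lattice classes and ends\<close>

lemma mapply_mmul: "mapply (mmul x y) v = mapply x (mapply y v)"
  by (cases x; cases y; cases v) (simp add: algebra_simps)

lemma mapply_smul: "mapply (smul c x) (s, t) = (c * fst (mapply x (s, t)), c * snd (mapply x (s, t)))"
  by (cases x) (simp add: algebra_simps)

lemma scale_scale: "scale c (scale d L) = scale (c * d) L"
  by (auto simp: scale_def image_image case_prod_beta mult.assoc)

lemma lattice_class_scale:
  assumes "c \<noteq> 0"
  shows "lattice_class (scale c L) = lattice_class L"
proof -
  have "\<exists>d'. scale d (scale c L) = scale d' L \<and> d' \<noteq> 0" if "d \<noteq> 0" for d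
    using that assms by (intro exI[of _ "d * c"]) (simp add: scale_scale)
  moreover have "\<exists>d'. scale d L = scale d' (scale c L) \<and> d' \<noteq> 0" if "d \<noteq> 0" for d
    using that assms by (intro exI[of _ "d / c"]) (simp add: scale_scale)
  ultimately show ?thesis unfolding lattice_class_def by blast
qed

lemma lattice_class_self: "L \<in> lattice_class L"
proof -
  have "scale 1 L = L" by (auto simp: scale_def)
  thus ?thesis unfolding lattice_class_def by (metis (mono_tags, lifting) mem_Collect_eq one_neq_zero)
qed

lemma image_mapply_scale: "mapply g ` scale c L = scale c (mapply g ` L)"
proof -
  have "mapply g (c * x, c * y) = (c * fst (mapply g (x, y)), c * snd (mapply g (x, y)))" for x y
    by (cases g) (simp add: algebra_simps)
  thus ?thesis by (auto simp: scale_def image_image case_prod_beta)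
qed

lemma act_vertex_lattice_class: "act_vertex g (lattice_class L) = lattice_class (mapply g ` L)"
proof -
  have "act_vertex g (lattice_class L) = {mapply g ` scale c L | c. c \<noteq> 0}"
    unfolding act_vertex_def lattice_class_def by auto
  thus ?thesis unfolding image_mapply_scale lattice_class_def .
qed

lemma act_vertex_mmul: "act_vertex (mmul g h) v = act_vertex g (act_vertex h v)"
  unfolding act_vertex_def by (simp add: image_image mapply_mmul)

lemma act_vertex_id2 [simp]: "act_vertex id2 v = v"
proof -
  have "mapply id2 x = x" for x :: "'a \<times> 'a" by (cases x) (simp add: id2_def)
  thus ?thesis by (simp add: act_vertex_def)
qed

lemma act_vertex_inv2:
  assumes "det2 g = 1"
  shows "act_vertex (inv2 g) v = w \<longleftrightarrow> v = act_vertex g w"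
  using assms by (metis act_vertex_id2 act_vertex_mmul mmul_inv2)

lemma same_end_sym: "same_end \<rho> \<sigma> \<Longrightarrow> same_end \<sigma> \<rho>"
  unfolding same_end_def by metis

lemma same_end_trans:
  assumes "same_end \<rho> \<sigma>" "same_end \<sigma> \<tau>"
  shows "same_end \<rho> \<tau>"
proof -
  obtain m n k l where 1: "\<And>i. \<rho> (m + i) = \<sigma> (n + i)" and 2: "\<And>i. \<sigma> (k + i) = \<tau> (l + i)"
    using assms unfolding same_end_def by blast
  have "\<rho> ((m + k) + i) = \<tau> ((l + n) + i)" for i
    using 1[of "k + i"] 2[of "n + i"] by (simp add: add_ac)
  thus ?thesis unfolding same_end_def by blast
qed

lemma same_end_map: "same_end \<rho> \<sigma> \<Longrightarrow> same_end (f \<circ> \<rho>) (f \<circ> \<sigma>)"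
  unfolding same_end_def comp_def by metis

lemma same_end_act_mmul:
  assumes "same_end (act_vertex h \<circ> \<rho>) \<sigma>" "same_end (act_vertex g \<circ> \<sigma>) \<tau>"
  shows "same_end (act_vertex (mmul g h) \<circ> \<rho>) \<tau>"
proof -
  have "act_vertex (mmul g h) \<circ> \<rho> = act_vertex g \<circ> (act_vertex h \<circ> \<rho>)"
    by (simp add: fun_eq_iff act_vertex_mmul)
  thus ?thesis using same_end_trans[OF same_end_map[OF assms(1)] assms(2)] by simp
qed

lemma same_end_act_inv2:
  assumes "same_end (act_vertex g \<circ> \<rho>) \<sigma>" "det2 g = 1"
  shows "same_end (act_vertex (inv2 g) \<circ> \<sigma>) \<rho>"
proof -
  have "act_vertex (inv2 g) \<circ> (act_vertex g \<circ> \<rho>) = \<rho>"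
    using assms(2) by (simp add: fun_eq_iff flip: act_vertex_mmul)
  thus ?thesis using same_end_sym[OF same_end_map[OF assms(1), of "act_vertex (inv2 g)"]] by simp
qed

section \<open>Absolute value and value group of a local field\<close>

locale local_field =
  fixes a :: "'k::field \<Rightarrow> real"
  assumes local_field: "nonarch_local_field a"
begin

lemma a_nonneg [simp]: "0 \<le> a x"
  and a_eq_0 [simp]: "a x = 0 \<longleftrightarrow> x = 0"
  and a_mult: "a (x * y) = a x * a y"
  and a_add: "a (x + y) \<le> max (a x) (a y)"
  using local_field unfolding nonarch_local_field_def by blast+

lemma a_zero [simp]: "a 0 = 0"
  by simp

lemma a_pos [simp]: "0 < a x \<longleftrightarrow> x \<noteq> 0"
  using a_nonneg[of x] a_eq_0[of x] by linarith

lemma a_le_0 [simp]: "a x \<le> 0 \<longleftrightarrow> x = 0"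
  using a_pos[of x] by (simp only: not_less[symmetric] not_not)

lemma a_power_le_0 [simp]: "a x ^ n \<le> 0 \<longleftrightarrow> a x ^ n = 0"
  using zero_le_power[OF a_nonneg[of x], of n] by linarith

lemma a_one [simp]: "a 1 = 1"
  using a_mult[of 1 1] by simp

lemma a_uminus [simp]: "a (- x) = a x"
proof -
  have "a (-1) * a (-1) = 1"
    using a_mult[of "-1" "-1"] by simp
  hence "(a (-1) - 1) * (a (-1) + 1) = 0"
    by (simp add: algebra_simps)
  hence "a (-1) = 1"
    using a_nonneg[of "-1"] by (smt (verit) mult_eq_0_iff)
  thus ?thesis using a_mult[of "-1" x] by simp
qed

lemma a_diff: "a (x - y) \<le> max (a x) (a y)"
  using a_add[of x "- y"] by simp

lemma a_diff_commute: "a (x - y) = a (y - x)"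
  using a_uminus[of "x - y"] by simp

lemma a_power: "a (x ^ n) = a x ^ n"
  by (induction n) (simp_all add: a_mult)

lemma a_inverse: "a (inverse x) = inverse (a x)"
proof (cases "x = 0")
  case False
  thus ?thesis using a_mult[of x "inverse x"] by (simp add: field_simps)
qed simp

lemma a_divide: "a (x / y) = a x / a y"
  by (simp add: divide_inverse a_mult a_inverse)

lemma a_add_le: "a x \<le> c \<Longrightarrow> a y \<le> c \<Longrightarrow> a (x + y) \<le> c"
  using a_add[of x y] by linarith

lemma a_diff_le: "a x \<le> c \<Longrightarrow> a y \<le> c \<Longrightarrow> a (x - y) \<le> c"
  using a_diff[of x y] by linarith

lemma a_sum_le: "(\<And>i. i \<in> S \<Longrightarrow> a (f i) \<le> c) \<Longrightarrow> 0 \<le> c \<Longrightarrow> a (sum f S) \<le> c"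
  by (induction S rule: infinite_finite_induct) (auto intro: a_add_le)

lemma a_add_eq: "a y < a x \<Longrightarrow> a (x + y) = a x"
  using a_add[of x y] a_diff[of "x + y" y] by (auto simp: max_def split: if_splits)

lemma a_diff_eq: "a y < a x \<Longrightarrow> a (x - y) = a x"
  using a_add_eq[of "- y" x] by simp

lemma a_of_nat: "a (of_nat n) \<le> 1"
  by (induction n) (auto intro: a_add_le)

text \<open>The constant \<open>c\<close> need not itself be a value of \<open>a\<close>; an element
  whose value is the least positive power of \<open>c\<close> that occurs is a uniformizer.\<close>

lemma ex_uniformizer: "\<exists>p. uniformizer a p"
proof -
  obtain c where c: "0 < c" "c < 1" and cv: "\<And>x. x \<noteq> 0 \<Longrightarrow> \<exists>k::int. a x = c powi k"
    using local_field unfolding nonarch_local_field_def by blast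
  obtain x0 where x0: "x0 \<noteq> 0" "a x0 \<noteq> 1"
    using local_field unfolding nonarch_local_field_def by blast
  have lt: "c powi k < 1 \<longleftrightarrow> k > 0" for k :: int
  proof (cases "k \<ge> 0")
    case True
    then obtain n where n: "k = int n" using nonneg_int_cases by blast
    have "c ^ Suc m < 1" for m using c by (intro power_Suc_less_one) auto
    thus ?thesis unfolding n power_int_of_nat by (cases n) auto
  next
    case False
    then obtain n where n: "k = - int n" "n > 0"
      by (metis linorder_not_le neg_int_cases)
    have "c ^ n \<le> 1" using c by (simp add: power_le_one)
    hence "1 \<le> c powi k" unfolding n(1) power_int_minus
      using c by (simp add: one_le_inverse_iff)
    thus ?thesis using False by simp
  qed
  define P where "P = (\<lambda>n::nat. n > 0 \<and> (\<exists>x. x \<noteq> 0 \<and> a x = c ^ n))"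
  have "\<exists>n. P n"
  proof -
    obtain x where x: "x \<noteq> 0" "a x < 1"
    proof (cases "a x0 < 1")
      case False
      hence "a (inverse x0) < 1"
        using x0 by (simp add: a_inverse inverse_less_1_iff)
      thus ?thesis using that[of "inverse x0"] x0 by simp
    qed (use x0 that in blast)
    obtain k where k: "a x = c powi k" using cv x by blast
    hence "k > 0" using lt x by simp
    then obtain n where "k = int n" "n > 0" using zero_less_imp_eq_int by blast
    thus ?thesis using k x unfolding P_def by auto
  qed
  define n where "n = (LEAST n. P n)"
  have Pn: "P n" and le: "\<And>m. P m \<Longrightarrow> n \<le> m"
    unfolding n_def using \<open>\<exists>n. P n\<close> by (auto intro: LeastI_ex Least_le)
  obtain p where p: "p \<noteq> 0" "a p = c ^ n" and n0: "n > 0" using Pn unfolding P_def by blast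
  have "a x \<le> a p" if x: "a x < 1" for x
  proof (cases "x = 0")
    case False
    obtain k where k: "a x = c powi k" using cv False by blast
    hence "k > 0" using lt x by simp
    then obtain m where m: "k = int m" "m > 0" using zero_less_imp_eq_int by blast
    hence "n \<le> m" using le k False unfolding P_def by auto
    thus ?thesis using k m p c by (simp add: power_decreasing)
  qed simp
  moreover have "a p < 1" using p n0 c lt[of "int n"] by simp
  ultimately show ?thesis using p by (auto simp: uniformizer_def)
qed

definition \<pi> :: 'k where "\<pi> = (SOME p. uniformizer a p)"

lemma pi_uniformizer: "uniformizer a \<pi>"
  unfolding \<pi>_def using ex_uniformizer by (rule someI_ex)

lemma pi_nz [simp]: "\<pi> \<noteq> 0" and a_pi_lt: "a \<pi> < 1" and a_le_pi: "a x < 1 \<Longrightarrow> a x \<le> a \<pi>"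
  using pi_uniformizer by (auto simp: uniformizer_def)

lemma a_uniformizer: "uniformizer a p \<Longrightarrow> a p = a \<pi>"
  using pi_uniformizer by (metis uniformizer_def antisym)

text \<open>The value group is discrete, so a strict inequality between values gains a factor
  \<open>a \<pi>\<close>. This gain later turns chains of inequalities into equalities.\<close>

lemma a_pi_le_mult: "a x < a y \<Longrightarrow> a x \<le> a \<pi> * a y"
proof -
  assume "a x < a y"
  hence y: "y \<noteq> 0" using a_nonneg[of x] by (metis a_zero not_le)
  hence "a (x / y) < 1" using \<open>a x < a y\<close> by (simp add: a_divide)
  hence "a (x / y) \<le> a \<pi>" by (rule a_le_pi)
  thus ?thesis using y by (simp add: a_divide field_simps)
qed

lemma pi_power_less: "0 < e \<Longrightarrow> \<exists>k. a \<pi> ^ k < e"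
  using real_arch_pow_inv[of e "a \<pi>"] a_pi_lt by blast

text \<open>Powers of \<open>a \<pi>\<close> tend to 0, so there is a least exponent whose power is
  below a given value; no value lies strictly between neighbouring powers.\<close>

lemma a_pi_powi:
  assumes x: "x \<noteq> 0"
  shows "\<exists>k::int. a x = a \<pi> powi k"
proof -
  have nat: "\<exists>n::nat. a x = a \<pi> ^ n" if "x \<noteq> 0" "a x \<le> 1" for x
  proof -
    obtain k where k: "a \<pi> ^ k < a x"
      using pi_power_less[of "a x"] \<open>x \<noteq> 0\<close> by auto
    define n where "n = (LEAST k. a \<pi> ^ k < a x)"
    have n: "a \<pi> ^ n < a x" unfolding n_def using k by (rule LeastI)
    have n0: "n \<noteq> 0" using n that by (cases n) auto
    hence "\<not> a \<pi> ^ (n - 1) < a x" unfolding n_def by (intro not_less_Least) simp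
    moreover have "a \<pi> ^ (n - 1) \<le> a x"
    proof -
      have "\<not> a x < a (\<pi> ^ (n - 1))"
      proof
        assume "a x < a (\<pi> ^ (n - 1))"
        hence "a x \<le> a \<pi> * a (\<pi> ^ (n - 1))" by (rule a_pi_le_mult)
        also have "\<dots> = a \<pi> ^ n" using n0 by (cases n) (simp_all add: a_power)
        finally show False using n by simp
      qed
      thus ?thesis by (simp add: a_power)
    qed
    ultimately show ?thesis by (intro exI[of _ "n - 1"]) linarith
  qed
  show ?thesis
  proof (cases "a x \<le> 1")
    case True
    then obtain n where "a x = a \<pi> ^ n" using nat x by blast
    thus ?thesis by (intro exI[of _ "int n"]) simp
  next
    case False
    hence "a (inverse x) \<le> 1" by (simp add: a_inverse inverse_le_1_iff)
    then obtain n where "a (inverse x) = a \<pi> ^ n" using nat[of "inverse x"] x by auto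
    hence "a x = inverse (a \<pi> ^ n)" by (metis a_inverse inverse_inverse_eq)
    thus ?thesis by (intro exI[of _ "- int n"]) (simp add: power_int_minus)
  qed
qed

section \<open>The maximum norm on matrices\<close>

abbreviation N :: "'k mat2 \<Rightarrow> real" where "N \<equiv> mnorm a"

lemma N_le_iff: "N (x, y, z, w) \<le> c \<longleftrightarrow> a x \<le> c \<and> a y \<le> c \<and> a z \<le> c \<and> a w \<le> c"
  by auto

lemma N_attained: "\<exists>e. N x = a e"
  by (cases x) (auto simp: max_def)

lemma N_nonneg [simp]: "0 \<le> N x"
  using N_attained[of x] by auto

lemma N_id2 [simp]: "N id2 = 1"
  by (simp add: id2_def)

lemma N_inv2 [simp]: "N (inv2 x) = N x"
  by (cases x) auto

lemma N_smul: "N (smul c x) = a c * N x"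
  by (cases x) (simp add: a_mult max_mult_distrib_left)

lemma N_mmul: "N (mmul x y) \<le> N x * N y"
proof (cases x; cases y)
  fix p q r s p' q' r' s'
  assume x: "x = (p, q, r, s)" and y: "y = (p', q', r', s')"
  have "a u \<le> N x" if "u \<in> {p, q, r, s}" for u using that x by auto
  moreover have "a u \<le> N y" if "u \<in> {p', q', r', s'}" for u using that y by auto
  ultimately have "a (u * v) \<le> N x * N y" if "u \<in> {p, q, r, s}" "v \<in> {p', q', r', s'}" for u v
    using that unfolding a_mult by (intro mult_mono) auto
  thus ?thesis unfolding x y mmul.simps N_le_iff by (intro conjI a_add_le) auto
qed

lemma N_msub: "N (msub x y) \<le> max (N x) (N y)"
proof (cases x; cases y)
  fix p q r s p' q' r' s'
  assume x: "x = (p, q, r, s)" and y: "y = (p', q', r', s')"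
  show ?thesis unfolding x y msub.simps N_le_iff by (intro conjI a_diff_le) auto
qed

lemma N_msub_commute: "N (msub x y) = N (msub y x)"
  by (cases x; cases y) (simp add: a_diff_commute)

lemma N_msub_trans: "N (msub x z) \<le> max (N (msub x y)) (N (msub y z))"
proof -
  have "msub x z = msub (msub x y) (msub z y)"
    by (cases x; cases y; cases z) simp
  thus ?thesis using N_msub[of "msub x y" "msub z y"] N_msub_commute[of z y] by simp
qed

lemma N_le_msub: "N x \<le> max (N y) (N (msub x y))"
proof -
  have "x = msub y (msub y x)" by (cases x; cases y) simp
  thus ?thesis using N_msub[of y "msub y x"] N_msub_commute[of y x] by simp
qed

lemma N_eq_of_msub: "N (msub x y) < N y \<Longrightarrow> N x = N y"
  using N_le_msub[of x y] N_le_msub[of y x] N_msub_commute[of x y] by linarith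

lemma N_msub_eq_0 [simp]: "N (msub x y) = 0 \<longleftrightarrow> x = y"
proof -
  have "N (msub x y) \<le> 0 \<longleftrightarrow> x = y"
  proof (cases x; cases y)
    fix p q r s p' q' r' s'
    assume x: "x = (p, q, r, s)" and y: "y = (p', q', r', s')"
    have *: "a u \<le> 0 \<longleftrightarrow> u = 0" for u using a_pos[of u] by linarith
    show ?thesis unfolding x y msub.simps N_le_iff * by auto
  qed
  thus ?thesis using N_nonneg[of "msub x y"] by linarith
qed

lemma a_det2: "a (det2 x) \<le> (N x)\<^sup>2"
proof (cases x)
  fix p q r s assume x: "x = (p, q, r, s)"
  have "a u \<le> N x" if "u \<in> {p, q, r, s}" for u using that x by auto
  hence "a (u * v) \<le> (N x)\<^sup>2" if "u \<in> {p, q, r, s}" "v \<in> {p, q, r, s}" for u v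
    using that unfolding a_mult power2_eq_square by (intro mult_mono) auto
  thus ?thesis unfolding x det2.simps by (intro a_diff_le) auto
qed

lemma N_ge_1: "det2 x = 1 \<Longrightarrow> 1 \<le> N x"
  using a_det2[of x] N_nonneg[of x] by (metis a_one abs_of_nonneg one_le_power power2_le_iff_abs_le power_one zero_le_one)

lemma a_mtr: "a (mtr x) \<le> N x"
  by (cases x) (simp add: a_add_le)

lemma N_mpow: "N (mpow x k) \<le> N x ^ k"
proof (induction k)
  case (Suc k)
  have "N (mpow x (Suc k)) \<le> N x * N (mpow x k)" by (simp add: N_mmul)
  also have "\<dots> \<le> N x * N x ^ k" by (intro mult_left_mono Suc.IH) simp
  finally show ?case by simp
qed simp

subsection \<open>The four-point inequality\<close>

definition E :: "'k mat2 \<Rightarrow> 'k mat2 \<Rightarrow> real" where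
  "E x y = N (mmul (inv2 x) y)"

fun cols :: "'k mat2 \<Rightarrow> ('k \<times> 'k) set" where
  "cols (x, y, z, w) = {(x, z), (y, w)}"

fun brk :: "'k \<times> 'k \<Rightarrow> 'k \<times> 'k \<Rightarrow> 'k" where
  "brk (u, u') (v, v') = u * v' - u' * v"

text \<open>Up to sign, the entries of adjugate times matrix are the minors with one column from
  \<open>x\<close> and one from \<open>y\<close>. This form makes the Pluecker relation
  applicable.\<close>

lemma E_ge: "u \<in> cols x \<Longrightarrow> v \<in> cols y \<Longrightarrow> a (brk u v) \<le> E x y"
  and E_attained: "\<exists>u\<in>cols x. \<exists>v\<in>cols y. E x y = a (brk u v)"
proof -
  obtain p q r s p' q' r' s' where x: "x = (p, q, r, s)" and y: "y = (p', q', r', s')"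
    by (cases x; cases y)
  have "a (s * p' - q * r') = a (q * r' - s * p')" "a (s * q' - q * s') = a (q * s' - s * q')"
    by (rule a_diff_commute)+
  hence E: "E x y = max (max (a (brk (q, s) (p', r'))) (a (brk (q, s) (q', s'))))
             (max (a (brk (p, r) (p', r'))) (a (brk (p, r) (q', s'))))"
    unfolding E_def x y by (simp add: algebra_simps)
  show "u \<in> cols x \<Longrightarrow> v \<in> cols y \<Longrightarrow> a (brk u v) \<le> E x y"
    unfolding E unfolding x y by (auto simp del: brk.simps)
  show "\<exists>u\<in>cols x. \<exists>v\<in>cols y. E x y = a (brk u v)"
    unfolding E unfolding x y by (auto simp del: brk.simps simp: max_def)
qed

lemma E_nonneg [simp]: "0 \<le> E x y"
  by (simp add: E_def)

lemma E_commute: "E x y = E y x"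
proof -
  have "inv2 (mmul (inv2 x) y) = mmul (inv2 y) x" by (simp add: inv2_mmul)
  thus ?thesis unfolding E_def by (metis N_inv2)
qed

text \<open>The tree is 0-hyperbolic because of the Pluecker relation between the
  \<open>2 \<times> 2\<close> minors of four vectors in the plane.\<close>

lemma four_point: "E x z * E y w \<le> max (E x y * E z w) (E x w * E y z)"
proof -
  obtain u v where 1: "u \<in> cols x" "v \<in> cols z" "E x z = a (brk u v)" using E_attained by blast
  obtain s t where 2: "s \<in> cols y" "t \<in> cols w" "E y w = a (brk s t)" using E_attained by blast
  have "brk u v * brk s t = brk u s * brk v t + brk u t * brk s v"
    by (cases u; cases v; cases s; cases t) (simp add: algebra_simps)
  hence "E x z * E y w \<le> max (a (brk u s * brk v t)) (a (brk u t * brk s v))"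
    unfolding 1(3) 2(3) using a_add by (simp flip: a_mult)
  also have "\<dots> \<le> max (E x y * E z w) (E x w * E y z)"
    unfolding a_mult using 1 2 by (intro max.mono mult_mono E_ge) auto
  finally show ?thesis .
qed

lemma E_trans: "E x z * a (det2 y) \<le> E x y * E y z"
proof -
  have "mmul (mmul (inv2 x) y) (mmul (inv2 y) z) = mmul (inv2 x) (mmul (mmul y (inv2 y)) z)"
    by (simp add: mmul_assoc)
  also have "\<dots> = smul (det2 y) (mmul (inv2 x) z)"
    by (simp add: mmul_inv2_smul)
  finally show ?thesis
    unfolding E_def using N_mmul[of "mmul (inv2 x) y" "mmul (inv2 y) z"]
    by (simp add: N_smul mult.commute)
qed

lemma E_mmul_left: "E (mmul g x) (mmul g y) = a (det2 g) * E x y"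
proof -
  have "mmul (inv2 (mmul g x)) (mmul g y) = mmul (inv2 x) (mmul (mmul (inv2 g) g) y)"
    by (simp add: inv2_mmul mmul_assoc)
  thus ?thesis by (simp add: E_def mmul_inv2_smul N_smul)
qed

lemma E_ge_det: "a (det2 x) * a (det2 y) \<le> (E x y)\<^sup>2"
  unfolding E_def using a_det2[of "mmul (inv2 x) y"] by (simp add: a_mult)

lemma E_attained_value: "\<exists>e. E x y = a e"
  using E_attained[of x y] by auto

subsection \<open>Finiteness of bounded parts of discrete subgroups\<close>

lemma residue_reps: "\<exists>F. finite F \<and> (\<forall>x. a x \<le> 1 \<longrightarrow> (\<exists>y\<in>F. a (x - y) < 1))"
proof -
  let ?R = "{(x, y). a x \<le> 1 \<and> a y \<le> 1 \<and> a (x - y) < 1}"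
  have fin: "finite ({x. a x \<le> 1} // ?R)"
    using local_field unfolding nonarch_local_field_def by blast
  let ?F = "(\<lambda>S. SOME y. y \<in> S) ` ({x. a x \<le> 1} // ?R)"
  have "\<exists>y\<in>?F. a (x - y) < 1" if x: "a x \<le> 1" for x
  proof
    have "x \<in> ?R `` {x}" using x by simp
    hence "(SOME y. y \<in> ?R `` {x}) \<in> ?R `` {x}" by (rule someI)
    thus "a (x - (SOME y. y \<in> ?R `` {x})) < 1" by blast
    show "(SOME y. y \<in> ?R `` {x}) \<in> ?F" using x by (intro imageI quotientI) simp
  qed
  thus ?thesis using fin by blast
qed

text \<open>Digit expansion in base \<open>\<pi>\<close>: subtract a residue representative, divide
  by \<open>\<pi>\<close>, and continue with the quotient.\<close>

lemma int_totally_bounded: "\<exists>F. finite F \<and> (\<forall>x. a x \<le> 1 \<longrightarrow> (\<exists>y\<in>F. a (x - y) \<le> a \<pi> ^ k))"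
proof (induction k)
  case 0
  show ?case by (intro exI[of _ "{0}"]) simp
next
  case (Suc k)
  obtain F where F: "finite F" "\<And>x. a x \<le> 1 \<Longrightarrow> \<exists>y\<in>F. a (x - y) \<le> a \<pi> ^ k" using Suc by blast
  obtain R where R: "finite R" "\<And>x. a x \<le> 1 \<Longrightarrow> \<exists>y\<in>R. a (x - y) < 1" using residue_reps by blast
  have "\<exists>y\<in>(\<lambda>(u, v). u + \<pi> * v) ` (R \<times> F). a (x - y) \<le> a \<pi> ^ Suc k" if x: "a x \<le> 1" for x
  proof -
    obtain u where u: "u \<in> R" "a (x - u) < 1" using R x by blast
    hence "a ((x - u) / \<pi>) \<le> 1" using a_le_pi[of "x - u"] by (simp add: a_divide)
    then obtain v where v: "v \<in> F" "a ((x - u) / \<pi> - v) \<le> a \<pi> ^ k" using F by blast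
    have "x - (u + \<pi> * v) = \<pi> * ((x - u) / \<pi> - v)" by (simp add: field_simps)
    hence "a (x - (u + \<pi> * v)) \<le> a \<pi> ^ Suc k" using v by (simp add: a_mult mult_left_mono)
    thus ?thesis using u v by force
  qed
  thus ?case using F R by (intro exI[of _ "(\<lambda>(u, v). u + \<pi> * v) ` (R \<times> F)"]) auto
qed

lemma totally_bounded:
  assumes "e > 0"
  shows "\<exists>F. finite F \<and> (\<forall>x. a x \<le> B \<longrightarrow> (\<exists>y\<in>F. a (x - y) < e))"
proof -
  obtain j where j: "a \<pi> ^ j < 1 / max B 1" using pi_power_less[of "1 / max B 1"] by (auto simp: less_max_iff_disj)
  define c where "c = \<pi> ^ j"
  have c: "c \<noteq> 0" "a c * B \<le> 1" and c1: "a c \<le> 1"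
  proof -
    have "a c * max B 1 < 1" using j by (simp add: c_def a_power field_simps)
    moreover have "a c * B \<le> a c * max B 1" by (intro mult_left_mono) auto
    ultimately show "a c * B \<le> 1" by linarith
    show "a c \<le> 1" using a_pi_lt by (simp add: c_def a_power power_le_one)
  qed (simp add: c_def)
  obtain k where k: "a \<pi> ^ k < e * a c" using pi_power_less[of "e * a c"] c assms by auto
  obtain F where F: "finite F" "\<And>x. a x \<le> 1 \<Longrightarrow> \<exists>y\<in>F. a (x - y) \<le> a \<pi> ^ k"
    using int_totally_bounded by blast
  have "\<exists>y\<in>(\<lambda>y. y / c) ` F. a (x - y) < e" if x: "a x \<le> B" for x
  proof -
    have "a (c * x) \<le> 1" using x c by (simp add: a_mult) (meson a_nonneg mult_left_mono order_trans)
    then obtain y where y: "y \<in> F" "a (c * x - y) \<le> a \<pi> ^ k" using F by blast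
    have "c * x - y = c * (x - y / c)" using c by (simp add: field_simps)
    hence "a c * a (x - y / c) \<le> a \<pi> ^ k" using y by (simp add: a_mult)
    hence "a c * a (x - y / c) < a c * e" using k by (simp add: mult.commute)
    hence "a (x - y / c) < e" using c by (simp add: mult_less_cancel_left_pos)
    thus ?thesis using y by blast
  qed
  thus ?thesis using F by (intro exI[of _ "(\<lambda>y. y / c) ` F"]) auto
qed

text \<open>Pigeonhole on a finite net: by the ultrametric inequality, two points assigned to the
  same net point are closer than \<open>e\<close>.\<close>

lemma finite_separated:
  assumes "e > 0" and sep: "\<And>x y. x \<in> S \<Longrightarrow> y \<in> S \<Longrightarrow> N (msub x y) < e \<Longrightarrow> x = y"
    and bd: "\<And>x. x \<in> S \<Longrightarrow> N x \<le> B"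
  shows "finite S"
proof -
  obtain F where F: "finite F" "\<And>x. a x \<le> B \<Longrightarrow> \<exists>y\<in>F. a (x - y) < e"
    using totally_bounded[OF assms(1)] by blast
  have ex: "\<exists>y\<in>F \<times> F \<times> F \<times> F. N (msub x y) < e" if "x \<in> S" for x
  proof (cases x)
    fix p q r s assume x: "x = (p, q, r, s)"
    have "a p \<le> B" "a q \<le> B" "a r \<le> B" "a s \<le> B"
      using bd[OF that] unfolding x N_le_iff by blast+
    then obtain p' q' r' s' where "p' \<in> F" "a (p - p') < e" "q' \<in> F" "a (q - q') < e"
      "r' \<in> F" "a (r - r') < e" "s' \<in> F" "a (s - s') < e"
      using F(2) by meson
    thus ?thesis unfolding x by (intro bexI[of _ "(p', q', r', s')"]) auto
  qed
  then obtain f where f: "\<And>x. x \<in> S \<Longrightarrow> f x \<in> F \<times> F \<times> F \<times> F \<and> N (msub x (f x)) < e"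
    by metis
  have "inj_on f S"
  proof (rule inj_onI)
    fix x y assume "x \<in> S" "y \<in> S" "f x = f y"
    hence "N (msub x y) < e"
      using N_msub_trans[of x y "f x"] f[of x] f[of y] N_msub_commute[of "f x" y] by (auto simp: max_def split: if_splits)
    thus "x = y" using sep \<open>x \<in> S\<close> \<open>y \<in> S\<close> by blast
  qed
  moreover have "f ` S \<subseteq> F \<times> F \<times> F \<times> F" using f by blast
  ultimately show ?thesis by (rule inj_on_finite) (use F(1) in simp)
qed

lemma N_msub_inv2_mmul:
  assumes "det2 x = 1"
  shows "N (msub (mmul (inv2 x) y) id2) \<le> N x * N (msub y x)"
proof -
  have "msub (mmul (inv2 x) y) id2 = mmul (inv2 x) (msub y x)"
    using assms by (simp add: msub_mmul)
  thus ?thesis using N_mmul[of "inv2 x" "msub y x"] by simp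
qed

lemma discrete_at_id2:
  assumes "is_grp G" "discrete_subgroup a G"
  shows "\<exists>e>0. \<forall>x\<in>G. N (msub x id2) < e \<longrightarrow> x = id2"
  using assms is_grpD(1)[OF assms(1)] unfolding discrete_subgroup_def mdist_eq_mnorm
  by (metis N_msub_commute)

lemma discrete_separated:
  assumes G: "is_grp G" and e: "e > 0" "\<And>x. x \<in> G \<Longrightarrow> N (msub x id2) < e \<Longrightarrow> x = id2"
    and "x \<in> G" "y \<in> G" "N x * N (msub y x) < e"
  shows "y = x"
proof -
  have d: "det2 x = 1" using is_grpD(2)[OF G] assms by blast
  have "mmul (inv2 x) y = id2"
    using assms N_msub_inv2_mmul[OF d, of y] is_grpD[OF G] by (intro e(2)) auto
  thus ?thesis using d by (metis mmul_id2(2) mmul_inv2_cancel(1))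
qed

lemma discrete_subgroupI:
  assumes G: "is_grp G" and e: "e > 0" "\<And>x. x \<in> G \<Longrightarrow> N (msub x id2) < e \<Longrightarrow> x = id2"
  shows "discrete_subgroup a G"
  unfolding discrete_subgroup_def mdist_eq_mnorm
proof
  fix x assume x: "x \<in> G"
  have "1 \<le> N x" using N_ge_1 is_grpD(2)[OF G x] by blast
  hence "e / N x > 0" using e by auto
  moreover have "y = x" if "y \<in> G" "N (msub x y) < e / N x" for y
    using that \<open>1 \<le> N x\<close> x
    by (intro discrete_separated[OF G e]) (auto simp: field_simps N_msub_commute[of x y])
  ultimately show "\<exists>e>0. \<forall>y\<in>G. N (msub x y) < e \<longrightarrow> y = x" by blast
qed

text \<open>Left translation by \<open>inv2 x\<close> enlarges distances by at most the factor
  \<open>N x\<close>, so the gap around \<open>id2\<close> gives a uniform gap between elements of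
  bounded norm.\<close>

lemma finite_discrete_bounded:
  assumes G: "is_grp G" "discrete_subgroup a G"
  shows "finite {x \<in> G. N x \<le> B}"
proof -
  obtain e where e: "e > 0" "\<And>x. x \<in> G \<Longrightarrow> N (msub x id2) < e \<Longrightarrow> x = id2"
    using discrete_at_id2[OF G] by blast
  show ?thesis
  proof (rule finite_separated)
    show "e / max B 1 > 0" using e by simp
    fix x y assume xy: "x \<in> {x \<in> G. N x \<le> B}" "y \<in> {x \<in> G. N x \<le> B}" "N (msub x y) < e / max B 1"
    have "N y * N (msub x y) \<le> max B 1 * N (msub x y)"
      using xy by (intro mult_right_mono) auto
    also have "\<dots> < e" using xy(3) by (simp add: field_simps)
    finally show "x = y" using discrete_separated[OF G(1) e, of y x] xy by auto
  qed auto
qed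

subsection \<open>Elements close to the identity\<close>

text \<open>To be used with \<open>F k i\<close> a coordinate of x^k (x - 1)^i, where the hypothesis
  is the identity x = 1 + (x - 1). Matrices are tuples rather than ring elements, so the binomial
  expansion is carried out in one scalar coordinate at a time.\<close>

lemma pascal_expansion:
  fixes F :: "nat \<Rightarrow> nat \<Rightarrow> 'b::comm_ring_1"
  assumes "\<And>k i. F (Suc k) i = F k i + F k (Suc i)"
  shows "F k i = (\<Sum>j\<le>k. of_nat (k choose j) * F 0 (i + j))"
proof (induction k arbitrary: i)
  case (Suc k)
  let ?f = "\<lambda>j. F 0 (i + j)"
  have "(\<Sum>j\<le>Suc k. of_nat (Suc k choose j) * ?f j)
      = ?f 0 + (\<Sum>j\<le>k. of_nat (k choose Suc j) * ?f (Suc j)) + (\<Sum>j\<le>k. of_nat (k choose j) * ?f (Suc j))"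
    by (simp add: sum.atMost_Suc_shift algebra_simps sum.distrib del: sum.atMost_Suc)
  also have "?f 0 + (\<Sum>j\<le>k. of_nat (k choose Suc j) * ?f (Suc j)) = (\<Sum>j\<le>Suc k. of_nat (k choose j) * ?f j)"
    by (simp add: sum.atMost_Suc_shift del: sum.atMost_Suc)
  also have "\<dots> = (\<Sum>j\<le>k. of_nat (k choose j) * ?f j)"
    by (simp add: binomial_eq_0)
  finally show ?case by (simp add: assms Suc.IH)
qed simp

lemma mpow_expansion:
  fixes e :: "'k mat2 \<Rightarrow> 'k"
  assumes lin: "\<And>x y. e (msub x y) = e x - e y"
  shows "e (mpow x k) = (\<Sum>j\<le>k. of_nat (k choose j) * e (mpow (msub x id2) j))"
proof -
  let ?F = "\<lambda>k i. e (mmul (mpow x k) (mpow (msub x id2) i))"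
  have "?F (Suc k) i = ?F k i + ?F k (Suc i)" for k i
  proof -
    have "mmul (mpow x k) (mpow (msub x id2) (Suc i))
        = msub (mmul (mpow x (Suc k)) (mpow (msub x id2) i)) (mmul (mpow x k) (mpow (msub x id2) i))"
      unfolding mpow_Suc2[of x] by (simp add: msub_mmul mmul_assoc)
    thus ?thesis using lin by simp
  qed
  from pascal_expansion[of ?F, OF this, of k 0] show ?thesis by simp
qed

definition coord :: "('k mat2 \<Rightarrow> 'k) \<Rightarrow> bool" where
  "coord e \<longleftrightarrow> e \<in> {\<lambda>(x, y, z, w). x, \<lambda>(x, y, z, w). y, \<lambda>(x, y, z, w). z, \<lambda>(x, y, z, w). w}"

lemma coord_msub: "coord e \<Longrightarrow> e (msub x y) = e x - e y"
  by (cases x; cases y) (auto simp: coord_def)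

lemma coord_smul: "coord e \<Longrightarrow> e (smul c x) = c * e x"
  by (cases x) (auto simp: coord_def)

lemma coord_le: "coord e \<Longrightarrow> a (e x) \<le> N x"
  by (cases x) (auto simp: coord_def)

lemma coord_cases:
  "coord (\<lambda>(x, y, z, w). x)" "coord (\<lambda>(x, y, z, w). y)" "coord (\<lambda>(x, y, z, w). z)" "coord (\<lambda>(x, y, z, w). w)"
  by (simp_all add: coord_def)

lemma mat2_eqI:
  assumes "\<And>e. coord e \<Longrightarrow> e x = e y"
  shows "x = y"
  using assms[OF coord_cases(1)] assms[OF coord_cases(2)] assms[OF coord_cases(3)] assms[OF coord_cases(4)]
  by (cases x; cases y) simp

lemma N_leI:
  assumes "\<And>e. coord e \<Longrightarrow> a (e x) \<le> c"
  shows "N x \<le> c"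
  using assms[OF coord_cases(1)] assms[OF coord_cases(2)] assms[OF coord_cases(3)] assms[OF coord_cases(4)]
  by (cases x) simp

lemma frobenius_mpow:
  fixes x :: "'k mat2"
  assumes p: "prime p" "of_nat p = (0::'k)"
  shows "msub (mpow x p) id2 = mpow (msub x id2) p"
proof (rule mat2_eqI)
  fix e :: "'k mat2 \<Rightarrow> 'k" assume "coord e"
  note lin = coord_msub[OF this]
  let ?t = "\<lambda>j. of_nat (p choose j) * e (mpow (msub x id2) j)"
  have z: "?t j = 0" if "j \<in> {..p} - {0, p}" for j
  proof -
    have "p dvd (p choose j)" using that p(1) by (intro dvd_choose_prime) auto
    then obtain c where "p choose j = p * c" ..
    thus ?thesis using p(2) by simp
  qed
  have "{..p} = insert 0 (insert p ({..p} - {0, p}))" by auto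
  moreover have "p \<noteq> 0" using p(1) by auto
  ultimately have "sum ?t {..p} = ?t 0 + (?t p + sum ?t ({..p} - {0, p}))"
    by (metis (no_types, lifting) Diff_iff finite_Diff finite_atMost finite_insert insert_iff sum.insert)
  also have "sum ?t ({..p} - {0, p}) = 0" using z by (intro sum.neutral) blast
  finally have "sum ?t {..p} = ?t 0 + ?t p" by simp
  thus "e (msub (mpow x p) id2) = e (mpow (msub x id2) p)"
    using mpow_expansion[of e x p] lin by simp
qed

lemma frobenius_mpow_power:
  fixes x :: "'k mat2"
  assumes p: "prime p" "of_nat p = (0::'k)"
  shows "msub (mpow x (p ^ k)) id2 = mpow (msub x id2) (p ^ k)"
proof (induction k)
  case 0
  then show ?case by (cases x) (simp add: id2_def)
next
  case (Suc k)
  show ?case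
    using frobenius_mpow[OF p, of "mpow x (p ^ k)"] Suc.IH
    by (simp add: mpow_mult mult.commute[of p])
qed

lemma det2_msub_id2: "det2 x = 1 \<Longrightarrow> det2 (msub x id2) = 2 - mtr x"
  by (cases x) (simp add: id2_def algebra_simps)

text \<open>x^m - 1 is m (x - 1) plus terms of degree at least two in x - 1, and the linear term
  dominates them once x - 1 is smaller than m.\<close>

lemma N_mpow_msub:
  fixes m :: nat
  assumes m: "m \<ge> 2" and small: "N (msub x id2) < a (of_nat m)"
  shows "N (msub (mpow x m) id2) = a (of_nat m) * N (msub x id2)"
proof (cases "x = id2")
  case True
  have "mpow (id2 :: 'k mat2) m = id2" for m by (induction m) simp_all
  thus ?thesis using True N_msub_eq_0[of id2 id2] by (simp del: N_msub_eq_0)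
next
  case False
  let ?D = "msub x id2" and ?d = "N (msub x id2)"
  have d: "0 < ?d" "?d < 1"
    using False N_nonneg[of ?D] N_msub_eq_0[of x id2] small a_of_nat[of m] by linarith+
  have "N (msub (msub (mpow x m) id2) (smul (of_nat m) ?D)) \<le> ?d\<^sup>2"
  proof (rule N_leI)
    fix e :: "'k mat2 \<Rightarrow> 'k"
    assume "coord e"
    note lin = coord_msub[OF this] coord_smul[OF this] and le = coord_le[OF this]
    let ?t = "\<lambda>j. of_nat (m choose j) * e (mpow ?D j)"
    have "sum ?t {..m} = ?t 0 + (?t 1 + sum ?t {2..m})"
      using m by (simp add: atMost_atLeast0 sum.atLeast_Suc_atMost numeral_2_eq_2)
    hence "e (msub (msub (mpow x m) id2) (smul (of_nat m) ?D)) = sum ?t {2..m}"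
      using mpow_expansion[of e x m] lin by simp
    moreover have "a (sum ?t {2..m}) \<le> ?d\<^sup>2"
    proof (rule a_sum_le)
      fix j assume j: "j \<in> {2..m}"
      have "a (?t j) \<le> 1 * N (mpow ?D j)"
        unfolding a_mult by (intro mult_mono a_of_nat le) auto
      also have "\<dots> \<le> ?d ^ j" using N_mpow by simp
      also have "\<dots> \<le> ?d\<^sup>2" using j d by (intro power_decreasing) auto
      finally show "a (?t j) \<le> ?d\<^sup>2" .
    qed simp
    ultimately show "a (e (msub (msub (mpow x m) id2) (smul (of_nat m) ?D))) \<le> ?d\<^sup>2" by simp
  qed
  also have "\<dots> < N (smul (of_nat m) ?D)"
    using small d by (simp add: N_smul power2_eq_square)
  finally show ?thesis using N_eq_of_msub N_smul by metis
qed

text \<open>A nontrivial element of a discrete group very close to 1 has finite order, since its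
  powers with exponents \<open>p\<^sup>k\<close> tend to 1. In characteristic 0 this is impossible for lack of small
  torsion; in characteristic p it forces the element to be unipotent.\<close>

lemma near_id2_unipotent:
  "\<exists>e>0. e \<le> 1 \<and> (\<forall>H x. is_grp H \<longrightarrow> discrete_subgroup a H \<longrightarrow> x \<in> H \<longrightarrow> N (msub x id2) < e \<longrightarrow> mtr x = 2)"
proof (cases "CHAR('k) = 0")
  case False
  define p where "p = CHAR('k)"
  have p: "prime p" "of_nat p = (0::'k)"
    using False prime_CHAR_semidom[where 'a = 'k] by (simp_all add: p_def)
  show ?thesis
  proof (intro exI[of _ 1] conjI allI impI)
    fix H x assume H: "is_grp H" "discrete_subgroup a H" and x: "x \<in> H" "N (msub x id2) < 1"
    obtain e where e: "e > 0" "\<And>x. x \<in> H \<Longrightarrow> N (msub x id2) < e \<Longrightarrow> x = id2"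
      using discrete_at_id2[OF H] by blast
    obtain k where k: "N (msub x id2) ^ k < e"
      using real_arch_pow_inv[OF e(1) x(2)] by blast
    have "k < p ^ k" using prime_gt_1_nat[OF p(1)] by (intro power_gt_expt) simp
    hence "k \<le> p ^ k" by simp
    have "N (msub (mpow x (p ^ k)) id2) \<le> N (msub x id2) ^ (p ^ k)"
      unfolding frobenius_mpow_power[OF p] by (rule N_mpow)
    also have "\<dots> \<le> N (msub x id2) ^ k"
      using x(2) \<open>k \<le> p ^ k\<close> by (intro power_decreasing) auto
    finally have "mpow x (p ^ k) = id2"
      using k is_grpD(5)[OF H(1) x(1)] by (intro e(2)) auto
    \<comment> \<open>Thus x - 1 is nilpotent, and its determinant, which is
      \<open>2 - mtr x\<close>, vanishes.\<close>
    hence "mpow (msub x id2) (p ^ k) = msub id2 id2"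
      using frobenius_mpow_power[OF p, of x k] by simp
    hence "det2 (mpow (msub x id2) (p ^ k)) = 0"
      by (simp only: id2_def msub.simps det2.simps diff_self mult_zero_left)
    hence "det2 (msub x id2) = 0" by simp
    thus "mtr x = 2" using det2_msub_id2 is_grpD(2)[OF H(1) x(1)] by fastforce
  qed auto
next
  case True
  obtain F where F: "finite F" "\<And>x. a x \<le> 1 \<Longrightarrow> \<exists>y\<in>F. a (x - y) < 1" using residue_reps by blast
  have "\<forall>n::nat. \<exists>y\<in>F. a (of_nat n - y) < 1" using F a_of_nat by blast
  then obtain f where f: "\<And>n::nat. f n \<in> F \<and> a (of_nat n - f n) < 1" by metis
  \<comment> \<open>Finitely many residues force two distinct natural numbers to agree modulo the
    maximal ideal. Their difference \<open>m\<close> has absolute value below 1, yet is nonzero in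
    characteristic 0.\<close>
  have "\<not> inj f" using F(1) f by (metis finite_imageD finite_subset image_subsetI infinite_UNIV_nat)
  then obtain i j where ij: "i < j" "f i = f j" unfolding inj_def by (metis linorder_neqE_nat)
  define m where "m = j - i"
  have am: "a (of_nat m) < 1"
  proof -
    have "(of_nat m :: 'k) = (of_nat j - f j) - (of_nat i - f i)" using ij by (simp add: m_def of_nat_diff)
    thus ?thesis using a_diff[of "of_nat j - f j" "of_nat i - f i"] f[of i] f[of j]
      by (auto simp: max_def split: if_splits)
  qed
  have m0: "(of_nat m :: 'k) \<noteq> 0"
  proof -
    have "m > 0" using ij by (simp add: m_def)
    thus ?thesis using True by (simp add: of_nat_eq_0_iff_char_dvd)
  qed
  hence m2: "m \<ge> 2" using am by (cases m; cases "m - 1") auto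
  show ?thesis
  proof (intro exI[of _ "a (of_nat m)"] conjI allI impI)
    fix H x assume H: "is_grp H" "discrete_subgroup a H" and x: "x \<in> H" "N (msub x id2) < a (of_nat m)"
    obtain e where e: "e > 0" "\<And>x. x \<in> H \<Longrightarrow> N (msub x id2) < e \<Longrightarrow> x = id2"
      using discrete_at_id2[OF H] by blast
    \<comment> \<open>Each \<open>m\<close>-th power multiplies the distance to \<open>id2\<close>
      by exactly \<open>a (of_nat m)\<close>: the powers approach \<open>id2\<close> but never reach
      it unless x = \<open>id2\<close>.\<close>
    have pw: "N (msub (mpow x (m ^ k)) id2) = a (of_nat m) ^ k * N (msub x id2)" for k
    proof (induction k)
      case 0
      then show ?case by (cases x) (simp add: id2_def)
    next
      case (Suc k)
      have "a (of_nat m) ^ k * N (msub x id2) \<le> 1 * N (msub x id2)"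
        using am by (intro mult_right_mono power_le_one) auto
      hence "N (msub (mpow x (m ^ k)) id2) < a (of_nat m)" using x Suc by linarith
      from N_mpow_msub[OF m2 this] show ?case
        using Suc.IH by (simp add: mpow_mult mult.commute[of m])
    qed
    obtain k where k: "a (of_nat m) ^ k < e" using real_arch_pow_inv[OF e(1) am] by blast
    have "a (of_nat m) ^ k * N (msub x id2) \<le> a (of_nat m) ^ k * 1"
      using am x by (intro mult_left_mono) auto
    hence "mpow x (m ^ k) = id2"
      using k pw[of k] is_grpD(5)[OF H(1) x(1)] by (intro e(2)) auto
    hence "N (msub x id2) = 0" using pw[of k] m0 N_msub_eq_0[of id2 id2] by (simp del: N_msub_eq_0)
    thus "mtr x = 2" by (simp add: id2_def)
  qed (use am m0 in auto)
qed

section \<open>Lattices, vertices and distances in the tree\<close>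

definition Lat :: "'k mat2 \<Rightarrow> ('k \<times> 'k) set" where
  "Lat m = {mapply m (s, t) | s t. s \<in> intO a \<and> t \<in> intO a}"

definition V :: "'k mat2 \<Rightarrow> ('k \<times> 'k) set set" where
  "V m = lattice_class (Lat m)"

lemma Lat_smul: "Lat (smul c m) = scale c (Lat m)"
proof -
  have "Lat m = mapply m ` (intO a \<times> intO a)" for m
    unfolding Lat_def by auto
  moreover have "mapply (smul c m) v = (c * fst (mapply m v), c * snd (mapply m v))" for v
    using mapply_smul by (cases v) blast
  ultimately show ?thesis by (simp add: scale_def image_image case_prod_beta)
qed

lemma image_Lat: "mapply g ` Lat m = Lat (mmul g m)"
  unfolding Lat_def mapply_mmul by blast

lemma act_vertex_V: "act_vertex g (V m) = V (mmul g m)"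
  unfolding V_def act_vertex_lattice_class image_Lat ..

lemma V_smul: "c \<noteq> 0 \<Longrightarrow> V (smul c m) = V m"
  unfolding V_def Lat_smul by (rule lattice_class_scale)

lemma BT_vertices_eq: "BT_vertices a = {V m | m. det2 m \<noteq> 0}"
  unfolding BT_vertices_def V_def lattice_def Lat_def by blast

lemma V_in_BT [simp]: "det2 m \<noteq> 0 \<Longrightarrow> V m \<in> BT_vertices a"
  unfolding BT_vertices_eq by blast

lemma mem_V: "L \<in> V m \<longleftrightarrow> (\<exists>c. c \<noteq> 0 \<and> L = Lat (smul c m))"
  unfolding V_def lattice_class_def Lat_smul by auto

text \<open>The inclusion says that y^-1 x has integral entries, and the adjugate used in
  \<open>E\<close> differs from y^-1 by the factor \<open>det2 y\<close>.\<close>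

lemma Lat_subset_iff:
  assumes y: "det2 y \<noteq> 0"
  shows "Lat x \<subseteq> Lat y \<longleftrightarrow> E y x \<le> a (det2 y)"
proof
  assume sub: "Lat x \<subseteq> Lat y"
  obtain p q r s where z: "mmul (inv2 y) x = (p, q, r, s)" by (cases "mmul (inv2 y) x")
  have *: "a (fst (mapply (mmul (inv2 y) x) (i, j))) \<le> a (det2 y) \<and> a (snd (mapply (mmul (inv2 y) x) (i, j))) \<le> a (det2 y)"
    if "a i \<le> 1" "a j \<le> 1" for i j
  proof -
    have "mapply x (i, j) \<in> Lat y" using sub that unfolding Lat_def intO_def by blast
    then obtain s t where st: "mapply x (i, j) = mapply y (s, t)" "a s \<le> 1" "a t \<le> 1"
      unfolding Lat_def intO_def by blast
    have "mapply (mmul (inv2 y) x) (i, j) = mapply (smul (det2 y) id2) (s, t)"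
      by (simp only: mapply_mmul st mmul_inv2_smul(2)[symmetric])
    thus ?thesis using st by (simp add: mapply_smul id2_def a_mult mult_left_le)
  qed
  show "E y x \<le> a (det2 y)"
    using *[of 1 0] *[of 0 1] unfolding E_def z by simp
next
  assume le: "E y x \<le> a (det2 y)"
  define z where "z = smul (1 / det2 y) (mmul (inv2 y) x)"
  have x: "x = mmul y z"
    unfolding z_def using y by (simp flip: mmul_assoc add: mmul_inv2_smul)
  have "N z \<le> 1"
    unfolding z_def N_smul using le y by (simp add: E_def a_divide field_simps)
  moreover obtain p q r s where z: "z = (p, q, r, s)" by (cases z)
  ultimately have n: "a p \<le> 1" "a q \<le> 1" "a r \<le> 1" "a s \<le> 1" by simp_all
  have m: "a (u * v) \<le> 1" if "a u \<le> 1" "a v \<le> 1" for u v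
    using that by (simp add: a_mult mult_le_one)
  show "Lat x \<subseteq> Lat y"
  proof
    fix v assume "v \<in> Lat x"
    then obtain i j where v: "v = mapply x (i, j)" "a i \<le> 1" "a j \<le> 1" unfolding Lat_def intO_def by blast
    have "v = mapply y (p * i + q * j, r * i + s * j)" unfolding v x mapply_mmul z by simp
    moreover have "a (p * i + q * j) \<le> 1" "a (r * i + s * j) \<le> 1"
      using n v m by (auto intro!: a_add_le)
    ultimately show "v \<in> Lat y" unfolding Lat_def intO_def by blast
  qed
qed

lemma E_smul: "E (smul c x) y = a c * E x y" "E x (smul c y) = a c * E x y"
  by (simp_all add: E_def inv2_smul N_smul)

text \<open>With \<open>q = 1 / a \<pi>\<close>, this is \<open>q ^ d\<close> for \<open>d\<close> the distance of the vertices \<open>V x\<close> and \<open>V y\<close>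
  in the tree; the denominator compensates for \<open>inv2\<close> being only the adjugate.\<close>

definition dd :: "'k mat2 \<Rightarrow> 'k mat2 \<Rightarrow> real" where
  "dd x y = (E x y)\<^sup>2 / (a (det2 x) * a (det2 y))"

lemma dd_smul: "c \<noteq> 0 \<Longrightarrow> dd (smul c x) y = dd x y" "c \<noteq> 0 \<Longrightarrow> dd x (smul c y) = dd x y"
  by (simp_all add: dd_def E_smul a_mult a_power power_mult_distrib)

lemma dd_commute: "dd x y = dd y x"
  by (simp add: dd_def E_commute mult.commute)

lemma dd_ge_1: "det2 x \<noteq> 0 \<Longrightarrow> det2 y \<noteq> 0 \<Longrightarrow> 1 \<le> dd x y"
  using E_ge_det[of x y] by (simp add: dd_def)

lemma V_eq_iff:
  assumes d: "det2 x \<noteq> 0" "det2 y \<noteq> 0"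
  shows "V x = V y \<longleftrightarrow> dd x y = 1"
proof
  assume "V x = V y"
  hence "Lat x \<in> V y" using lattice_class_self V_def by metis
  then obtain c where c: "c \<noteq> 0" "Lat x = Lat (smul c y)" unfolding mem_V by blast
  let ?y = "smul c y"
  have dy: "det2 ?y \<noteq> 0" using c d by simp
  have "E ?y x \<le> a (det2 ?y)" "E x ?y \<le> a (det2 x)"
    using c Lat_subset_iff[OF dy, of x] Lat_subset_iff[OF d(1), of ?y] by auto
  hence "E x ?y * E x ?y \<le> a (det2 x) * a (det2 ?y)"
    by (intro mult_mono) (auto simp: E_commute)
  hence "dd x ?y \<le> 1"
    using d dy by (simp add: dd_def power2_eq_square del: det2_smul)
  thus "dd x y = 1" using dd_ge_1[OF d] c dd_smul by simp
next
  assume "dd x y = 1"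
  hence E2: "E x y * E x y = a (det2 x) * a (det2 y)"
    using d by (simp add: dd_def power2_eq_square)
  obtain e where e: "E x y = a e" using E_attained_value by blast
  have e0: "e \<noteq> 0" using E2 d unfolding e by auto
  \<comment> \<open>This scaling gives both lattices determinants of equal absolute value, after
    which the two inclusion criteria hold with equality.\<close>
  define c where "c = e / det2 y"
  have c: "c \<noteq> 0" "a c * a (det2 y) = E x y" using e0 d by (simp_all add: c_def a_divide e)
  let ?y = "smul c y"
  have dy: "det2 ?y \<noteq> 0" using c d by simp
  have "E ?y x = a (det2 ?y)"
    using c(2) by (simp add: E_smul E_commute[of y] a_mult a_power power2_eq_square)
  moreover have "E x ?y = a (det2 x)"
  proof -
    have "E x ?y * a (det2 y) = (a c * a (det2 y)) * E x y"
      by (simp add: E_smul)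
    hence "E x ?y * a (det2 y) = a (det2 x) * a (det2 y)"
      using c(2) E2 by simp
    thus ?thesis using d by simp
  qed
  ultimately have "Lat x = Lat ?y"
    using Lat_subset_iff[OF dy, of x] Lat_subset_iff[OF d(1), of ?y] by auto
  thus "V x = V y" using V_smul[OF c(1), of y] by (simp add: V_def)
qed

lemma dd_mmul_left: "det2 g \<noteq> 0 \<Longrightarrow> dd (mmul g x) (mmul g y) = dd x y"
  by (simp add: dd_def E_mmul_left a_mult power_mult_distrib power2_eq_square)

lemma dd_trans:
  assumes "det2 x \<noteq> 0" "det2 y \<noteq> 0" "det2 z \<noteq> 0"
  shows "dd x z \<le> dd x y * dd y z"
proof -
  have "(E x z * a (det2 y))\<^sup>2 \<le> (E x y * E y z)\<^sup>2"
    by (intro power_mono E_trans) simp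
  moreover have "A / (u * w) \<le> B / (u * v) * (C / (v * w))"
    if "A * v\<^sup>2 \<le> B * C" "u > 0" "v > 0" "w > 0" for A B C u v w :: real
  proof -
    have "A / (u * w) = A * v\<^sup>2 / (u * w * v\<^sup>2)" using that by simp
    also have "\<dots> \<le> B * C / (u * w * v\<^sup>2)" using that by (intro divide_right_mono) auto
    also have "\<dots> = B / (u * v) * (C / (v * w))" by (simp add: power2_eq_square mult_ac)
    finally show ?thesis .
  qed
  ultimately show ?thesis
    unfolding dd_def using assms by (simp add: power_mult_distrib)
qed

lemma dd_four_point:
  assumes "det2 x \<noteq> 0" "det2 y \<noteq> 0" "det2 z \<noteq> 0" "det2 w \<noteq> 0"
  shows "dd x z * dd y w \<le> max (dd x y * dd z w) (dd x w * dd y z)"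
proof -
  have *: "dd x y * dd z w = (E x y * E z w)\<^sup>2 / (a (det2 x) * a (det2 y) * (a (det2 z) * a (det2 w)))" for x y z w
    by (simp add: dd_def power_mult_distrib)
  define D where "D = a (det2 x) * a (det2 y) * (a (det2 z) * a (det2 w))"
  have D: "D > 0" using assms by (simp add: D_def)
  have 1: "dd x y * dd z w = (E x y * E z w)\<^sup>2 / D" "dd x z * dd y w = (E x z * E y w)\<^sup>2 / D"
    "dd x w * dd y z = (E x w * E y z)\<^sup>2 / D"
    unfolding * D_def by (simp_all only: mult_ac)
  have "(E x z * E y w)\<^sup>2 \<le> (max (E x y * E z w) (E x w * E y z))\<^sup>2"
    by (intro power_mono four_point) simp
  hence "(E x z * E y w)\<^sup>2 \<le> (E x y * E z w)\<^sup>2 \<or> (E x z * E y w)\<^sup>2 \<le> (E x w * E y z)\<^sup>2"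
    by (auto simp: max_def split: if_splits)
  thus ?thesis unfolding 1 le_max_iff_disj using D by (auto intro: divide_right_mono)
qed

lemma dd_cong:
  assumes "det2 x \<noteq> 0" "det2 x' \<noteq> 0" "det2 y \<noteq> 0" "det2 y' \<noteq> 0" "V x = V x'" "V y = V y'"
  shows "dd x y = dd x' y'"
proof -
  have le: "dd x y \<le> dd x' y" if "det2 x \<noteq> 0" "det2 x' \<noteq> 0" "det2 y \<noteq> 0" "V x = V x'" for x x' y
    using dd_trans[of x x' y] V_eq_iff[of x x'] that by simp
  have "dd x y = dd x' y"
    using le[of x x' y] le[of x' x y] assms by (intro antisym) simp_all
  also have "\<dots> = dd x' y'"
    unfolding dd_commute[of x'] using le[of y y' x'] le[of y' y x'] assms by (intro antisym) simp_all
  finally show ?thesis .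
qed

text \<open>The two strict inclusions bound \<open>E X Y\<close> and the determinants from both
  sides; since values are discrete, these bounds leave only one possibility.\<close>

lemma BT_adj_dd:
  assumes d: "det2 x \<noteq> 0" "det2 y \<noteq> 0" and "BT_adj a (V x) (V y)"
  shows "dd x y = 1 / a \<pi>"
proof -
  obtain p L L' where p: "uniformizer a p" and L: "L \<in> V x" "L' \<in> V y" "L' \<subset> L" "scale p L \<subset> L'"
    using assms(3) unfolding BT_adj_def by blast
  have p0: "p \<noteq> 0" using p by (simp add: uniformizer_def)
  have ap: "a p = a \<pi>" using p by (rule a_uniformizer)
  obtain c c' where c: "c \<noteq> 0" "L = Lat (smul c x)" "c' \<noteq> 0" "L' = Lat (smul c' y)"
    using L unfolding mem_V by blast
  define X Y where "X = smul c x" and "Y = smul c' y"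
  have dX: "det2 X \<noteq> 0" and dY: "det2 Y \<noteq> 0" and dpX: "det2 (smul p X) \<noteq> 0"
    using c d p0 by (simp_all add: X_def Y_def)
  have sub: "Lat Y \<subseteq> Lat X" "\<not> Lat X \<subseteq> Lat Y" "Lat (smul p X) \<subseteq> Lat Y" "\<not> Lat Y \<subseteq> Lat (smul p X)"
    using L(3,4) unfolding c(2)[folded X_def] c(4)[folded Y_def] Lat_smul[symmetric] by blast+
  have EYX: "E Y X = E X Y" by (rule E_commute)
  have dp: "a (det2 (smul p X)) = a \<pi> * a \<pi> * a (det2 X)"
    by (simp add: a_mult a_power ap power2_eq_square)
  have 1: "E X Y \<le> a (det2 X)" using sub(1) Lat_subset_iff[OF dX, of Y] by blast
  have 2: "E X Y > a (det2 Y)" using sub(2) Lat_subset_iff[OF dY, of X] EYX by linarith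
  have 3: "a \<pi> * E X Y \<le> a (det2 Y)"
    using sub(3) Lat_subset_iff[OF dY, of "smul p X"] EYX by (simp add: E_smul ap)
  have 4: "a \<pi> * E X Y > a \<pi> * a \<pi> * a (det2 X)"
    using sub(4) Lat_subset_iff[OF dpX, of Y] unfolding dp E_smul ap by linarith
  obtain e where e: "E X Y = a e" using E_attained_value by blast
  have "a (det2 Y) \<le> a \<pi> * E X Y" using 2 a_pi_le_mult unfolding e by blast
  hence Y: "a (det2 Y) = a \<pi> * E X Y" using 3 by simp
  have "\<not> a e < a (det2 X)"
  proof
    assume "a e < a (det2 X)"
    hence "a e \<le> a \<pi> * a (det2 X)" by (rule a_pi_le_mult)
    hence "a \<pi> * a e \<le> a \<pi> * (a \<pi> * a (det2 X))" by (rule mult_left_mono) simp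
    thus False using 4 unfolding e mult.assoc by linarith
  qed
  hence X: "E X Y = a (det2 X)" using 1 e by simp
  have "dd X Y = 1 / a \<pi>" unfolding dd_def Y X using dX by (simp add: power2_eq_square)
  thus ?thesis unfolding X_def Y_def dd_smul[OF c(1)] dd_smul[OF c(3)] .
qed

lemma BT_adjI:
  assumes d: "det2 x \<noteq> 0" and E: "E x y = a (det2 x)" "a (det2 y) = a \<pi> * a (det2 x)"
  shows "BT_adj a (V x) (V y)"
proof -
  have dy: "det2 y \<noteq> 0" using d E by (metis a_eq_0 mult_eq_0_iff pi_nz)
  have dp: "det2 (smul \<pi> x) \<noteq> 0" using d by simp
  have lt: "a \<pi> * a (det2 x) < a (det2 x)" using d a_pi_lt by simp
  have lt2: "a \<pi> * (a \<pi> * a (det2 x)) < a \<pi> * a (det2 x)" using lt by simp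
  have Eyx: "E y x = a (det2 x)" using E(1) E_commute by simp
  have "Lat y \<subseteq> Lat x" "\<not> Lat x \<subseteq> Lat y" "Lat (smul \<pi> x) \<subseteq> Lat y" "\<not> Lat y \<subseteq> Lat (smul \<pi> x)"
    unfolding Lat_subset_iff[OF d] Lat_subset_iff[OF dy] Lat_subset_iff[OF dp] E_smul Eyx E
    using lt lt2 by (simp_all add: a_mult a_power power2_eq_square not_le)
  hence "Lat y \<subset> Lat x" "scale \<pi> (Lat x) \<subset> Lat y" by (auto simp: Lat_smul)
  thus ?thesis
    unfolding BT_adj_def using V_in_BT[OF d] V_in_BT[OF dy] pi_uniformizer
      lattice_class_self[of "Lat x", folded V_def] lattice_class_self[of "Lat y", folded V_def]
    by blast
qed

section \<open>Geodesic rays and vertex stabilizers\<close>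

lemma BT_ray_reps:
  assumes "BT_ray a \<rho>"
  shows "\<exists>m. \<forall>i. det2 (m i) \<noteq> 0 \<and> \<rho> i = V (m i)"
proof -
  have "\<forall>i. \<exists>m. det2 m \<noteq> 0 \<and> \<rho> i = V m"
    using assms unfolding BT_ray_def BT_vertices_eq by blast
  thus ?thesis by (rule choice)
qed

text \<open>Absence of backtracking only speaks about two consecutive edges; the four-point
  inequality propagates it to the whole path, each further edge multiplying \<open>dd\<close> by at
  least \<open>1 / a \<pi>\<close>.\<close>

lemma BT_ray_geodesic:
  assumes ray: "BT_ray a \<rho>" and m: "\<And>i. det2 (m i) \<noteq> 0" "\<And>i. \<rho> i = V (m i)"
  shows "(1 / a \<pi>) ^ k \<le> dd (m j) (m (j + k))"
proof -
  let ?Q = "1 / a \<pi>"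
  have Q: "?Q > 1" using a_pi_lt by (simp add: field_simps)
  have adj: "dd (m i) (m (Suc i)) = ?Q" for i
    using ray m BT_adj_dd by (simp add: BT_ray_def)
  \<comment> \<open>Parity argument: over two edges \<open>dd\<close> is the square of a value
    \<open>a f\<close>, that is, the distance is even. Without backtracking it is not 0, hence at
    least 2.\<close>
  have two: "?Q\<^sup>2 \<le> dd (m i) (m (Suc (Suc i)))" for i
  proof -
    obtain e e1 e2 where e: "E (m i) (m (Suc (Suc i))) = a e" "E (m i) (m (Suc i)) = a e1"
      "E (m (Suc i)) (m (Suc (Suc i))) = a e2" using E_attained_value by metis
    define f where "f = e * det2 (m (Suc i)) * \<pi> / (e1 * e2 * \<pi>\<^sup>2)"
    have e1: "(a e1)\<^sup>2 * a \<pi> = a (det2 (m i)) * a (det2 (m (Suc i)))"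
      and e2: "(a e2)\<^sup>2 * a \<pi> = a (det2 (m (Suc i))) * a (det2 (m (Suc (Suc i))))"
      using adj[of i] adj[of "Suc i"] m(1) unfolding dd_def e by (simp_all add: divide_simps)
    have nz: "e1 \<noteq> 0" "e2 \<noteq> 0" using e1 e2 m(1) by (auto simp: zero_power2)
    have "dd (m i) (m (Suc (Suc i))) * (((a e1)\<^sup>2 * a \<pi>) * ((a e2)\<^sup>2 * a \<pi>)) = (a e * a (det2 (m (Suc i))))\<^sup>2"
      unfolding e1 e2 unfolding dd_def e using m(1) by (simp add: field_simps power2_eq_square)
    hence sq: "dd (m i) (m (Suc (Suc i))) = (a f)\<^sup>2"
      using nz unfolding f_def by (simp add: a_divide a_mult a_power power2_eq_square field_simps)
    have "dd (m i) (m (Suc (Suc i))) \<noteq> 1"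
      using ray m V_eq_iff[OF m(1)[of i] m(1)[of "Suc (Suc i)"]] by (auto simp: BT_ray_def)
    hence f1: "(a f)\<^sup>2 > 1" using dd_ge_1[of "m i" "m (Suc (Suc i))"] m(1) sq by simp
    have "a f > 1"
    proof (rule ccontr)
      assume "\<not> a f > 1"
      hence "(a f)\<^sup>2 \<le> 1" by (intro power_le_one) auto
      thus False using f1 by simp
    qed
    hence "a 1 \<le> a \<pi> * a f" by (intro a_pi_le_mult) simp
    hence "?Q \<le> a f" by (simp add: field_simps)
    thus ?thesis unfolding sq using Q by (intro power_mono) auto
  qed
  have step: "?Q * dd (m j) (m (j + k)) \<le> dd (m j) (m (j + Suc k))" for k
  proof (induction k)
    case 0
    have "dd (m j) (m j) = 1" using V_eq_iff m(1) by blast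
    thus ?case using adj[of j] by simp
  next
    case (Suc k)
    let ?x = "m j" and ?y = "m (j + k)" and ?z = "m (Suc (j + k))" and ?w = "m (Suc (Suc (j + k)))"
    \<comment> \<open>Of the two alternatives in the four-point inequality, the first is excluded by
      the induction hypothesis together with \<open>two\<close>; the second is the claim.\<close>
    have "dd ?x ?z * dd ?y ?w \<le> max (dd ?x ?y * ?Q) (dd ?x ?w * ?Q)"
      using dd_four_point[of ?x ?y ?z ?w] m(1) adj by simp
    moreover have "dd ?x ?z * ?Q\<^sup>2 \<le> dd ?x ?z * dd ?y ?w"
      using two dd_ge_1[of ?x ?z] m(1) by (intro mult_left_mono) auto
    moreover have "dd ?x ?y * ?Q < dd ?x ?z * ?Q\<^sup>2"
    proof -
      have z: "0 < dd ?x ?z" using dd_ge_1[of ?x ?z] m(1) by (smt (verit))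
      have "dd ?x ?y * ?Q \<le> dd ?x ?z" using Suc by (simp add: mult.commute)
      also have "\<dots> < dd ?x ?z * ?Q\<^sup>2"
        using Q z by (metis mult.right_neutral mult_less_cancel_left_pos one_less_power pos2)
      finally show ?thesis .
    qed
    ultimately have "dd ?x ?z * ?Q\<^sup>2 \<le> dd ?x ?w * ?Q" by linarith
    hence "?Q * dd ?x ?z * ?Q \<le> dd ?x ?w * ?Q" by (simp add: power2_eq_square mult_ac)
    hence "?Q * dd ?x ?z \<le> dd ?x ?w"
      by (rule mult_right_le_imp_le) (simp add: less_imp_neq)
    thus ?case by simp
  qed
  show ?thesis
  proof (induction k)
    case 0
    then show ?case using dd_ge_1 m(1) by simp
  next
    case (Suc k)
    have "?Q * ?Q ^ k \<le> ?Q * dd (m j) (m (j + k))" using Suc Q by (intro mult_left_mono) auto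
    thus ?case using step[of k] by simp
  qed
qed

text \<open>Conjugating u - 1 by the basis \<open>m\<close> costs a factor
  \<open>(N m)\<^sup>2\<close> up to the determinant. Below the stated radius the scalar matrix
  \<open>smul (det2 m) id2\<close> dominates, so \<open>dd\<close> is 1.\<close>

lemma vertex_stabilizer_open:
  assumes m: "det2 m \<noteq> 0"
  shows "\<exists>e>0. \<forall>u. det2 u = 1 \<longrightarrow> N (msub u id2) < e \<longrightarrow> act_vertex u (V m) = V m"
proof -
  have "0 < a (det2 m)" using m by simp
  hence "N m \<noteq> 0" using a_det2[of m] by auto
  hence Nm: "N m > 0" using N_nonneg[of m] by linarith
  show ?thesis
  proof (intro exI[of _ "a (det2 m) / (N m)\<^sup>2"] conjI allI impI)
    show "a (det2 m) / (N m)\<^sup>2 > 0" using m Nm by simp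
    fix u :: "'k mat2" assume u: "det2 u = 1" "N (msub u id2) < a (det2 m) / (N m)\<^sup>2"
    have "msub (mmul (inv2 m) (mmul u m)) (smul (det2 m) id2) = mmul (inv2 m) (mmul (msub u id2) m)"
      by (simp add: msub_mmul mmul_inv2_smul)
    hence "N (msub (mmul (inv2 m) (mmul u m)) (smul (det2 m) id2)) \<le> N m * (N (msub u id2) * N m)"
      using N_mmul[of "inv2 m" "mmul (msub u id2) m"] N_mmul[of "msub u id2" m]
      by (simp) (smt (verit) N_nonneg mult_left_mono)
    also have "\<dots> < a (det2 m)" using u(2) Nm by (simp add: field_simps power2_eq_square)
    finally have "E m (mmul u m) = a (det2 m)"
      using N_eq_of_msub[of "mmul (inv2 m) (mmul u m)" "smul (det2 m) id2"] by (simp add: E_def N_smul)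
    hence "dd m (mmul u m) = 1" using m u by (simp add: dd_def power2_eq_square)
    hence "V m = V (mmul u m)" using V_eq_iff[of m "mmul u m"] m u by simp
    thus "act_vertex u (V m) = V m" unfolding act_vertex_V by (rule sym)
  qed
qed

subsection \<open>Rays from vectors and elementary groups\<close>

text \<open>The ray towards the end given by the line spanned by the first column of \<open>m\<close>.\<close>

definition ray :: "'k mat2 \<Rightarrow> nat \<Rightarrow> ('k \<times> 'k) set set" where
  "ray m i = V (mmul m (1, 0, 0, \<pi> ^ i))"

lemma BT_ray_ray:
  assumes m: "det2 m \<noteq> 0"
  shows "BT_ray a (ray m)"
proof -
  have E: "E (mmul m (1, 0, 0, \<pi> ^ i)) (mmul m (1, 0, 0, \<pi> ^ (i + j))) = a (det2 m) * a \<pi> ^ i" for i j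
  proof -
    have "a \<pi> ^ (i + j) \<le> a \<pi> ^ i" using a_pi_lt by (intro power_decreasing) auto
    thus ?thesis unfolding E_mmul_left by (simp add: E_def a_power a_mult max_def)
  qed
  show ?thesis
    unfolding BT_ray_def
  proof (intro conjI allI)
    fix i
    show "ray m i \<in> BT_vertices a" unfolding ray_def using m by (intro V_in_BT) simp
    show "BT_adj a (ray m i) (ray m (Suc i))"
      unfolding ray_def using m E[of i 1] by (intro BT_adjI) (simp_all add: a_mult a_power)
    have "a \<pi> ^ 2 < 1 ^ 2" using a_pi_lt by (intro power_strict_mono) auto
    hence "dd (mmul m (1, 0, 0, \<pi> ^ i)) (mmul m (1, 0, 0, \<pi> ^ (i + 2))) \<noteq> 1"
      unfolding dd_def E using m by (simp add: a_mult a_power power2_eq_square power_add)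
    thus "ray m (Suc (Suc i)) \<noteq> ray m i"
      unfolding ray_def using V_eq_iff[of "mmul m (1, 0, 0, \<pi> ^ i)" "mmul m (1, 0, 0, \<pi> ^ (i + 2))"] m by auto
  qed
qed

text \<open>Along the ray the off-diagonal entry \<open>y\<close> is multiplied by growing powers of
  \<open>\<pi>\<close> and becomes negligible against \<open>x\<close>; the diagonal part only
  shifts the ray, by the valuation of \<open>z / x\<close>.\<close>

lemma same_end_ray:
  assumes d: "det2 m \<noteq> 0" "det2 m' \<noteq> 0" and g: "mmul g m = mmul m' (x, y, 0, z)" and xz: "x \<noteq> 0" "z \<noteq> 0"
  shows "same_end (act_vertex g \<circ> ray m) (ray m')"
proof -
  obtain k where k: "a (z / x) = a \<pi> powi k" using a_pi_powi[of "z / x"] xz by auto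
  obtain j where j: "a \<pi> ^ j < a x / max (a y) 1"
    using pi_power_less[of "a x / max (a y) 1"] xz by (auto simp: less_max_iff_disj)
  have j': "a y * a \<pi> ^ i \<le> a x" if "i \<ge> j" for i
  proof -
    have "a y * a \<pi> ^ i \<le> max (a y) 1 * a \<pi> ^ j"
      using that a_pi_lt by (intro mult_mono power_decreasing) auto
    also have "\<dots> < a x" using j by (simp add: field_simps)
    finally show ?thesis by simp
  qed
  \<comment> \<open>The difference of \<open>L\<close> and \<open>M\<close> is the valuation
    \<open>k\<close>, split by \<open>nat\<close> according to its sign; the common summand
    \<open>j\<close> makes \<open>y\<close> negligible.\<close>
  define M L where "M = j + nat (- k)" and "L = j + nat k"
  have zx: "a z * a \<pi> ^ (M + i) = a x * a \<pi> ^ (L + i)" for i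
  proof -
    have "a \<pi> powi (int (M + i) + k) = a \<pi> powi int (L + i)"
      by (rule arg_cong[where f = "power_int _"]) (simp add: M_def L_def)
    hence "a \<pi> ^ (M + i) * a \<pi> powi k = a \<pi> ^ (L + i)"
      by (simp only: power_int_add[OF disjI1] a_eq_0 pi_nz not_False_eq_True power_int_of_nat)
    moreover have "a z = a x * a \<pi> powi k" using k xz by (simp add: a_divide field_simps)
    ultimately show ?thesis by (simp add: mult_ac)
  qed
  have "(act_vertex g \<circ> ray m) (M + i) = ray m' (L + i)" for i
  proof -
    let ?T = "(x, y * \<pi> ^ (M + i), 0, z * \<pi> ^ (M + i)) :: 'k mat2" and ?S = "(1, 0, 0, \<pi> ^ (L + i)) :: 'k mat2"
    have "mmul (x, y, 0, z) (1, 0, 0, \<pi> ^ (M + i)) = ?T" by simp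
    hence T: "mmul g (mmul m (1, 0, 0, \<pi> ^ (M + i))) = mmul m' ?T"
      using g by (metis mmul_assoc)
    have "a y * a \<pi> ^ (M + i) * a \<pi> ^ (L + i) \<le> a x * a \<pi> ^ (L + i)"
      using j'[of "M + i"] by (intro mult_right_mono) (auto simp: M_def)
    hence "E ?S ?T = a x * a \<pi> ^ (L + i)"
      using zx[of i] by (simp add: E_def a_mult a_power max_def mult_ac)
    hence "dd ?S ?T = 1"
      unfolding dd_def using zx[of i] xz by (simp add: a_mult a_power power2_eq_square mult_ac)
    hence "dd (mmul m' ?T) (mmul m' ?S) = 1"
      using dd_mmul_left[OF d(2)] dd_commute by metis
    hence "V (mmul m' ?T) = V (mmul m' ?S)"
      using V_eq_iff[of "mmul m' ?T" "mmul m' ?S"] d xz by simp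
    thus ?thesis by (simp add: ray_def act_vertex_V T)
  qed
  thus ?thesis unfolding same_end_def by blast
qed

lemma not_same_end_ray:
  assumes m: "det2 m \<noteq> 0"
  shows "\<not> same_end (ray m) (ray (mmul m (0, 1, 1, 0)))"
proof
  assume "same_end (ray m) (ray (mmul m (0, 1, 1, 0)))"
  then obtain i j where "\<And>k. ray m (i + k) = ray (mmul m (0, 1, 1, 0)) (j + k)"
    unfolding same_end_def by blast
  \<comment> \<open>Both rays may start at the same vertex, so index 0 could give no contradiction.
    From index 1 on they lie on opposite sides of it.\<close>
  from this[of 1] have "V (mmul m (1, 0, 0, \<pi> ^ Suc i)) = V (mmul m (0, \<pi> ^ Suc j, 1, 0))"
    by (simp add: ray_def mmul_assoc)
  hence "dd (mmul m (1, 0, 0, \<pi> ^ Suc i)) (mmul m (0, \<pi> ^ Suc j, 1, 0)) = 1"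
    using V_eq_iff[of "mmul m (1, 0, 0, \<pi> ^ Suc i)" "mmul m (0, \<pi> ^ Suc j, 1, 0)"] m by simp
  moreover have lt: "a \<pi> ^ Suc i * a \<pi> ^ Suc j < 1"
    unfolding power_add[symmetric] add_Suc using a_pi_lt by (intro power_Suc_less_one) auto
  have "E (1, 0, 0, \<pi> ^ Suc i) (0, \<pi> ^ Suc j, 1, 0) = 1"
    using lt by (simp add: E_def a_mult a_power max_def)
  ultimately show False
    unfolding dd_mmul_left[OF m] unfolding dd_def using lt by (simp add: a_mult a_power)
qed

lemma elementary_fixes_line:
  assumes m: "det2 m \<noteq> 0" and g: "\<And>g. g \<in> G \<Longrightarrow> det2 g = 1 \<and> (\<exists>x y z. conj2 m g = (x, y, 0, z))"
  shows "elementary a G"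
proof -
  have "same_end (act_vertex g \<circ> ray m) (ray m)" if gG: "g \<in> G" for g
  proof -
    obtain x y z where 1: "conj2 m g = (x, y, 0, z)" "det2 g = 1" using g[OF gG] by blast
    hence "x * z = 1" using det2_conj2[OF m, of g] by simp
    hence nz: "x \<noteq> 0" "z \<noteq> 0" by auto
    show ?thesis using same_end_ray[OF m m _ nz] mmul_conj2[OF m, of g] 1 by metis
  qed
  thus ?thesis using BT_ray_ray[OF m] unfolding elementary_def by blast
qed

lemma elementary_line_pair:
  assumes m: "det2 m \<noteq> 0"
    and g: "\<And>g. g \<in> G \<Longrightarrow> det2 g = 1 \<and> (\<exists>x y. conj2 m g = (x, 0, 0, y) \<or> conj2 m g = (0, x, y, 0))"
  shows "elementary a G"
proof -
  \<comment> \<open>Exchanging the two basis vectors gives the ray towards the other end of the same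
    apartment.\<close>
  let ?W = "(0, 1, 1, 0) :: 'k mat2"
  let ?m = "mmul m ?W"
  have m': "det2 ?m \<noteq> 0" using m by simp
  have "(same_end (act_vertex g \<circ> ray m) (ray m) \<and> same_end (act_vertex g \<circ> ray ?m) (ray ?m)) \<or>
        (same_end (act_vertex g \<circ> ray m) (ray ?m) \<and> same_end (act_vertex g \<circ> ray ?m) (ray m))"
    if gG: "g \<in> G" for g
  proof -
    obtain x y where 1: "conj2 m g = (x, 0, 0, y) \<or> conj2 m g = (0, x, y, 0)" and d: "det2 g = 1"
      using g[OF gG] by blast
    have gm: "mmul g m = mmul m (conj2 m g)" using mmul_conj2[OF m] by simp
    have gm': "mmul g ?m = mmul m (mmul (conj2 m g) ?W)" using gm by (metis mmul_assoc)
    have 2: "mmul ?m z = mmul m (mmul ?W z)" for z by (rule mmul_assoc)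
    from 1 show ?thesis
    proof
      assume c: "conj2 m g = (x, 0, 0, y)"
      hence nz: "x \<noteq> 0" "y \<noteq> 0" using det2_conj2[OF m, of g] d by auto
      have "mmul g m = mmul m (x, 0, 0, y)" "mmul g ?m = mmul ?m (y, 0, 0, x)"
        unfolding gm' 2 unfolding gm c by simp_all
      thus ?thesis using same_end_ray[OF m m _ nz] same_end_ray[OF m' m' _ nz(2,1)] by blast
    next
      assume c: "conj2 m g = (0, x, y, 0)"
      hence nz: "x \<noteq> 0" "y \<noteq> 0" using det2_conj2[OF m, of g] d by auto
      have "mmul g m = mmul ?m (y, 0, 0, x)" "mmul g ?m = mmul m (x, 0, 0, y)"
        unfolding gm' 2 unfolding gm c by simp_all
      thus ?thesis using same_end_ray[OF m m' _ nz(2,1)] same_end_ray[OF m' m _ nz] by blast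
    qed
  qed
  thus ?thesis using BT_ray_ray[OF m] BT_ray_ray[OF m'] not_same_end_ray[OF m]
    unfolding elementary_def by blast
qed

subsection \<open>Uniform discreteness\<close>

lemma ex_unipotent_basis:
  fixes x :: "'k mat2"
  assumes "det2 x = 1" "mtr x = 2" "x \<noteq> id2"
  shows "\<exists>m c. det2 m \<noteq> 0 \<and> c \<noteq> 0 \<and> conj2 m x = (1, c, 0, 1)"
proof (cases x)
  fix p q r s assume x: "x = (p, q, r, s)"
  have s: "s = 2 - p" and d: "p * s - q * r = 1" using assms(1,2) unfolding x by (auto simp: algebra_simps)
  have pq: "(p - 1) * (p - 1) = - q * r" using d unfolding s by (simp add: algebra_simps)
  show ?thesis
  proof (cases "r = 0")
    case True
    hence "p = 1" using pq by simp
    hence "x = (1, q, 0, 1)" using x s True by simp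
    thus ?thesis using assms(3)
      by (intro exI[of _ id2] exI[of _ q]) (auto simp: conj2_eqI id2_def)
  next
    case False
    \<comment> \<open>The columns are (x - 1) e and e for the first standard vector e; the former is
      fixed by \<open>x\<close> because (x - 1)^2 = 0.\<close>
    let ?m = "(p - 1, 1, r, 0) :: 'k mat2"
    have "mmul x ?m = mmul ?m (1, 1, 0, 1)"
      using pq unfolding x s by (simp add: algebra_simps)
    thus ?thesis using False
      by (intro exI[of _ ?m] exI[of _ 1]) (simp add: conj2_eqI)
  qed
qed

text \<open>If \<open>x\<close>, its conjugate by a generator \<open>b\<close>, and their product are all unipotent, then
  \<open>b\<close> preserves the line fixed by \<open>x\<close>.\<close>

lemma uniform_discreteness:
  assumes "B \<ge> 1"
  shows "\<exists>e>0. \<forall>h r x. (\<forall>i<r. h i \<in> SL2 \<and> N (h i) \<le> B) \<longrightarrow> discrete_subgroup a (gen_grp h r)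
     \<longrightarrow> \<not> elementary a (gen_grp h r) \<longrightarrow> x \<in> gen_grp h r \<longrightarrow> N (msub x id2) < e \<longrightarrow> x = id2"
proof -
  obtain e where e: "e > 0" "e \<le> 1" and uni: "\<And>H x. is_grp H \<Longrightarrow> discrete_subgroup a H \<Longrightarrow> x \<in> H \<Longrightarrow>
      N (msub x id2) < e \<Longrightarrow> mtr x = 2"
    using near_id2_unipotent by blast
  \<comment> \<open>The divisor \<open>B\<^sup>2\<close> pays for the conjugation by a generator and
    its inverse, so that the conjugate still lies in the range of \<open>uni\<close>.\<close>
  show ?thesis
  proof (intro exI[of _ "e / B\<^sup>2"] conjI allI impI)
    show "e / B\<^sup>2 > 0" using e assms by simp
    fix h r x
    assume h: "\<forall>i<r. h i \<in> SL2 \<and> N (h i) \<le> B" and disc: "discrete_subgroup a (gen_grp h r)"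
      and ne: "\<not> elementary a (gen_grp h r)" and x: "x \<in> gen_grp h r" "N (msub x id2) < e / B\<^sup>2"
    let ?H = "gen_grp h r"
    have H: "is_grp ?H" using h by (intro is_grp_gen_grp) blast
    have xB: "B * (N (msub x id2) * B) < e" using x(2) assms by (simp add: field_simps power2_eq_square)
    have "N (msub x id2) * 1 \<le> N (msub x id2) * B\<^sup>2" using assms by (intro mult_left_mono) auto
    hence xe: "N (msub x id2) < e" using xB by (simp add: power2_eq_square mult_ac)
    have dx: "det2 x = 1" and tx: "mtr x = 2" using is_grpD(2)[OF H x(1)] uni[OF H disc x(1) xe] .
    show "x = id2"
    proof (rule ccontr)
      assume "x \<noteq> id2"
      then obtain m c where m: "det2 m \<noteq> 0" and c: "c \<noteq> 0" "conj2 m x = (1, c, 0, 1)"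
        using ex_unipotent_basis dx tx by blast
      have line: "\<exists>u v w. conj2 m (h i) = (u, v, 0, w)" if i: "i < r" for i
      proof -
        let ?b = "h i"
        have b: "?b \<in> ?H" "det2 ?b = 1" "N ?b \<le> B" using gen_in_gen_grp[OF i] h i by (auto simp: SL2_def)
        define x' where "x' = mmul ?b (mmul x (inv2 ?b))"
        have x': "x' \<in> ?H" unfolding x'_def using is_grpD(3,4)[OF H] b x by blast
        have "msub x' id2 = mmul ?b (mmul (msub x id2) (inv2 ?b))"
          unfolding x'_def using b by (simp add: msub_mmul)
        hence "N (msub x' id2) \<le> N ?b * (N (msub x id2) * N ?b)"
          using N_mmul[of ?b "mmul (msub x id2) (inv2 ?b)"] N_mmul[of "msub x id2" "inv2 ?b"]
          by simp (smt (verit) N_nonneg mult_left_mono)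
        also have "\<dots> \<le> B * (N (msub x id2) * B)" using b assms by (intro mult_mono) auto
        finally have xe': "N (msub x' id2) < e" using xB by simp
        have "N x' \<le> 1" using N_le_msub[of x' id2] xe' e by auto
        have "msub (mmul x x') id2 = msub (mmul (msub x id2) x') (msub id2 x')"
          unfolding msub_mmul mmul_id2 by (cases "mmul x x'"; cases x') (simp add: id2_def)
        hence "N (msub (mmul x x') id2) \<le> max (N (msub x id2) * N x') (N (msub x' id2))"
          using N_msub[of "mmul (msub x id2) x'" "msub id2 x'"] N_mmul[of "msub x id2" x'] N_msub_commute[of x' id2]
          by (simp add: max.coboundedI1 le_max_iff_disj) linarith
        also have "\<dots> < e"
          using xe' xe \<open>N x' \<le> 1\<close> mult_left_le[of "N x'" "N (msub x id2)"] by auto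
        finally have "mtr (mmul x x') = 2"
          using is_grpD(4)[OF H x(1) x'] by (intro uni[OF H disc])
        hence t2: "mtr (conj2 m (mmul x x')) = 2" using m by simp
        obtain u v s w where b4: "conj2 m ?b = (u, v, s, w)" by (cases "conj2 m ?b")
        have "u * w - v * s = 1" using det2_conj2[OF m, of ?b] b b4 by simp
        \<comment> \<open>The trace of \<open>mmul x x'\<close> written in the basis
          \<open>m\<close>. It differs from 2 by c^2 s^2, where \<open>s\<close> is the entry that
          measures whether \<open>h i\<close> moves the line fixed by \<open>x\<close>.\<close>
        moreover have 0: "mtr (mmul (1, c, 0, 1) (mmul (u, v, s, w) (mmul (1, c, 0, 1) (w, - v, - s, u))))
            = 2 * (u * w - v * s) - c\<^sup>2 * s\<^sup>2"
          by (simp add: power2_eq_square algebra_simps)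
        ultimately have "mtr (mmul (1, c, 0, 1) (mmul (u, v, s, w) (mmul (1, c, 0, 1) (w, - v, - s, u)))) = 2 - c\<^sup>2 * s\<^sup>2"
          by simp
        hence "mtr (conj2 m (mmul x x')) = 2 - c\<^sup>2 * s\<^sup>2"
          unfolding x'_def by (simp add: conj2_mmul[OF m] conj2_inv2[OF m] c b4)
        hence "c\<^sup>2 * s\<^sup>2 = 0" using t2 by simp
        hence "s = 0" using c by simp
        thus ?thesis using b4 by blast
      qed
      have "\<exists>u v w. conj2 m g = (u, v, 0, w)" if "g \<in> ?H" for g
        using that
      proof (induction rule: gen_grp_induct)
        case id
        then show ?case using m by (simp add: id2_def[symmetric]) (simp add: id2_def)
      next
        case (gen x i)
        obtain u v w u' v' w' where "conj2 m x = (u, v, 0, w)" "conj2 m (h i) = (u', v', 0, w')"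
          using gen.IH line[OF gen.hyps] by blast
        thus ?case by (simp add: conj2_mmul[OF m] conj2_inv2[OF m])
      qed
      hence "elementary a ?H" using is_grpD(2)[OF H] by (intro elementary_fixes_line[OF m]) blast
      thus False using ne by blast
    qed
  qed
qed

subsection \<open>Diagonalization of hyperbolic elements\<close>

text \<open>The roots are the fixed points of the map sending y to t - 1 / y. On elements of
  absolute value \<open>a t\<close> it contracts by 1 / (a t)^2, so completeness yields the root of
  large absolute value.\<close>

lemma ex_eigenvalue:
  assumes t: "a t > 1"
  shows "\<exists>l. a l = a t \<and> l * l - t * l + 1 = 0"
proof -
  define f where "f = rec_nat t (\<lambda>_ y. t - 1 / y)"
  have f0: "f 0 = t" and fS: "f (Suc n) = t - 1 / f n" for n by (simp_all add: f_def)
  have af: "a (f n) = a t" for n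
  proof (induction n)
    case (Suc n)
    have "a (1 / f n) < a t" using t Suc
      by (simp add: a_divide) (smt (verit) divide_less_eq_1 t)
    thus ?case unfolding fS by (rule a_diff_eq)
  qed (simp add: f0)
  have nz: "f n \<noteq> 0" for n using af[of n] t by auto
  define q where "q = 1 / (a t * a t)"
  have q: "0 < q" "q < 1"
  proof -
    have "1 * 1 < a t * a t" using t by (intro mult_strict_mono) auto
    thus "0 < q" "q < 1" by (auto simp: q_def)
  qed
  have st: "a (f (Suc n) - f n) \<le> q ^ n" for n
  proof (induction n)
    case 0
    then show ?case using t by (simp add: f0 fS a_divide divide_le_eq_1)
  next
    case (Suc n)
    have "f (Suc (Suc n)) - f (Suc n) = (f (Suc n) - f n) / (f (Suc n) * f n)"
      using nz[of n] nz[of "Suc n"] unfolding fS[of "Suc n"] by (subst (2) fS) (simp add: field_simps)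
    hence "a (f (Suc (Suc n)) - f (Suc n)) = q * a (f (Suc n) - f n)"
      by (simp add: a_divide a_mult af q_def)
    thus ?case using Suc q by simp
  qed
  have tel: "a (f (n + k) - f n) \<le> q ^ n" for n k
  proof (induction k)
    case (Suc k)
    have "a (f (Suc (n + k)) - f (n + k)) \<le> q ^ n"
      using st[of "n + k"] power_decreasing[of n "n + k" q] q by linarith
    hence "a ((f (Suc (n + k)) - f (n + k)) + (f (n + k) - f n)) \<le> q ^ n"
      using Suc by (intro a_add_le)
    thus ?case by simp
  qed (use q in simp)
  have "\<exists>l. k_converges a f l"
  proof -
    have "\<exists>M. \<forall>m\<ge>M. \<forall>n\<ge>M. a (f m - f n) < e" if e: "e > 0" for e
    proof -
      obtain M where M: "q ^ M < e" using real_arch_pow_inv[OF e q(2)] by blast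
      have "a (f m - f n) < e" if "m \<ge> M" "n \<ge> M" for m n
      proof -
        have "a (f m - f M) \<le> q ^ M" "a (f n - f M) \<le> q ^ M"
          using tel[of M "m - M"] tel[of M "n - M"] that by simp_all
        hence "a ((f m - f M) - (f n - f M)) \<le> q ^ M" by (rule a_diff_le)
        thus ?thesis using M by simp
      qed
      thus ?thesis by blast
    qed
    thus ?thesis using local_field unfolding nonarch_local_field_def by blast
  qed
  then obtain l where l: "\<And>e. e > 0 \<Longrightarrow> \<exists>M. \<forall>n\<ge>M. a (f n - l) < e" unfolding k_converges_def by blast
  have al: "a l = a t"
  proof -
    obtain n where "a (f n - l) < a t" using l[of "a t"] t by force
    hence "a (f n - (f n - l)) = a (f n)" by (intro a_diff_eq) (simp add: af)
    thus ?thesis by (simp add: af)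
  qed
  have "a (l * l - t * l + 1) \<le> e" if e: "e > 0" for e
  proof -
    have "0 < e / a t" using e t by (intro divide_pos_pos) linarith+
    then obtain M where M: "\<forall>n\<ge>M. a (f n - l) < e / a t" using l by blast
    have t0: "0 < a t" using t by linarith
    have 1: "a (f M - l) \<le> e / a t" "a (f (Suc M) - l) \<le> e / a t" using M by (auto intro: less_imp_le)
    have "f (Suc M) * f M = t * f M - 1" unfolding fS using nz[of M] by (simp add: field_simps)
    hence "l * l - t * l + 1 = t * (f M - l) - (l * (f M - l) + f M * (f (Suc M) - l))"
      by (simp add: algebra_simps)
    moreover have "a (t * (f M - l)) \<le> e" "a (l * (f M - l)) \<le> e" "a (f M * (f (Suc M) - l)) \<le> e"
      using 1 t0 unfolding a_mult al af by (simp_all only: pos_le_divide_eq mult.commute)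
    ultimately show ?thesis by (simp only:) (intro a_diff_le a_add_le)
  qed
  hence "a (l * l - t * l + 1) \<le> 0" by (rule field_le_epsilon[of _ 0, simplified]) auto
  thus ?thesis using al by auto
qed

lemma ex_diagonalization:
  assumes d: "det2 x = 1" and t: "a (mtr x) > 1"
  shows "\<exists>m l. det2 m \<noteq> 0 \<and> a l > 1 \<and> conj2 m x = (l, 0, 0, 1 / l)"
proof (cases x)
  fix p q r s assume x: "x = (p, q, r, s)"
  obtain l where l: "a l = a (p + s)" "l * l - (p + s) * l + 1 = 0" using ex_eigenvalue[of "p + s"] t x by auto
  have al: "a l > 1" using l t x by simp
  hence l0: "l \<noteq> 0" by auto
  define k where "k = 1 / l"
  have lk: "l * k = 1" "l + k = p + s" using l0 l(2) by (simp_all add: k_def field_simps)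
  have ne: "l \<noteq> k"
  proof
    assume "l = k"
    hence "a l * a l = 1" using lk(1) by (metis a_mult a_one)
    thus False using al by (smt (verit) mult_less_cancel_left1)
  qed
  have k: "k = p + s - l" using lk(2) by (simp add: algebra_simps)
  have dd: "p * s - q * r = 1" using d x by simp
  have "\<exists>m. det2 m \<noteq> 0 \<and> mmul x m = mmul m (l, 0, 0, k)"
  proof (cases "r = 0")
    case False
    \<comment> \<open>The columns are eigenvectors for \<open>l\<close> and \<open>k\<close>, read
      off from the second row of \<open>x\<close>.\<close>
    let ?m = "(l - s, k - s, r, r) :: 'k mat2"
    have "det2 ?m \<noteq> 0" using False ne by (simp add: algebra_simps)
    moreover have "mmul x ?m = mmul ?m (l, 0, 0, k)"
      using lk(1) dd unfolding x k by (simp add: algebra_simps)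
    ultimately show ?thesis by blast
  next
    case True
    have "(l - p) * (l - s) = 0" using lk(1) dd True unfolding k by (simp add: algebra_simps)
    hence "l = p \<and> k = s \<or> l = s \<and> k = p" unfolding k by auto
    thus ?thesis
    proof
      assume 1: "l = p \<and> k = s"
      show ?thesis using 1 True ne x by (intro exI[of _ "(1, q, 0, k - l)"]) (simp add: algebra_simps)
    next
      assume 1: "l = s \<and> k = p"
      show ?thesis using 1 True ne x by (intro exI[of _ "(q, 1, l - k, 0)"]) (simp add: algebra_simps)
    qed
  qed
  thus ?thesis using al conj2_eqI unfolding k_def by blast
qed

lemma commutes_diagonal:
  fixes x :: "'k mat2"
  assumes "mmul x (l, 0, 0, k) = mmul (l, 0, 0, k) x" "l \<noteq> k"
  shows "\<exists>u v. x = (u, 0, 0, v)"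
proof (cases x)
  fix p q r s assume x: "x = (p, q, r, s)"
  have "q * (k - l) = 0" "r * (k - l) = 0" using assms(1) unfolding x by (auto simp: algebra_simps)
  thus ?thesis using assms(2) x by auto
qed

lemma anticommutes_diagonal:
  fixes x :: "'k mat2"
  assumes "mmul x (l, 0, 0, k) = mmul (k, 0, 0, l) x" "l \<noteq> k"
  shows "\<exists>u v. x = (0, u, v, 0)"
proof (cases x)
  fix p q r s assume x: "x = (p, q, r, s)"
  have "p * (k - l) = 0" "s * (k - l) = 0" using assms(1) unfolding x by (auto simp: algebra_simps)
  thus ?thesis using assms(2) x by auto
qed

lemma one_div_ne: "a l > 1 \<Longrightarrow> l \<noteq> 1 / l"
proof
  assume l: "a l > 1" "l = 1 / l"
  have "a l = 1 / a l" using a_divide[of 1 l] l(2) by simp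
  moreover have "1 / a l < 1" using l(1) by (simp add: divide_less_eq_1)
  ultimately show False using l(1) by linarith
qed

text \<open>In an eigenbasis of \<open>x\<close>, a matrix commuting with \<open>x\<close> is
  diagonal and one inverting \<open>x\<close> is antidiagonal, and such matrices are closed under
  products. Asking for relations of the generators only keeps their number finite.\<close>

lemma elementary_normalizes_hyperbolic:
  assumes h: "\<forall>i<r. h i \<in> SL2" and x: "det2 x = 1" "a (mtr x) > 1"
    and norm: "\<And>i. i < r \<Longrightarrow> mmul (h i) x = mmul x (h i) \<or> mmul (h i) x = mmul (inv2 x) (h i)"
  shows "elementary a (gen_grp h r)"
proof -
  obtain m l where m: "det2 m \<noteq> 0" and l: "a l > 1" "conj2 m x = (l, 0, 0, 1 / l)"
    using ex_diagonalization x by blast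
  have ne: "l \<noteq> 1 / l" using one_div_ne l by blast
  have inv: "conj2 m (inv2 x) = (1 / l, 0, 0, l)" using l m by (simp add: conj2_inv2)
  have "\<exists>u v. conj2 m (h i) = (u, 0, 0, v) \<or> conj2 m (h i) = (0, u, v, 0)" if "i < r" for i
    using norm[OF that]
  proof
    assume "mmul (h i) x = mmul x (h i)"
    hence "conj2 m (mmul (h i) x) = conj2 m (mmul x (h i))" by simp
    thus ?thesis using commutes_diagonal[OF _ ne, of "conj2 m (h i)"] unfolding conj2_mmul[OF m] l by blast
  next
    assume "mmul (h i) x = mmul (inv2 x) (h i)"
    hence "conj2 m (mmul (h i) x) = conj2 m (mmul (inv2 x) (h i))" by simp
    thus ?thesis using anticommutes_diagonal[OF _ ne, of "conj2 m (h i)"] unfolding conj2_mmul[OF m] l inv by blast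
  qed
  note pair = this
  have "\<exists>u v. conj2 m g = (u, 0, 0, v) \<or> conj2 m g = (0, u, v, 0)" if "g \<in> gen_grp h r" for g
    using that
  proof (induction rule: gen_grp_induct)
    case id
    then show ?case using m by (simp add: id2_def[symmetric]) (simp add: id2_def)
  next
    case (gen x i)
    obtain u v u' v' where "conj2 m x = (u, 0, 0, v) \<or> conj2 m x = (0, u, v, 0)"
      "conj2 m (h i) = (u', 0, 0, v') \<or> conj2 m (h i) = (0, u', v', 0)"
      using gen.IH pair[OF gen.hyps] by blast
    thus ?case by (auto simp: conj2_mmul[OF m] conj2_inv2[OF m]) blast+
  qed
  thus ?thesis using is_grpD(2)[OF is_grp_gen_grp[OF h]] by (intro elementary_line_pair[OF m]) blast
qed

subsection \<open>Reduction of relations\<close>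

primrec mprod :: "'k mat2 list \<Rightarrow> 'k mat2" where
  "mprod [] = id2"
| "mprod (x # xs) = mmul x (mprod xs)"

lemma mprod_append: "mprod (xs @ ys) = mmul (mprod xs) (mprod ys)"
  by (induction xs) (simp_all add: mmul_assoc)

lemma E_id2: "E x id2 = N x" "E id2 x = N x"
  by (simp_all add: E_def)

lemma E_mmul_id2: "det2 p = 1 \<Longrightarrow> E p (mmul p x) = N x"
  using E_mmul_left[of p id2 x] by (simp add: E_id2)

text \<open>If no two neighbours can be merged, then the partial products escape to infinity.\<close>

lemma merge_or_grow_step:
  assumes "det2 x = 1" "det2 y = 1" "N x \<le> R" "N y \<le> R" "det2 p = 1" "N p \<le> N (mmul p x)" "\<not> N (mmul x y) \<le> R"
  shows "N (mmul p x) < N (mmul p (mmul x y))"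
proof -
  let ?q = "mmul p x" and ?r = "mmul p (mmul x y)"
  have 1: "1 \<le> N ?q" "1 \<le> N x" using assms by (simp_all add: N_ge_1)
  \<comment> \<open>The step from \<open>p\<close> to \<open>?q\<close> does not lead towards
    \<open>id2\<close>, and \<open>p\<close> and \<open>?r\<close> are further apart than either
    step allows to be undone. The alternative containing \<open>N p\<close> fails because
    \<open>N p \<le> N ?q\<close>, so the second step strictly increases the norm.\<close>
  have "E p ?r * E ?q id2 \<le> max (E p ?q * E ?r id2) (E p id2 * E ?q ?r)" by (rule four_point)
  moreover have "E ?q ?r = N y" using E_mmul_id2[of ?q y] assms by (simp add: mmul_assoc)
  ultimately have "N (mmul x y) * N ?q \<le> max (N x * N ?r) (N p * N y)"
    using assms by (simp add: E_mmul_id2 E_id2)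
  also have "\<dots> \<le> max (R * N ?r) (R * N p)"
    unfolding mult.commute[of R "N p"] using assms
    by (intro max.mono mult_right_mono mult_left_mono) auto
  finally have "R * N ?q < max (R * N ?r) (R * N p)"
    using mult_strict_right_mono[of R "N (mmul x y)" "N ?q"] assms 1 by linarith
  moreover have "R * N p \<le> R * N ?q" using assms 1 by (intro mult_left_mono) auto
  ultimately have "R * N ?q < R * N ?r" by linarith
  thus ?thesis using assms 1 by (simp add: mult_less_cancel_left)
qed

text \<open>The prefix \<open>p\<close> collects the letters already passed; the inequality
  \<open>N p \<le> N (mmul p x)\<close> is the invariant that \<open>merge_or_grow_step\<close>
  restores for the next letter.\<close>

lemma merge_or_grow:
  assumes "\<forall>u\<in>set (x # y # zs). det2 u = 1 \<and> N u \<le> R" "det2 p = 1" "N p \<le> N (mmul p x)"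
  shows "(\<exists>us u v vs. x # y # zs = us @ u # v # vs \<and> N (mmul u v) \<le> R) \<or>
    N (mmul p x) < N (mmul p (mprod (x # y # zs)))"
  using assms
proof (induction zs arbitrary: p x y)
  case (Nil p x y)
  show ?case
  proof (cases "N (mmul x y) \<le> R")
    case True
    thus ?thesis by (metis append_Nil)
  next
    case False
    thus ?thesis using merge_or_grow_step[of x y R p] Nil by simp
  qed
next
  case (Cons z zs p x y)
  show ?case
  proof (cases "N (mmul x y) \<le> R")
    case True
    thus ?thesis by (metis append_Nil)
  next
    case False
    hence lt: "N (mmul p x) < N (mmul (mmul p x) y)"
      using merge_or_grow_step[of x y R p] Cons.prems by (simp add: mmul_assoc)
    have "(\<exists>us u v vs. y # z # zs = us @ u # v # vs \<and> N (mmul u v) \<le> R) \<or>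
      N (mmul (mmul p x) y) < N (mmul (mmul p x) (mprod (y # z # zs)))"
      using Cons.prems lt by (intro Cons.IH) auto
    thus ?thesis
    proof
      assume "\<exists>us u v vs. y # z # zs = us @ u # v # vs \<and> N (mmul u v) \<le> R"
      thus ?thesis by (metis append_Cons)
    next
      assume "N (mmul (mmul p x) y) < N (mmul (mmul p x) (mprod (y # z # zs)))"
      thus ?thesis using lt by (simp add: mmul_assoc)
    qed
  qed
qed

text \<open>A product equal to \<open>id2\<close> cannot grow, so some two neighbours multiply to an
  element of \<open>S\<close>; merging them shortens the list and stays inside \<open>S\<close>.
  Hence \<open>\<phi>\<close> has to be multiplicative only where all three elements lie in
  \<open>S\<close>.\<close>

lemma relation_reduction:
  assumes S: "\<And>x. x \<in> S \<longleftrightarrow> x \<in> G \<and> N x \<le> R" and G: "is_grp G"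
    and \<phi>: "\<And>x y. x \<in> S \<Longrightarrow> y \<in> S \<Longrightarrow> mmul x y \<in> S \<Longrightarrow> \<phi> (mmul x y) = mmul (\<phi> x) (\<phi> y)" "\<phi> id2 = id2"
  shows "set xs \<subseteq> S \<Longrightarrow> mprod xs = id2 \<Longrightarrow> mprod (map \<phi> xs) = id2"
proof (induction xs rule: length_induct)
  case (1 xs)
  show ?case
  proof -
    consider (n) "xs = []" | (s) x where "xs = [x]" | (c) x y zs where "xs = x # y # zs"
      by (metis neq_Nil_conv)
    then show ?thesis
    proof cases
      case n
      thus ?thesis by simp
    next
      case (s x)
      thus ?thesis using 1 \<phi> by simp
    next
      case (c x y zs)
      have det: "\<forall>u\<in>set (x # y # zs). det2 u = 1 \<and> N u \<le> R"
        using "1.prems"(1) S is_grpD(2)[OF G] unfolding c by blast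
      hence "1 \<le> N x" using N_ge_1 by simp
      \<comment> \<open>Starting from the empty prefix, growth would make \<open>N x\<close> smaller
        than the norm 1 of the full product.\<close>
      hence "\<not> N (mmul id2 x) < N (mmul id2 (mprod (x # y # zs)))"
        using "1.prems"(2) unfolding c by simp
      then obtain us u v vs where uv: "xs = us @ u # v # vs" "N (mmul u v) \<le> R"
        using merge_or_grow[OF det, of id2] \<open>1 \<le> N x\<close> unfolding c by auto
      have in_S: "u \<in> S" "v \<in> S" "mmul u v \<in> S" using "1.prems"(1) uv S is_grpD(4)[OF G] by auto
      have "mprod (map \<phi> (us @ mmul u v # vs)) = id2"
        using 1 uv in_S by (intro "1.IH"[rule_format]) (auto simp: mprod_append mmul_assoc)
      thus ?thesis using \<phi>(1)[OF in_S] by (simp add: uv mprod_append mmul_assoc)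
    qed
  qed
qed

subsection \<open>Shifts along a ray\<close>

text \<open>For \<open>g\<close> fixing the end of \<open>\<rho>\<close>, the integer
  \<open>s\<close> is its Busemann translation, positive towards the end. The bound
  \<open>0 \<le> int i + s\<close> prevents truncation by \<open>nat\<close>.\<close>

definition shift :: "(nat \<Rightarrow> ('k \<times> 'k) set set) \<Rightarrow> 'k mat2 \<Rightarrow> int \<Rightarrow> bool" where
  "shift \<rho> g s \<longleftrightarrow> (\<exists>K. \<forall>i\<ge>K. 0 \<le> int i + s \<and> act_vertex g (\<rho> i) = \<rho> (nat (int i + s)))"

lemma shift_same_end: "(\<exists>s. shift \<rho> g s) \<longleftrightarrow> same_end (act_vertex g \<circ> \<rho>) \<rho>"
proof
  assume "\<exists>s. shift \<rho> g s"
  then obtain s K where K: "\<And>i. i \<ge> K \<Longrightarrow> 0 \<le> int i + s \<and> act_vertex g (\<rho> i) = \<rho> (nat (int i + s))"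
    unfolding shift_def by blast
  have "(act_vertex g \<circ> \<rho>) (K + i) = \<rho> (nat (int K + s) + i)" for i
  proof -
    have "0 \<le> int K + s" using K[of K] by simp
    hence "nat (int (K + i) + s) = nat (int K + s) + i" by linarith
    thus ?thesis using K[of "K + i"] by simp
  qed
  thus "same_end (act_vertex g \<circ> \<rho>) \<rho>" unfolding same_end_def by blast
next
  assume "same_end (act_vertex g \<circ> \<rho>) \<rho>"
  then obtain m n where mn: "\<And>i. act_vertex g (\<rho> (m + i)) = \<rho> (n + i)" unfolding same_end_def by auto
  have "0 \<le> int i + (int n - int m) \<and> act_vertex g (\<rho> i) = \<rho> (nat (int i + (int n - int m)))" if "i \<ge> m" for i
  proof -
    have "nat (int i + (int n - int m)) = n + (i - m)" using that by simp
    thus ?thesis using mn[of "i - m"] that by simp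
  qed
  thus "\<exists>s. shift \<rho> g s" unfolding shift_def by blast
qed

lemma shift_mmul:
  assumes "shift \<rho> g s" "shift \<rho> h t"
  shows "shift \<rho> (mmul g h) (s + t)"
proof -
  obtain K L where K: "\<And>i. i \<ge> K \<Longrightarrow> 0 \<le> int i + s \<and> act_vertex g (\<rho> i) = \<rho> (nat (int i + s))"
    and L: "\<And>i. i \<ge> L \<Longrightarrow> 0 \<le> int i + t \<and> act_vertex h (\<rho> i) = \<rho> (nat (int i + t))"
    using assms unfolding shift_def by blast
  have "0 \<le> int i + (s + t) \<and> act_vertex (mmul g h) (\<rho> i) = \<rho> (nat (int i + (s + t)))"
    if i: "i \<ge> L + (K + nat (- t))" for i
  proof -
    have 1: "0 \<le> int i + t" "act_vertex h (\<rho> i) = \<rho> (nat (int i + t))" using L i by simp_all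
    have "nat (int i + t) \<ge> K" using i by linarith
    from K[OF this] show ?thesis using 1 by (simp add: act_vertex_mmul algebra_simps)
  qed
  thus ?thesis unfolding shift_def by blast
qed

lemma shift_inv2:
  assumes "shift \<rho> g s" "det2 g = 1"
  shows "shift \<rho> (inv2 g) (- s)"
proof -
  obtain K where K: "\<And>i. i \<ge> K \<Longrightarrow> 0 \<le> int i + s \<and> act_vertex g (\<rho> i) = \<rho> (nat (int i + s))"
    using assms unfolding shift_def by blast
  have "0 \<le> int i + - s \<and> act_vertex (inv2 g) (\<rho> i) = \<rho> (nat (int i + - s))" if i: "i \<ge> K + nat s" for i
  proof -
    have 1: "nat (int i - s) \<ge> K" "0 \<le> int i - s" using i by linarith+
    from K[OF 1(1)] 1(2) have "act_vertex g (\<rho> (nat (int i - s))) = \<rho> i" by simp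
    thus ?thesis using 1 act_vertex_inv2[OF assms(2)] by simp
  qed
  thus ?thesis unfolding shift_def by blast
qed

text \<open>Finite generation enters here: finitely many elements without translation fix a common
  vertex far out on the ray.\<close>

lemma shift_zero_common:
  assumes "finite F" "\<And>f. f \<in> F \<Longrightarrow> shift \<rho> f 0"
  shows "\<exists>K. \<forall>f\<in>F. \<forall>i\<ge>K. act_vertex f (\<rho> i) = \<rho> i"
proof -
  have "\<forall>f\<in>F. \<exists>K. \<forall>i\<ge>K. act_vertex f (\<rho> i) = \<rho> i" using assms(2) unfolding shift_def by auto
  then obtain K where K: "\<And>f i. f \<in> F \<Longrightarrow> i \<ge> K f \<Longrightarrow> act_vertex f (\<rho> i) = \<rho> i" by metis
  have "K f \<le> Max (K ` F)" if "f \<in> F" for f using assms(1) that by simp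
  thus ?thesis using K by (meson order_trans)
qed

lemma shift_mpow:
  assumes K: "\<And>i. i \<ge> K \<Longrightarrow> act_vertex g (\<rho> i) = \<rho> (i + s)"
  shows "i \<ge> K \<Longrightarrow> act_vertex (mpow g k) (\<rho> i) = \<rho> (i + k * s)"
  by (induction k) (simp_all add: act_vertex_mmul K add.assoc add.commute[of s])

text \<open>By Cayley-Hamilton each power is a combination of the previous two with coefficients
  \<open>mtr x\<close> and -1, both of absolute value at most 1.\<close>

lemma mpow_bounded:
  assumes d: "det2 x = 1" and t: "a (mtr x) \<le> 1"
  shows "N (mpow x k) \<le> N x"
proof -
  have sq: "mmul x x = msub (smul (mtr x) x) id2"
    using d by (cases x) (simp add: id2_def algebra_simps)
  have "N (mpow x k) \<le> N x \<and> N (mpow x (Suc k)) \<le> N x"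
  proof (induction k)
    case 0
    then show ?case using N_ge_1[OF d] by simp
  next
    case (Suc k)
    have "mpow x (Suc (Suc k)) = mmul (mmul x x) (mpow x k)" by (simp add: mmul_assoc)
    also have "\<dots> = msub (smul (mtr x) (mpow x (Suc k))) (mpow x k)"
      unfolding sq by (simp add: msub_mmul)
    finally have "N (mpow x (Suc (Suc k))) \<le> max (a (mtr x) * N (mpow x (Suc k))) (N (mpow x k))"
      using N_msub[of "smul (mtr x) (mpow x (Suc k))" "mpow x k"] unfolding N_smul by (simp only:)
    moreover have "a (mtr x) * N (mpow x (Suc k)) \<le> 1 * N x"
      using Suc t by (intro mult_mono) auto
    ultimately have "N (mpow x (Suc (Suc k))) \<le> N x" using Suc by linarith
    thus ?case using Suc by blast
  qed
  thus ?thesis ..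
qed

text \<open>Powers of \<open>x\<close> move a vertex of the ray arbitrarily far, whereas a trace of
  absolute value at most 1 would keep all powers bounded.\<close>

lemma shift_hyperbolic:
  assumes ray: "BT_ray a \<rho>" and d: "det2 x = 1" and s: "s > 0"
    and K: "\<And>i. i \<ge> K \<Longrightarrow> act_vertex x (\<rho> i) = \<rho> (i + s)"
  shows "a (mtr x) > 1"
proof (rule ccontr)
  assume t: "\<not> a (mtr x) > 1"
  obtain m where m: "\<And>i. det2 (m i) \<noteq> 0" "\<And>i. \<rho> i = V (m i)" using BT_ray_reps[OF ray] by blast
  let ?Q = "1 / a \<pi>" and ?m = "m K"
  have Q: "1 < ?Q" using a_pi_lt by (simp add: field_simps)
  define C where "C = (N ?m * (N x * N ?m))\<^sup>2 / (a (det2 ?m) * a (det2 ?m))"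
  have "?Q ^ k \<le> C" for k
  proof -
    have "?Q ^ k \<le> ?Q ^ (k * s)" using Q s by (intro power_increasing) auto
    also have "\<dots> \<le> dd ?m (m (K + k * s))" by (rule BT_ray_geodesic[OF ray m])
    also have "\<dots> = dd ?m (mmul (mpow x k) ?m)"
    proof (rule dd_cong)
      have "V (mmul (mpow x k) ?m) = act_vertex (mpow x k) (\<rho> K)" by (simp add: m(2) act_vertex_V)
      also have "\<dots> = \<rho> (K + k * s)" using shift_mpow[of K x \<rho> s K k] K by simp
      finally show "V (m (K + k * s)) = V (mmul (mpow x k) ?m)" using m(2) by simp
    qed (use m d in simp_all)
    also have "\<dots> \<le> C"
    proof -
      have "N (mmul (inv2 ?m) (mmul (mpow x k) ?m)) \<le> N ?m * N (mmul (mpow x k) ?m)"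
        using N_mmul[of "inv2 ?m"] by simp
      also have "\<dots> \<le> N ?m * (N (mpow x k) * N ?m)" by (intro mult_left_mono N_mmul) simp
      also have "\<dots> \<le> N ?m * (N x * N ?m)"
        using mpow_bounded[OF d] t by (intro mult_left_mono mult_right_mono) auto
      finally have "(E ?m (mmul (mpow x k) ?m))\<^sup>2 \<le> (N ?m * (N x * N ?m))\<^sup>2"
        unfolding E_def by (intro power_mono) auto
      thus ?thesis unfolding dd_def C_def using d by (simp add: divide_right_mono)
    qed
    finally show ?thesis .
  qed
  moreover obtain k where "C < ?Q ^ k" using real_arch_pow[OF Q] by blast
  ultimately show False using not_le by blast
qed

text \<open>A stabilizing matrix is integral in the basis \<open>m\<close>, and changing back costs
  a constant. Together with \<open>finite_discrete_bounded\<close>, vertex stabilizers in discrete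
  groups are finite.\<close>

lemma vertex_stabilizer_bounded:
  assumes m: "det2 m \<noteq> 0"
  shows "\<exists>B. \<forall>g. det2 g = 1 \<longrightarrow> act_vertex g (V m) = V m \<longrightarrow> N g \<le> B"
proof (intro exI allI impI)
  fix g :: "'k mat2" assume g: "det2 g = 1" "act_vertex g (V m) = V m"
  have "dd m (mmul g m) = 1" using V_eq_iff[of m "mmul g m"] g m by (simp add: act_vertex_V)
  hence "(E m (mmul g m))\<^sup>2 = (a (det2 m))\<^sup>2" using m g by (simp add: dd_def power2_eq_square)
  hence E: "N (mmul (inv2 m) (mmul g m)) = a (det2 m)"
    by (simp add: E_def power2_eq_iff_nonneg)
  have "mmul m (mmul (mmul (inv2 m) (mmul g m)) (inv2 m)) = mmul (mmul m (inv2 m)) (mmul g (mmul m (inv2 m)))"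
    by (simp add: mmul_assoc)
  also have "\<dots> = smul (det2 m * det2 m) g" by (simp add: mmul_inv2_smul)
  finally have "a (det2 m) * a (det2 m) * N g = N (mmul m (mmul (mmul (inv2 m) (mmul g m)) (inv2 m)))"
    by (simp add: N_smul a_mult)
  also have "\<dots> \<le> N m * N (mmul (mmul (inv2 m) (mmul g m)) (inv2 m))" by (rule N_mmul)
  also have "\<dots> \<le> N m * (a (det2 m) * N m)"
    using N_mmul[of "mmul (inv2 m) (mmul g m)" "inv2 m"] E by (intro mult_left_mono) auto
  finally have "a (det2 m) * (a (det2 m) * N g) \<le> a (det2 m) * (N m * N m)" by (simp add: mult_ac)
  hence "a (det2 m) * N g \<le> N m * N m" by (rule mult_left_le_imp_le) (simp add: m)
  thus "N g \<le> N m * N m / a (det2 m)" using m by (simp add: pos_le_divide_eq mult.commute)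
qed

lemma diagonal_eq:
  fixes l u v :: 'k
  assumes "l \<noteq> 0" "u * v = 1" "u + v = l + 1 / l"
  shows "u = l \<and> v = 1 / l \<or> u = 1 / l \<and> v = l"
proof -
  have v: "v = l + 1 / l - u" using assms(3) by (simp add: algebra_simps)
  have "(u - l) * (u - 1 / l) = 0" using assms(1,2) unfolding v by (simp add: field_simps)
  thus ?thesis unfolding v by auto
qed

text \<open>With \<open>b = y x y\<^sup>-\<^sup>1\<close>, the commutator of \<open>b\<close> and \<open>x\<close> fixes a tail of the ray, so its conjugates
  by powers of \<open>x\<close> lie in a finite vertex stabilizer and the commutator centralizes a power of \<open>x\<close>.\<close>

lemma normalizes_hyperbolic:
  assumes G: "is_grp G" "discrete_subgroup a G" and ray: "BT_ray a \<rho>"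
    and x: "x \<in> G" "shift \<rho> x s" "s > 0"
    and ends: "\<And>y. y \<in> G \<Longrightarrow> \<exists>t. shift \<rho> (mmul y (mmul x (inv2 y))) t"
  shows "a (mtr x) > 1 \<and> (\<forall>y\<in>G. mmul y x = mmul x y \<or> mmul y x = mmul (inv2 x) y)"
proof -
  note cl = is_grpD(3,4)[OF G(1)]
  have dx: "det2 x = 1" using is_grpD(2)[OF G(1) x(1)] .
  obtain K where K: "\<And>i. i \<ge> K \<Longrightarrow> act_vertex x (\<rho> i) = \<rho> (i + nat s)"
  proof -
    obtain K where K: "\<And>i. i \<ge> K \<Longrightarrow> act_vertex x (\<rho> i) = \<rho> (nat (int i + s))"
      using x(2) unfolding shift_def by blast
    have "nat (int i + s) = i + nat s" for i using x(3) by simp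
    thus ?thesis using that[of K] K by simp
  qed
  have t: "a (mtr x) > 1" using shift_hyperbolic[OF ray dx _ K] x(3) by simp
  obtain m l where m: "det2 m \<noteq> 0" and l: "a l > 1" "conj2 m x = (l, 0, 0, 1 / l)"
    using ex_diagonalization dx t by blast
  have l0: "l \<noteq> 0" using l(1) by auto
  have ne: "l \<noteq> 1 / l" using one_div_ne l by blast
  have "mmul y x = mmul x y \<or> mmul y x = mmul (inv2 x) y" if y: "y \<in> G" for y
  proof -
    define b where "b = mmul y (mmul x (inv2 y))"
    have dy: "det2 y = 1" using is_grpD(2)[OF G(1) y] .
    have b: "b \<in> G" "det2 b = 1" using cl x y dx dy by (simp_all add: b_def)
    define c where "c = mmul (mmul b x) (mmul (inv2 b) (inv2 x))"
    have c: "c \<in> G" "det2 c = 1" using cl x b dx by (simp_all add: c_def)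
    obtain t where "shift \<rho> b t" using ends[OF y] unfolding b_def by blast
    \<comment> \<open>Translations add up, so those in a commutator cancel.\<close>
    hence "shift \<rho> c ((t + s) + (- t + - s))"
      unfolding c_def using x b dx by (intro shift_mmul shift_inv2) auto
    then obtain L where L: "\<And>i. i \<ge> L \<Longrightarrow> act_vertex c (\<rho> i) = \<rho> i" unfolding shift_def by auto
    define P where "P = \<rho> (K + L)"
    obtain p where p: "det2 p \<noteq> 0" "P = V p" using BT_ray_reps[OF ray] unfolding P_def by blast
    obtain B where B: "\<And>g. det2 g = 1 \<Longrightarrow> act_vertex g P = P \<Longrightarrow> N g \<le> B"
      using vertex_stabilizer_bounded[OF p(1)] p(2) by blast
    let ?f = "\<lambda>k. mmul (inv2 (mpow x k)) (mmul c (mpow x k))"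
    have "?f k \<in> {x \<in> G. N x \<le> B}" for k
    proof -
      have xk: "mpow x k \<in> G" "det2 (mpow x k) = 1" using is_grpD(5)[OF G(1) x(1)] dx by simp_all
      have "act_vertex (mpow x k) P = \<rho> (K + L + k * nat s)"
        unfolding P_def using shift_mpow[of K x \<rho> "nat s" "K + L" k] K by simp
      hence "act_vertex c (act_vertex (mpow x k) P) = act_vertex (mpow x k) P" using L by simp
      hence "act_vertex (?f k) P = P"
        using act_vertex_inv2[OF xk(2)] by (simp add: act_vertex_mmul)
      moreover have "det2 (?f k) = 1" using c xk by simp
      ultimately show ?thesis using B cl xk c by simp
    qed
    hence "range ?f \<subseteq> {x \<in> G. N x \<le> B}" by blast
    hence "finite (range ?f)" using finite_discrete_bounded[OF G] finite_subset by blast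
    hence "\<not> inj ?f" using finite_imageD infinite_UNIV_nat by blast
    then obtain i j where ij: "i < j" "?f i = ?f j" unfolding inj_def by (metis linorder_neqE_nat)
    define n where "n = j - i"
    have n: "n > 0" "j = n + i" using ij by (simp_all add: n_def)
    have "mmul (mpow x n) c = mmul c (mpow x n)"
    proof -
      have di: "det2 (mpow x i) = 1" and dn: "det2 (mpow x n) = 1" using dx by simp_all
      have "?f i = mmul (inv2 (mpow x i)) (mmul (mmul (inv2 (mpow x n)) (mmul c (mpow x n))) (mpow x i))"
        using ij(2) unfolding n(2) mpow_add inv2_mmul by (simp add: mmul_assoc)
      hence "c = mmul (inv2 (mpow x n)) (mmul c (mpow x n))"
        using di by (simp add: mmul_left_cancel mmul_right_cancel)
      thus ?thesis using dn by (metis mmul_inv2_cancel(1))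
    qed
    moreover have "conj2 m (mpow x n) = (l ^ n, 0, 0, 1 / l ^ n)"
      unfolding conj2_mpow[OF m] l by (induction n) (simp_all add: id2_def)
    moreover have "a (l ^ n) > 1" using l(1) n(1) by (simp add: a_power one_less_power)
    ultimately obtain u v where c': "conj2 m c = (u, 0, 0, v)"
      using commutes_diagonal[of "conj2 m c" "l ^ n" "1 / l ^ n"] one_div_ne conj2_mmul[OF m] by metis
    \<comment> \<open>As \<open>c\<close> is diagonal in the eigenbasis of \<open>x\<close>, so is
      \<open>b'\<close>, which equals c x. Being conjugate to \<open>x\<close>, it has the
      eigenvalues \<open>l\<close> and \<open>1 / l\<close> in one of the two orders.\<close>
    define b' where "b' = mmul b (mmul x (inv2 b))"
    have "b' = mmul c x" unfolding b'_def c_def using dx by (simp add: mmul_assoc)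
    hence b'c: "conj2 m b' = (u * l, 0, 0, v * (1 / l))" by (simp add: conj2_mmul[OF m] c' l)
    have "mtr b' = mtr x" unfolding b'_def using b mtr_conj by blast
    hence "u * l + v * (1 / l) = l + 1 / l"
      using mtr_conj2[OF m, of b'] mtr_conj2[OF m, of x] unfolding b'c l by simp
    moreover have "det2 b' = 1" unfolding b'_def using b dx by simp
    hence "u * l * (v * (1 / l)) = 1" using det2_conj2[OF m, of b'] unfolding b'c by simp
    ultimately have cases: "conj2 m b' = (l, 0, 0, 1 / l) \<or> conj2 m b' = (1 / l, 0, 0, l)"
      using diagonal_eq[OF l0, of "u * l" "v * (1 / l)"] unfolding b'c by auto
    have "mmul b x = mmul b' b" unfolding b'_def using b by (simp add: mmul_assoc)
    hence bx: "mmul (conj2 m b) (l, 0, 0, 1 / l) = mmul (conj2 m b') (conj2 m b)"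
      using conj2_mmul[OF m] l by metis
    have tb: "mtr (conj2 m b) = l + 1 / l"
      using m dy mtr_conj[OF dy, of x] mtr_conj2[OF m, of x] by (simp add: b_def l)
    \<comment> \<open>If \<open>b\<close> inverted \<open>x\<close>, it would be antidiagonal with
      trace 0, but its trace is that of \<open>x\<close>. So \<open>b\<close> is itself diagonal,
      and the same trace argument identifies it with \<open>x\<close> or
      \<open>inv2 x\<close>.\<close>
    obtain u v where b2: "conj2 m b = (u, 0, 0, v)"
    proof -
      have "\<not> conj2 m b' = (1 / l, 0, 0, l)"
      proof
        assume "conj2 m b' = (1 / l, 0, 0, l)"
        then obtain u v where "conj2 m b = (0, u, v, 0)"
          using anticommutes_diagonal[OF _ ne, of "conj2 m b"] bx by auto
        hence "l + 1 / l = 0" using tb by simp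
        hence "mtr (conj2 m x) = 0" unfolding l by simp
        thus False using t m by simp
      qed
      thus ?thesis using that commutes_diagonal[OF _ ne, of "conj2 m b"] bx cases by auto
    qed
    have "u * v = 1" using det2_conj2[OF m, of b] b b2 by simp
    moreover have "u + v = l + 1 / l" using tb b2 by simp
    ultimately have "conj2 m b = conj2 m x \<or> conj2 m b = conj2 m (inv2 x)"
      using diagonal_eq[OF l0, of u v] l b2 by (auto simp: conj2_inv2[OF m])
    hence "b = x \<or> b = inv2 x" using conj2_inject[OF m] by blast
    moreover have "mmul y x = mmul b y" unfolding b_def using dy by (simp add: mmul_assoc)
    ultimately show ?thesis by auto
  qed
  thus ?thesis using t by blast
qed

subsection \<open>Midpoints\<close>

text \<open>The midpoint between the standard lattice and \<open>Lat b\<close> is spanned by a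
  column of \<open>b\<close> containing an entry of maximal absolute value and by \<open>c\<close>
  times the standard vector of the other row.\<close>

lemma ex_midpoint_aux:
  fixes b :: "'k mat2"
  assumes c: "a c \<le> N b" "a (det2 b) = a c * a c"
  shows "\<exists>m. a (det2 m) = a c * N b \<and> N m = N b \<and> E m b = a c * N b"
proof (cases b)
  fix p q r s assume b: "b = (p, q, r, s)"
  have Nb: "a p \<le> N b" "a q \<le> N b" "a r \<le> N b" "a s \<le> N b" unfolding b by auto
  have dc: "a (p * s - q * r) \<le> a c * N b"
  proof -
    have "a c * a c \<le> a c * N b" using c by (intro mult_left_mono) auto
    thus ?thesis using c(2) unfolding b by simp
  qed
  have le: "a (c * u) \<le> a c * N b" if "a u \<le> N b" for u
    unfolding a_mult using that by (intro mult_left_mono) auto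
  have eqI: "N (x, y, z, w) = t" if "a x \<le> t" "a y \<le> t" "a z \<le> t" "a w \<le> t" "t \<in> {a x, a y, a z, a w}" for x y z w t
    using that by auto
  have "N b = a p \<or> N b = a q \<or> N b = a r \<or> N b = a s" unfolding b by (auto simp: max_def)
  thus ?thesis
  proof (elim disjE)
    assume 1: "N b = a p"
    have E: "mmul (inv2 (p, 0, r, c)) b = (c * p, c * q, 0, p * s - q * r)"
      unfolding b by (simp add: algebra_simps)
    have "N (p, 0, r, c) = N b" using Nb c(1) 1 by (intro eqI) auto
    moreover have "E (p, 0, r, c) b = a c * N b"
      unfolding E_def E using Nb dc 1 by (intro eqI le) (auto simp: a_mult)
    moreover have "a (det2 (p, 0, r, c)) = a c * N b" using 1 by (simp add: a_mult mult.commute)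
    ultimately show ?thesis by blast
  next
    assume 1: "N b = a q"
    have E: "mmul (inv2 (q, 0, s, c)) b = (c * p, c * q, - (p * s - q * r), 0)"
      unfolding b by (simp add: algebra_simps)
    have "N (q, 0, s, c) = N b" using Nb c(1) 1 by (intro eqI) auto
    moreover have "E (q, 0, s, c) b = a c * N b"
      unfolding E_def E using Nb dc 1 by (intro eqI le) (auto simp: a_mult simp del: minus_diff_eq)
    moreover have "a (det2 (q, 0, s, c)) = a c * N b" using 1 by (simp add: a_mult mult.commute)
    ultimately show ?thesis by blast
  next
    assume 1: "N b = a r"
    have E: "mmul (inv2 (p, c, r, 0)) b = (- (c * r), - (c * s), 0, p * s - q * r)"
      unfolding b by (simp add: algebra_simps)
    have "N (p, c, r, 0) = N b" using Nb c(1) 1 by (intro eqI) auto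
    moreover have "E (p, c, r, 0) b = a c * N b"
      unfolding E_def E a_uminus using Nb dc 1 le by (intro eqI) (auto simp: a_mult)
    moreover have "a (det2 (p, c, r, 0)) = a c * N b" using 1 by (simp add: a_mult mult.commute)
    ultimately show ?thesis by blast
  next
    assume 1: "N b = a s"
    have E: "mmul (inv2 (q, c, s, 0)) b = (- (c * r), - (c * s), - (p * s - q * r), 0)"
      unfolding b by (simp add: algebra_simps)
    have "N (q, c, s, 0) = N b" using Nb c(1) 1 by (intro eqI) auto
    moreover have "E (q, c, s, 0) b = a c * N b"
      unfolding E_def E a_uminus using Nb dc 1 le by (intro eqI) (auto simp: a_mult simp del: minus_diff_eq)
    moreover have "a (det2 (q, c, s, 0)) = a c * N b" using 1 by (simp add: a_mult mult.commute)
    ultimately show ?thesis by blast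
  qed
qed

text \<open>Determinants of equal absolute value put the vertices at even distance, so the midpoint
  is a vertex and not the middle of an edge.\<close>

lemma ex_midpoint:
  assumes p: "det2 p \<noteq> 0" and q: "a (det2 q) = a (det2 p)"
  shows "\<exists>m h. det2 m \<noteq> 0 \<and> h > 0 \<and> dd p m = h \<and> dd m q = h \<and> dd p q = h * h"
proof -
  define b where "b = mmul (inv2 p) q"
  have Nb: "N b = E p q" by (simp add: b_def E_def)
  have "a (det2 p) * a (det2 p) \<le> N b * N b"
    using E_ge_det[of p q] unfolding Nb q by (simp add: power2_eq_square)
  hence le: "a (det2 p) \<le> N b" by (metis N_nonneg abs_of_nonneg a_nonneg abs_le_square_iff power2_eq_square)
  have db: "a (det2 b) = a (det2 p) * a (det2 p)" by (simp add: b_def a_mult q)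
  obtain m where m: "a (det2 m) = a (det2 p) * N b" "N m = N b" "E m b = a (det2 p) * N b"
    using ex_midpoint_aux[OF le db] by blast
  define d where "d = a (det2 p)"
  have d: "d > 0" using p by (simp add: d_def)
  have n: "N b > 0" using le d unfolding d_def by linarith
  have dm: "det2 m \<noteq> 0" using m(1) d n unfolding d_def by (metis a_zero mult_pos_pos less_irrefl)
  have "dd p (mmul p m) = dd (mmul p id2) (mmul p m)" by simp
  also have "\<dots> = dd id2 m" by (rule dd_mmul_left[OF p])
  also have "\<dots> = N b / d"
    unfolding dd_def using m d n by (simp add: E_id2 power2_eq_square flip: d_def)
  finally have 1: "dd p (mmul p m) = N b / d" .
  have "mmul p b = smul (det2 p) q" unfolding b_def by (simp flip: mmul_assoc add: mmul_inv2_smul)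
  hence "dd (mmul p m) q = dd (mmul p m) (mmul p b)" using dd_smul(2)[OF p] by simp
  also have "\<dots> = dd m b" by (rule dd_mmul_left[OF p])
  also have "\<dots> = N b / d"
    unfolding dd_def m db using d n by (simp add: power2_eq_square flip: d_def)
  finally have 2: "dd (mmul p m) q = N b / d" .
  have "dd p q = N b / d * (N b / d)"
    unfolding dd_def q using Nb by (simp add: power2_eq_square d_def)
  thus ?thesis using 1 2 d n p dm by (intro exI[of _ "mmul p m"] exI[of _ "N b / d"]) auto
qed

text \<open>An isometry preserving the pair sends the midpoint to a point equally far from both
  vertices, and the four-point inequality shows that such a point at this distance is
  unique.\<close>

lemma pair_fixes_vertex:
  assumes p: "det2 p \<noteq> 0" "det2 q \<noteq> 0" "a (det2 q) = a (det2 p)"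
    and F: "\<And>g. g \<in> F \<Longrightarrow> det2 g = 1 \<and>
      (act_vertex g (V p) = V p \<and> act_vertex g (V q) = V q \<or> act_vertex g (V p) = V q \<and> act_vertex g (V q) = V p)"
  shows "\<exists>m. det2 m \<noteq> 0 \<and> (\<forall>g\<in>F. act_vertex g (V m) = V m)"
proof -
  obtain m h where m: "det2 m \<noteq> 0" and h: "h > 0" "dd p m = h" "dd m q = h" "dd p q = h * h"
    using ex_midpoint[OF p(1,3)] by blast
  have "act_vertex g (V m) = V m" if g: "g \<in> F" for g
  proof -
    have dg: "det2 g = 1" using F[OF g] by blast
    have gm: "dd (mmul g x) (mmul g m) = dd x m" for x using dd_mmul_left dg by simp
    have "dd p (mmul g m) = h \<and> dd (mmul g m) q = h"
      using F[OF g]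
    proof (elim conjE disjE)
      assume "act_vertex g (V p) = V p" "act_vertex g (V q) = V q"
      hence "dd (mmul g p) (mmul g m) = dd p (mmul g m)" "dd (mmul g q) (mmul g m) = dd q (mmul g m)"
        using p m dg by (auto intro!: dd_cong simp: act_vertex_V)
      thus ?thesis using gm h dd_commute by metis
    next
      assume "act_vertex g (V p) = V q" "act_vertex g (V q) = V p"
      hence "dd (mmul g p) (mmul g m) = dd q (mmul g m)" "dd (mmul g q) (mmul g m) = dd p (mmul g m)"
        using p m dg by (auto intro!: dd_cong simp: act_vertex_V)
      thus ?thesis using gm h dd_commute by metis
    qed
    hence "dd m (mmul g m) * (h * h) \<le> h * h"
      using dd_four_point[of m p "mmul g m" q] m p dg h dd_commute[of m p] by simp
    hence "dd m (mmul g m) \<le> 1" using h(1) by (simp add: mult_le_cancel_right1)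
    hence "dd m (mmul g m) = 1" using dd_ge_1[of m "mmul g m"] m dg by simp
    hence "V m = V (mmul g m)" using V_eq_iff[of m "mmul g m"] m dg by simp
    thus ?thesis unfolding act_vertex_V by (rule sym)
  qed
  thus ?thesis using m by blast
qed

subsection \<open>Discrete elementary groups\<close>

text \<open>Zero translation of all generators along an end yields a fixed vertex; nonzero
  translation yields a hyperbolic element to which \<open>normalizes_hyperbolic\<close> applies.
  Either outcome can be tested on the generators, so it survives passage to nearby groups.\<close>

lemma elementary_cases:
  assumes g: "\<forall>i<r. g i \<in> SL2" and disc: "discrete_subgroup a (gen_grp g r)" and el: "elementary a (gen_grp g r)"
  shows "(\<exists>m. det2 m \<noteq> 0 \<and> (\<forall>i<r. act_vertex (g i) (V m) = V m)) \<or>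
    (\<exists>x\<in>gen_grp g r. a (mtr x) > 1 \<and> (\<forall>y\<in>gen_grp g r. mmul y x = mmul x y \<or> mmul y x = mmul (inv2 x) y))"
    (is "?fix \<or> ?hyp")
proof -
  let ?G = "gen_grp g r"
  have G: "is_grp ?G" using is_grp_gen_grp[OF g] .
  note cl = is_grpD(3,4)[OF G] and det = is_grpD(2)[OF G]
  have gG: "g i \<in> ?G" if "i < r" for i using gen_in_gen_grp[OF that] .
  have hyp: ?hyp if ray: "BT_ray a \<rho>" and x: "x \<in> ?G" "shift \<rho> x s" "s \<noteq> 0"
    and conj: "\<And>y. y \<in> ?G \<Longrightarrow> \<exists>t. shift \<rho> (mmul y (mmul x (inv2 y))) t" for \<rho> x s
  proof (cases "s > 0")
    case True
    show ?thesis using normalizes_hyperbolic[OF G disc ray x(1,2) True conj] x(1) by blast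
  next
    case False
    have dx: "det2 x = 1" using det x by blast
    have conj': "\<exists>t. shift \<rho> (mmul y (mmul (inv2 x) (inv2 y))) t" if y: "y \<in> ?G" for y
    proof -
      obtain t where "shift \<rho> (mmul y (mmul x (inv2 y))) t" using conj[OF y] by blast
      hence "shift \<rho> (inv2 (mmul y (mmul x (inv2 y)))) (- t)"
        using dx det[OF y] by (intro shift_inv2) auto
      thus ?thesis by (auto simp: inv2_mmul mmul_assoc)
    qed
    have "- s > 0" using False x(3) by simp
    from normalizes_hyperbolic[OF G disc ray cl(1)[OF x(1)] shift_inv2[OF x(2) dx] this conj']
    show ?thesis using cl(1)[OF x(1)] by blast
  qed
  have fix0: ?fix if ray: "BT_ray a \<rho>" and sh: "\<And>i. i < r \<Longrightarrow> shift \<rho> (g i) 0" for \<rho>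
  proof -
    obtain K where K: "\<forall>f\<in>g ` {..<r}. \<forall>i\<ge>K. act_vertex f (\<rho> i) = \<rho> i"
      using shift_zero_common[of "g ` {..<r}" \<rho>] sh by blast
    obtain m where m: "det2 m \<noteq> 0" "\<rho> K = V m" using BT_ray_reps[OF ray] by blast
    have "act_vertex (g i) (V m) = V m" if "i < r" for i
      using K that unfolding m(2)[symmetric] by blast
    thus ?thesis using m(1) by blast
  qed
  from el consider
      (v) v where "v \<in> BT_vertices a" "\<forall>x\<in>?G. act_vertex x v = v"
    | (e) \<rho> where "BT_ray a \<rho>" "\<forall>x\<in>?G. same_end (act_vertex x \<circ> \<rho>) \<rho>"
    | (p) \<rho> \<sigma> where "BT_ray a \<rho>" "\<not> same_end \<rho> \<sigma>"
       "\<forall>x\<in>?G. (same_end (act_vertex x \<circ> \<rho>) \<rho> \<and> same_end (act_vertex x \<circ> \<sigma>) \<sigma>) \<or>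
                (same_end (act_vertex x \<circ> \<rho>) \<sigma> \<and> same_end (act_vertex x \<circ> \<sigma>) \<rho>)"
    unfolding elementary_def by blast
  thus ?thesis
  proof cases
    case v
    thus ?thesis using gG unfolding BT_vertices_eq by blast
  next
    case e
    have sh: "\<exists>s. shift \<rho> x s" if "x \<in> ?G" for x using e(2) that shift_same_end by blast
    show ?thesis
    proof (cases "\<exists>i<r. \<exists>s. s \<noteq> 0 \<and> shift \<rho> (g i) s")
      case True
      then obtain i s where i: "i < r" "s \<noteq> 0" "shift \<rho> (g i) s" by blast
      have "\<exists>t. shift \<rho> (mmul y (mmul (g i) (inv2 y))) t" if "y \<in> ?G" for y
        by (rule sh[OF cl(2)[OF that cl(2)[OF gG[OF i(1)] cl(1)[OF that]]]])
      thus ?thesis using hyp[OF e(1) gG[OF i(1)] i(3,2)] by blast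
    next
      case False
      hence "shift \<rho> (g i) 0" if "i < r" for i using sh gG that by metis
      thus ?thesis using fix0[OF e(1)] by blast
    qed
  next
    case p
    let ?fx = "\<lambda>x. same_end (act_vertex x \<circ> \<rho>) \<rho> \<and> same_end (act_vertex x \<circ> \<sigma>) \<sigma>"
    let ?sw = "\<lambda>x. same_end (act_vertex x \<circ> \<rho>) \<sigma> \<and> same_end (act_vertex x \<circ> \<sigma>) \<rho>"
    have alt: "?fx x \<or> ?sw x" if "x \<in> ?G" for x using p(3) that by blast
    have shift_fx: "?fx x" if "x \<in> ?G" "shift \<rho> x s" for x s
    proof (rule ccontr)
      assume "\<not> ?fx x"
      hence "same_end (act_vertex x \<circ> \<rho>) \<sigma>" using alt that by blast
      moreover have "same_end (act_vertex x \<circ> \<rho>) \<rho>" using that shift_same_end by blast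
      ultimately have "same_end \<rho> \<sigma>" by (meson same_end_sym same_end_trans)
      thus False using p(2) by blast
    qed
    show ?thesis
    proof (cases "\<exists>x\<in>?G. \<exists>s. s \<noteq> 0 \<and> shift \<rho> x s")
      case True
      then obtain x s where x: "x \<in> ?G" "s \<noteq> 0" "shift \<rho> x s" by blast
      have fx: "?fx x" using shift_fx x by blast
      \<comment> \<open>Since \<open>x\<close> fixes both ends, its conjugates fix the end of
        \<open>\<rho>\<close> even when \<open>y\<close> exchanges the ends.\<close>
      have "\<exists>t. shift \<rho> (mmul y (mmul x (inv2 y))) t" if y: "y \<in> ?G" for y
        unfolding shift_same_end using alt[OF y]
      proof
        assume fy: "?fx y"
        show "same_end (act_vertex (mmul y (mmul x (inv2 y))) \<circ> \<rho>) \<rho>"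
          by (rule same_end_act_mmul[OF same_end_act_mmul[OF same_end_act_inv2[OF _ det[OF y]]
                conjunct1[OF fx]] conjunct1[OF fy]]) (use fy in blast)
      next
        assume sy: "?sw y"
        show "same_end (act_vertex (mmul y (mmul x (inv2 y))) \<circ> \<rho>) \<rho>"
          by (rule same_end_act_mmul[OF same_end_act_mmul[OF same_end_act_inv2[OF _ det[OF y]]
                conjunct2[OF fx]] conjunct2[OF sy]]) (use sy in blast)
      qed
      thus ?thesis using hyp[OF p(1) x(1,3,2)] by blast
    next
      case False
      hence zero: "shift \<rho> x 0" if "x \<in> ?G" "same_end (act_vertex x \<circ> \<rho>) \<rho>" for x
        using that shift_same_end by metis
      show ?thesis
      proof (cases "\<forall>i<r. ?fx (g i)")
        case True
        hence "shift \<rho> (g i) 0" if "i < r" for i using zero gG that by blast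
        thus ?thesis using fix0[OF p(1)] by blast
      next
        case nonfix: False
        then obtain j where j: "j < r" "?sw (g j)" using alt gG by blast
        define s where "s = g j"
        have s: "s \<in> ?G" "det2 s = 1" "?sw s" using j gG det by (auto simp: s_def)
        have s': "?sw (inv2 s)" using s same_end_act_inv2 by blast
        \<comment> \<open>That \<open>g i\<close> preserves the pair of \<open>V m\<close> and its
          image under \<open>s\<close> means that two of these products fix \<open>V m\<close>: the
          first two if \<open>g i\<close> fixes the ends, the last two if it exchanges them. The
          intersection keeps the elements without translation.\<close>
        define F where "F = (\<Union>i<r. {g i, mmul (inv2 s) (mmul (g i) s), mmul (inv2 s) (g i), mmul (g i) s})
          \<inter> {x. shift \<rho> x 0}"
        have "finite F" unfolding F_def by (intro finite_Int disjI1 finite_UN_I) auto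
        then obtain K where K: "\<forall>f\<in>F. \<forall>i\<ge>K. act_vertex f (\<rho> i) = \<rho> i"
          using shift_zero_common[of F \<rho>] unfolding F_def by blast
        obtain m where m: "det2 m \<noteq> 0" "\<rho> K = V m" using BT_ray_reps[OF p(1)] by blast
        have F: "act_vertex f (V m) = V m" if "f \<in> F" for f
          using K that unfolding m(2)[symmetric] by blast
        have "\<exists>m. det2 m \<noteq> 0 \<and> (\<forall>x\<in>g ` {..<r}. act_vertex x (V m) = V m)"
        proof (rule pair_fixes_vertex[OF m(1)])
          show "det2 (mmul s m) \<noteq> 0" "a (det2 (mmul s m)) = a (det2 m)" using s m by simp_all
          fix x assume "x \<in> g ` {..<r}"
          then obtain i where i: "i < r" "x = g i" by blast
          have x: "x \<in> ?G" using gG i by blast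
          have Vs: "V (mmul s m) = act_vertex s (V m)" by (simp add: act_vertex_V)
          have "act_vertex x (V m) = V m \<and> act_vertex x (V (mmul s m)) = V (mmul s m) \<or>
            act_vertex x (V m) = V (mmul s m) \<and> act_vertex x (V (mmul s m)) = V m"
            using alt[OF x]
          proof
            assume fx: "?fx x"
            have "same_end (act_vertex (mmul (inv2 s) (mmul x s)) \<circ> \<rho>) \<rho>"
              by (rule same_end_act_mmul[OF same_end_act_mmul[OF conjunct1[OF s(3)] conjunct2[OF fx]] conjunct2[OF s']])
            hence "x \<in> F" "mmul (inv2 s) (mmul x s) \<in> F"
              unfolding F_def using fx x i zero cl s by auto
            hence "act_vertex x (V m) = V m" "act_vertex (inv2 s) (act_vertex x (act_vertex s (V m))) = V m"
              using F by (simp_all flip: act_vertex_mmul)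
            thus ?thesis unfolding Vs using act_vertex_inv2[OF s(2)] by blast
          next
            assume sw: "?sw x"
            have "same_end (act_vertex (mmul (inv2 s) x) \<circ> \<rho>) \<rho>" "same_end (act_vertex (mmul x s) \<circ> \<rho>) \<rho>"
              by (rule same_end_act_mmul[OF conjunct1[OF sw] conjunct2[OF s']],
                  rule same_end_act_mmul[OF conjunct1[OF s(3)] conjunct2[OF sw]])
            hence "mmul (inv2 s) x \<in> F" "mmul x s \<in> F"
              unfolding F_def using x i zero cl s by auto
            hence "act_vertex (inv2 s) (act_vertex x (V m)) = V m" "act_vertex x (act_vertex s (V m)) = V m"
              using F by (simp_all flip: act_vertex_mmul)
            thus ?thesis unfolding Vs using act_vertex_inv2[OF s(2)] by blast
          qed
          thus "det2 x = 1 \<and> (act_vertex x (V m) = V m \<and> act_vertex x (V (mmul s m)) = V (mmul s m) \<or>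
            act_vertex x (V m) = V (mmul s m) \<and> act_vertex x (V (mmul s m)) = V m)"
            using det x by blast
        qed
        thus ?thesis by blast
      qed
    qed
  qed
qed

subsection \<open>Limits\<close>

lemma mconverges_iff: "mconverges a f l \<longleftrightarrow> (\<forall>e>0. \<forall>\<^sub>F n in sequentially. N (msub (f n) l) < e)"
  unfolding mconverges_def mdist_eq_mnorm eventually_sequentially ..

lemma mconvergesD: "mconverges a f l \<Longrightarrow> e > 0 \<Longrightarrow> \<forall>\<^sub>F n in sequentially. N (msub (f n) l) < e"
  unfolding mconverges_iff by blast

lemma mconverges_const: "mconverges a (\<lambda>_. l) l"
proof -
  have "N (msub l l) = 0" by simp
  thus ?thesis unfolding mconverges_iff by (simp del: N_msub_eq_0)
qed

lemma mconverges_inv2: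
  assumes "mconverges a f l"
  shows "mconverges a (\<lambda>n. inv2 (f n)) (inv2 l)"
proof -
  have "N (msub (inv2 x) (inv2 y)) = N (msub x y)" for x y
  proof -
    have "msub (inv2 x) (inv2 y) = inv2 (msub x y)" by (cases x; cases y) simp
    thus ?thesis by simp
  qed
  thus ?thesis using assms unfolding mconverges_iff by simp
qed

lemma mconverges_mmul:
  assumes f: "mconverges a f l" and h: "mconverges a h k"
  shows "mconverges a (\<lambda>n. mmul (f n) (h n)) (mmul l k)"
  unfolding mconverges_iff
proof (intro allI impI)
  fix e :: real assume e: "e > 0"
  define C where "C = max (N l) (N k) + 1"
  have C: "C > 0" "N l \<le> C" "N k \<le> C" "1 \<le> C"
    unfolding C_def using N_nonneg[of l] N_nonneg[of k] by linarith+
  have "\<forall>\<^sub>F n in sequentially. N (msub (f n) l) < e / C" "\<forall>\<^sub>F n in sequentially. N (msub (h n) k) < e / C"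
    "\<forall>\<^sub>F n in sequentially. N (msub (h n) k) < 1"
    using mconvergesD[OF f] mconvergesD[OF h] e C by simp_all
  thus "\<forall>\<^sub>F n in sequentially. N (msub (mmul (f n) (h n)) (mmul l k)) < e"
  proof eventually_elim
    fix n assume 1: "N (msub (f n) l) < e / C" "N (msub (h n) k) < e / C" "N (msub (h n) k) < 1"
    have "N (h n) \<le> C" using N_le_msub[of "h n" k] 1(3) C by linarith
    have "N (msub (mmul (f n) (h n)) (mmul l (h n))) \<le> N (msub (f n) l) * N (h n)"
      using N_mmul[of "msub (f n) l" "h n"] by (simp add: msub_mmul)
    also have "\<dots> \<le> N (msub (f n) l) * C" using \<open>N (h n) \<le> C\<close> by (intro mult_left_mono) auto
    also have "\<dots> < e" using 1(1) C by (simp add: pos_less_divide_eq)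
    finally have A: "N (msub (mmul (f n) (h n)) (mmul l (h n))) < e" .
    have "N (msub (mmul l (h n)) (mmul l k)) \<le> N l * N (msub (h n) k)"
      using N_mmul[of l "msub (h n) k"] by (simp add: msub_mmul)
    also have "\<dots> \<le> C * N (msub (h n) k)" using C by (intro mult_right_mono) auto
    also have "\<dots> < e" using 1(2) C by (simp add: pos_less_divide_eq mult.commute)
    finally show "N (msub (mmul (f n) (h n)) (mmul l k)) < e"
      using A N_msub_trans[of "mmul (f n) (h n)" "mmul l k" "mmul l (h n)"] by linarith
  qed
qed

lemma mconverges_unique:
  assumes "mconverges a f l" "\<forall>\<^sub>F n in sequentially. f n = k"
  shows "l = k"
proof (rule ccontr)
  assume "l \<noteq> k"
  hence "N (msub k l) > 0" using N_nonneg[of "msub k l"] N_msub_eq_0[of k l] by (auto simp: less_le)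
  from eventually_conj[OF mconvergesD[OF assms(1) this] assms(2)]
  obtain n where "N (msub (f n) l) < N (msub k l)" "f n = k"
    using eventually_happens[of _ sequentially] by force
  thus False by simp
qed

lemma mconverges_eval_word:
  assumes "\<forall>i<r. mconverges a (\<lambda>n. gn n i) (g i)" "valid_word r w"
  shows "mconverges a (\<lambda>n. eval_word (gn n) w) (eval_word g w)"
  using assms(2)
proof (induction w)
  case Nil
  then show ?case by (simp add: mconverges_const)
next
  case (Cons l w)
  obtain i b where l: "l = (i, b)" by (cases l)
  have "mconverges a (\<lambda>n. if b then gn n i else inv2 (gn n i)) (if b then g i else inv2 (g i))"
    using assms(1) Cons.prems mconverges_inv2 by (cases b) (auto simp: l)
  thus ?case using Cons by (simp add: l mconverges_mmul)
qed

lemma mconverges_SL2: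
  assumes "mconverges a f l" "\<And>n. det2 (f n) = 1"
  shows "det2 l = 1"
proof -
  have "mmul l (inv2 l) = id2"
    using mconverges_mmul[OF assms(1) mconverges_inv2[OF assms(1)]] assms(2)
    by (intro mconverges_unique) auto
  hence "smul (det2 l) id2 = id2" by (simp add: mmul_inv2_smul)
  thus ?thesis by (simp add: id2_def)
qed

end

section \<open>Passing discreteness, fixed vertices and relations between the limit and its
  approximants\<close>

theorem theorem1p6:
  fixes a :: "'k::field \<Rightarrow> real" and r :: nat
    and gn :: "nat \<Rightarrow> nat \<Rightarrow> 'k mat2" and g :: "nat \<Rightarrow> 'k mat2"
  assumes "nonarch_local_field a"
    and "r \<ge> 1"
    and "\<forall>n. \<forall>i<r. gn n i \<in> SL2"
    and "\<forall>n. discrete_subgroup a (gen_grp (gn n) r) \<and> \<not> elementary a (gen_grp (gn n) r)"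
    and "\<forall>w. valid_word r w \<longrightarrow> (\<exists>l. mconverges a (\<lambda>n. eval_word (gn n) w) l)"
    and "\<forall>i<r. mconverges a (\<lambda>n. gn n i) (g i)"
  shows "discrete_subgroup a (gen_grp g r) \<and> \<not> elementary a (gen_grp g r) \<and>
         (\<exists>N. \<forall>n\<ge>N. \<exists>\<psi>.
            (\<forall>x\<in>gen_grp g r. \<forall>y\<in>gen_grp g r. \<psi> (mmul x y) = mmul (\<psi> x) (\<psi> y)) \<and>
            \<psi> ` gen_grp g r = gen_grp (gn n) r \<and>
            (\<forall>i<r. \<psi> (g i) = gn n i))"
proof -
  interpret local_field a by unfold_locales (rule assms(1))
  note lim = mconverges_eval_word[OF assms(6)]
  have gn: "\<forall>i<r. gn n i \<in> SL2" for n using assms(3) by blast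
  have g: "\<forall>i<r. g i \<in> SL2"
  proof (intro allI impI)
    fix i assume i: "i < r"
    have "mconverges a (\<lambda>n. gn n i) (g i)" using assms(6) i by blast
    moreover have "det2 (gn n i) = 1" for n using gn[of n] i by (simp add: SL2_def)
    ultimately show "g i \<in> SL2" using mconverges_SL2[of "\<lambda>n. gn n i" "g i"] by (simp add: SL2_def)
  qed
  have G: "is_grp (gen_grp g r)" by (rule is_grp_gen_grp[OF g])
  have Gn: "is_grp (gen_grp (gn n) r)" for n by (rule is_grp_gen_grp[OF gn])
  have all_ev: "\<forall>\<^sub>F n in sequentially. \<forall>i<r. P i n" if "\<And>i. i < r \<Longrightarrow> \<forall>\<^sub>F n in sequentially. P i n"
    for P :: "nat \<Rightarrow> nat \<Rightarrow> bool"
    using eventually_ball_finite[of "{..<r}" "\<lambda>n i. P i n" sequentially] that by (simp add: Ball_def)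
  \<comment> \<open>A bound for the generators of G and, by the ultrametric inequality, for those of
    all late \<open>gn n\<close>. The summand 1 covers their distance from the limit and places
    \<open>id2\<close> in \<open>S\<close> below.\<close>
  define B where "B = 1 + (\<Sum>i<r. N (g i))"
  have B: "N (g i) \<le> B" if "i < r" for i
    using member_le_sum[of i "{..<r}" "\<lambda>i. N (g i)"] that by (simp add: B_def)
  have B1: "B \<ge> 1" by (simp add: B_def sum_nonneg)
  have bounded: "\<forall>\<^sub>F n in sequentially. \<forall>i<r. N (gn n i) \<le> B"
  proof (rule all_ev)
    fix i assume i: "i < r"
    have "\<forall>\<^sub>F n in sequentially. N (msub (gn n i) (g i)) < 1" using mconvergesD assms(6) i by simp
    thus "\<forall>\<^sub>F n in sequentially. N (gn n i) \<le> B"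
    proof eventually_elim
      fix n assume "N (msub (gn n i) (g i)) < 1"
      thus "N (gn n i) \<le> B" using N_le_msub[of "gn n i" "g i"] B[OF i] B1 by linarith
    qed
  qed
  obtain e where e: "e > 0" and unif: "\<And>h x. \<forall>i<r. h i \<in> SL2 \<and> N (h i) \<le> B \<Longrightarrow> discrete_subgroup a (gen_grp h r) \<Longrightarrow>
      \<not> elementary a (gen_grp h r) \<Longrightarrow> x \<in> gen_grp h r \<Longrightarrow> N (msub x id2) < e \<Longrightarrow> x = id2"
    using uniform_discreteness[OF B1] by blast
  have key: "\<forall>\<^sub>F n in sequentially. \<forall>x\<in>gen_grp (gn n) r. N (msub x id2) < e \<longrightarrow> x = id2"
    using bounded by eventually_elim (use unif gn assms(4) in blast)
  \<comment> \<open>Words with value within \<open>e\<close> of \<open>id2\<close> in the limit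
    eventually fall into the common gap. Values near \<open>id2\<close> give discreteness of G,
    values equal to \<open>id2\<close> give the transfer of relations.\<close>
  have near: "\<forall>\<^sub>F n in sequentially. eval_word (gn n) w = id2"
    if w: "valid_word r w" "N (msub (eval_word g w) id2) < e" for w
    using key mconvergesD[OF lim[OF w(1)] e]
  proof eventually_elim
    fix n assume 1: "\<forall>x\<in>gen_grp (gn n) r. N (msub x id2) < e \<longrightarrow> x = id2"
      and 2: "N (msub (eval_word (gn n) w) (eval_word g w)) < e"
    have "N (msub (eval_word (gn n) w) id2) < e"
      using N_msub_trans[of "eval_word (gn n) w" id2 "eval_word g w"] 2 w(2) by linarith
    thus "eval_word (gn n) w = id2" using 1 gen_grpI[OF w(1)] by blast
  qed
  \<comment> \<open>The threshold still depends on the pair of words, so this may be applied to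
    finitely many pairs only.\<close>
  have rel: "\<forall>\<^sub>F n in sequentially. eval_word (gn n) u = eval_word (gn n) v"
    if uv: "valid_word r u" "valid_word r v" "eval_word g u = eval_word g v" for u v
  proof -
    have "det2 (eval_word g v) = 1" using det2_eval_word[OF g uv(2)] .
    hence "eval_word g (u @ inv_word v) = id2" by (simp add: eval_word_append eval_word_inv_word uv(3))
    hence "N (msub (eval_word g (u @ inv_word v)) id2) < e" using e N_msub_eq_0[of id2 id2] by (simp del: N_msub_eq_0)
    hence "\<forall>\<^sub>F n in sequentially. eval_word (gn n) (u @ inv_word v) = id2" using near uv by simp
    thus ?thesis
    proof eventually_elim
      fix n assume 1: "eval_word (gn n) (u @ inv_word v) = id2"
      have "det2 (eval_word (gn n) v) = 1" using det2_eval_word[OF gn uv(2)] .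
      thus "eval_word (gn n) u = eval_word (gn n) v"
        using 1 by (metis eval_word_append eval_word_inv_word mmul_inv2(1) mmul_right_cancel det2_inv2)
    qed
  qed
  have disc: "discrete_subgroup a (gen_grp g r)"
  proof (rule discrete_subgroupI[OF G e])
    fix x assume "x \<in> gen_grp g r" and x: "N (msub x id2) < e"
    then obtain w where w: "valid_word r w" "x = eval_word g w" by (auto simp: gen_grp_def)
    show "x = id2" using mconverges_unique[OF lim[OF w(1)] near[OF w(1)]] x w(2) by simp
  qed
  have nonel: "\<not> elementary a (gen_grp g r)"
  proof
    assume "elementary a (gen_grp g r)"
    from elementary_cases[OF g disc this] show False
    proof (elim disjE exE bexE conjE)
      fix m assume m: "det2 m \<noteq> 0" "\<forall>i<r. act_vertex (g i) (V m) = V m"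
      obtain d where d: "d > 0" "\<And>u. det2 u = 1 \<Longrightarrow> N (msub u id2) < d \<Longrightarrow> act_vertex u (V m) = V m"
        using vertex_stabilizer_open[OF m(1)] by blast
      have "\<forall>\<^sub>F n in sequentially. \<forall>i<r. act_vertex (gn n i) (V m) = V m"
      proof (rule all_ev)
        fix i assume i: "i < r"
        have di: "det2 (g i) = 1" using g i by (simp add: SL2_def)
        have "d / B > 0" using d B1 by simp
        hence "\<forall>\<^sub>F n in sequentially. N (msub (gn n i) (g i)) < d / B" using mconvergesD assms(6) i by blast
        thus "\<forall>\<^sub>F n in sequentially. act_vertex (gn n i) (V m) = V m"
        proof eventually_elim
          fix n assume 1: "N (msub (gn n i) (g i)) < d / B"
          \<comment> \<open>The quotient of \<open>gn n i\<close> by its limit lies in the open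
            stabilizer; the divisor \<open>B\<close> in the chosen distance compensates for the
            multiplication by \<open>inv2 (g i)\<close>.\<close>
          let ?u = "mmul (inv2 (g i)) (gn n i)"
          have "N (msub ?u id2) \<le> N (g i) * N (msub (gn n i) (g i))" by (rule N_msub_inv2_mmul[OF di])
          also have "\<dots> \<le> B * N (msub (gn n i) (g i))" using B[OF i] by (intro mult_right_mono) auto
          also have "\<dots> < d" using 1 B1 by (simp add: pos_less_divide_eq mult.commute)
          finally have "act_vertex ?u (V m) = V m" using d(2)[of ?u] gn[of n] i di by (simp add: SL2_def)
          hence "act_vertex (mmul (g i) ?u) (V m) = V m" using m(2) i by (simp add: act_vertex_mmul)
          thus "act_vertex (gn n i) (V m) = V m" using di by simp
        qed
      qed
      then obtain n where n: "\<forall>i<r. act_vertex (gn n i) (V m) = V m"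
        using eventually_happens[of _ sequentially] by force
      have "act_vertex x (V m) = V m" if "x \<in> gen_grp (gn n) r" for x
        using that
      proof (induction rule: gen_grp_induct)
        case (gen x i)
        have "det2 (gn n i) = 1" using gn gen.hyps by (simp add: SL2_def)
        thus ?case using n gen by (simp add: act_vertex_mmul act_vertex_inv2)
      qed simp
      hence "elementary a (gen_grp (gn n) r)" using m(1) V_in_BT unfolding elementary_def by blast
      thus False using assms(4) by blast
    next
      fix x assume x: "x \<in> gen_grp g r" "1 < a (mtr x)"
        and norm: "\<forall>y\<in>gen_grp g r. mmul y x = mmul x y \<or> mmul y x = mmul (inv2 x) y"
      obtain w where w: "valid_word r w" "x = eval_word g w" using x by (auto simp: gen_grp_def)
      let ?x = "\<lambda>n. eval_word (gn n) w"
      have "\<forall>\<^sub>F n in sequentially. \<forall>i<r. mmul (gn n i) (?x n) = mmul (?x n) (gn n i) \<or>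
          mmul (gn n i) (?x n) = mmul (inv2 (?x n)) (gn n i)"
      proof (rule all_ev)
        fix i assume i: "i < r"
        have "mmul (g i) x = mmul x (g i) \<or> mmul (g i) x = mmul (inv2 x) (g i)"
          using norm gen_in_gen_grp[OF i] by blast
        thus "\<forall>\<^sub>F n in sequentially. mmul (gn n i) (?x n) = mmul (?x n) (gn n i) \<or>
          mmul (gn n i) (?x n) = mmul (inv2 (?x n)) (gn n i)"
        proof
          assume "mmul (g i) x = mmul x (g i)"
          hence "\<forall>\<^sub>F n in sequentially. eval_word (gn n) ((i, True) # w) = eval_word (gn n) (w @ [(i, True)])"
            using w i by (intro rel) (simp_all add: eval_word_append)
          thus ?thesis by eventually_elim (simp add: eval_word_append)
        next
          assume "mmul (g i) x = mmul (inv2 x) (g i)"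
          hence "\<forall>\<^sub>F n in sequentially. eval_word (gn n) ((i, True) # w) = eval_word (gn n) (inv_word w @ [(i, True)])"
            using w i by (intro rel) (simp_all add: eval_word_append eval_word_inv_word)
          thus ?thesis by eventually_elim (simp add: eval_word_append eval_word_inv_word)
        qed
      qed
      from eventually_happens[OF eventually_conj[OF this mconvergesD[OF lim[OF w(1)] zero_less_one]]]
      obtain n where n: "\<And>i. i < r \<Longrightarrow> mmul (gn n i) (?x n) = mmul (?x n) (gn n i) \<or>
          mmul (gn n i) (?x n) = mmul (inv2 (?x n)) (gn n i)" "N (msub (?x n) x) < 1"
        unfolding w(2) by force
      \<comment> \<open>A change of the trace by less than 1, hence by less than
        \<open>a (mtr x)\<close>, leaves its absolute value unchanged, so \<open>?x n\<close> is
        hyperbolic as well.\<close>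
      have "a (mtr (?x n) - mtr x) \<le> N (msub (?x n) x)"
      proof -
        have "mtr (msub (?x n) x) = mtr (?x n) - mtr x" by (cases "?x n"; cases x) simp
        thus ?thesis using a_mtr[of "msub (?x n) x"] by simp
      qed
      hence "a (mtr x + (mtr (?x n) - mtr x)) = a (mtr x)" using n(2) x(2) by (intro a_add_eq) linarith
      hence "1 < a (mtr (?x n))" using x(2) by simp
      hence "elementary a (gen_grp (gn n) r)"
        using n(1) det2_eval_word[OF gn w(1)] by (intro elementary_normalizes_hyperbolic[OF gn, where x = "?x n"])
      thus False using assms(4) by blast
    qed
  qed
  define S where "S = {x \<in> gen_grp g r. N x \<le> B}"
  have finS: "finite S" unfolding S_def by (rule finite_discrete_bounded[OF G disc])
  have "\<forall>x\<in>S. \<exists>w. valid_word r w \<and> eval_word g w = x" unfolding S_def gen_grp_def by blast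
  then obtain W where W: "\<And>x. x \<in> S \<Longrightarrow> valid_word r (W x)" "\<And>x. x \<in> S \<Longrightarrow> eval_word g (W x) = x" by metis
  have gS: "g i \<in> S" "inv2 (g i) \<in> S" if "i < r" for i
    using that B gen_in_gen_grp[OF that, of g] is_grpD(3)[OF G] by (simp_all add: S_def)
  have idS: "id2 \<in> S" using B1 is_grpD(1)[OF G] by (simp add: S_def)
  let ?\<phi> = "\<lambda>n x. eval_word (gn n) (W x)"
  have "\<forall>\<^sub>F n in sequentially. \<forall>x\<in>S. \<forall>y\<in>S. mmul x y \<in> S \<longrightarrow> ?\<phi> n (mmul x y) = mmul (?\<phi> n x) (?\<phi> n y)"
  proof (intro eventually_ball_finite finS ballI)
    fix x y assume xy: "x \<in> S" "y \<in> S"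
    show "\<forall>\<^sub>F n in sequentially. mmul x y \<in> S \<longrightarrow> ?\<phi> n (mmul x y) = mmul (?\<phi> n x) (?\<phi> n y)"
    proof (cases "mmul x y \<in> S")
      case True
      have "\<forall>\<^sub>F n in sequentially. ?\<phi> n (mmul x y) = eval_word (gn n) (W x @ W y)"
        using W xy True by (intro rel) (simp_all add: eval_word_append)
      thus ?thesis by eventually_elim (simp add: eval_word_append)
    qed simp
  qed
  \<comment> \<open>The chosen word \<open>W x\<close> may be a roundabout expression even for
    \<open>id2\<close> or a generator; these relations align it with the empty word or the single
    letter.\<close>
  moreover have "\<forall>\<^sub>F n in sequentially. ?\<phi> n id2 = eval_word (gn n) []"
    using W idS by (intro rel) simp_all
  moreover have "\<forall>\<^sub>F n in sequentially. \<forall>i<r. ?\<phi> n (g i) = eval_word (gn n) [(i, True)]"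
    using W gS by (intro all_ev rel) simp_all
  moreover have "\<forall>\<^sub>F n in sequentially. \<forall>i<r. ?\<phi> n (inv2 (g i)) = eval_word (gn n) [(i, False)]"
    using W gS by (intro all_ev rel) simp_all
  ultimately have "\<forall>\<^sub>F n in sequentially. \<forall>w. valid_word r w \<longrightarrow> eval_word g w = id2 \<longrightarrow> eval_word (gn n) w = id2"
  proof eventually_elim
    fix n
    assume hom: "\<forall>x\<in>S. \<forall>y\<in>S. mmul x y \<in> S \<longrightarrow> ?\<phi> n (mmul x y) = mmul (?\<phi> n x) (?\<phi> n y)"
      and one: "?\<phi> n id2 = eval_word (gn n) []"
      and pos: "\<forall>i<r. ?\<phi> n (g i) = eval_word (gn n) [(i, True)]"
      and neg: "\<forall>i<r. ?\<phi> n (inv2 (g i)) = eval_word (gn n) [(i, False)]"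
    let ?l = "map (\<lambda>(i, b). if b then g i else inv2 (g i))"
    have ev: "mprod (?l w) = eval_word g w \<and> mprod (map (?\<phi> n) (?l w)) = eval_word (gn n) w \<and> set (?l w) \<subseteq> S"
      if "valid_word r w" for w
      using that
    proof (induction w)
      case (Cons l w)
      thus ?case using pos neg gS by (cases l) auto
    qed simp
    show "\<forall>w. valid_word r w \<longrightarrow> eval_word g w = id2 \<longrightarrow> eval_word (gn n) w = id2"
    proof (intro allI impI)
      fix w assume w: "valid_word r w" "eval_word g w = id2"
      have "mprod (map (?\<phi> n) (?l w)) = id2"
        using ev[OF w(1)] w(2) hom one
        by (intro relation_reduction[where S = S and G = "gen_grp g r" and R = B, OF _ G]) (auto simp: S_def)
      thus "eval_word (gn n) w = id2" using ev[OF w(1)] by simp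
    qed
  qed
  then obtain M where M: "\<And>n w. n \<ge> M \<Longrightarrow> valid_word r w \<Longrightarrow> eval_word g w = id2 \<Longrightarrow> eval_word (gn n) w = id2"
    unfolding eventually_sequentially by blast
  have "\<exists>\<psi>. (\<forall>x\<in>gen_grp g r. \<forall>y\<in>gen_grp g r. \<psi> (mmul x y) = mmul (\<psi> x) (\<psi> y)) \<and>
      \<psi> ` gen_grp g r = gen_grp (gn n) r \<and> (\<forall>i<r. \<psi> (g i) = gn n i)" if n: "n \<ge> M" for n
  proof -
    \<comment> \<open>This is well-definedness of the map on words rather than injectivity: words
      equal in G are equal in \<open>gen_grp (gn n) r\<close>.\<close>
    have inj: "eval_word (gn n) u = eval_word (gn n) v"
      if uv: "valid_word r u" "valid_word r v" "eval_word g u = eval_word g v" for u v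
    proof -
      have "eval_word g (u @ inv_word v) = id2"
        using det2_eval_word[OF g uv(2)] by (simp add: eval_word_append eval_word_inv_word uv(3))
      hence "eval_word (gn n) (u @ inv_word v) = id2" using M[OF n] uv by simp
      thus ?thesis
        using det2_eval_word[OF gn uv(2), of n]
        by (metis eval_word_append eval_word_inv_word mmul_inv2(1) mmul_right_cancel det2_inv2)
    qed
    define \<psi> where "\<psi> x = eval_word (gn n) (SOME w. valid_word r w \<and> eval_word g w = x)" for x
    have \<psi>: "\<psi> (eval_word g w) = eval_word (gn n) w" if w: "valid_word r w" for w
    proof -
      let ?P = "\<lambda>u. valid_word r u \<and> eval_word g u = eval_word g w"
      have "?P (SOME u. ?P u)" by (rule someI[of ?P w]) (simp add: w)
      thus ?thesis unfolding \<psi>_def using inj w by blast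
    qed
    have "\<psi> (mmul x y) = mmul (\<psi> x) (\<psi> y)" if xy: "x \<in> gen_grp g r" "y \<in> gen_grp g r" for x y
    proof -
      obtain u v where "valid_word r u" "valid_word r v" "x = eval_word g u" "y = eval_word g v"
        using xy by (auto simp: gen_grp_def)
      thus ?thesis using \<psi>[of "u @ v"] by (simp add: \<psi> eval_word_append)
    qed
    moreover have "\<psi> ` gen_grp g r = gen_grp (gn n) r"
    proof -
      have "gen_grp h r = eval_word h ` {w. valid_word r w}" for h :: "nat \<Rightarrow> 'k mat2"
        unfolding gen_grp_def by blast
      thus ?thesis using \<psi> by (simp add: image_image)
    qed
    moreover have "\<psi> (g i) = gn n i" if "i < r" for i
      using \<psi>[of "[(i, True)]"] that by simp
    ultimately show ?thesis by blast
  qed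
  thus ?thesis using disc nonel by blast
qed

end
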